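(* Let $V\in C^0(\mathbb R^d)$ with $V\ge 0$ and $V$ locally $C^2$ in a neighborhood of $\{V=0\}$. Then: (a) for every sequence $\psi_\varepsilon\in H^1(\mathbb R^d)$ (indexed by $\varepsilon\to0^+$) with $\int|\psi_\varepsilon|^2=1$ and $\liminf_{\varepsilon\to0}E_\varepsilon(\psi_\varepsilon)<\infty$, there exists a nonnegative measure $\gamma$ on $\mathbb R^d$ with $\gamma(\{V>0\})=0$ and $\gamma(\mathbb R^d)\le1$ such that $|\psi_\varepsilon|^2\rightharpoonup\gamma$ up to subsequences and $$\liminf_{\varepsilon\to0}E_\varepsilon(\psi_\varepsilon)\ \ge\ \frac12\int_{\mathbb R^d}\operatorname{tr}\big(\sqrt{D^2V}\big)\,d\gamma;$$ (b) for every $\gamma\in\mathcal P(\mathbb R^d)$ with $\gamma(\{V>0\})=0$ there exists a sequence $\psi_\varepsilon\in H^1(\mathbb R^d)$ with $\int|\psi_\varepsilon|^2=1$ such that $|\psi_\varepsilon|^2\rightharpoonup\gamma$ and $$\limsup_{\varepsilon\to0}E_\varepsilon(\psi_\varepsilon)\ \le\ \frac12\int_{\mathbb R^d}\operatorname{tr}\big(\sqrt{D^2V}\big)\,d\gamma.$$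
   Context: For $\varepsilon>0$ and $\psi\in H^1(\mathbb R^d)$, $$E_\varepsilon(\psi)=\int_{\mathbb R^d}\Big(\varepsilon^{1/2}\frac{|\nabla\psi(x)|^2}{2}+\varepsilon^{-1/2}V(x)|\psi(x)|^2\Big)dx .$$ $|\psi_\varepsilon|^2\rightharpoonup\gamma$ denotes weak convergence of the measures $|\psi_\varepsilon|^2\,dx$ to $\gamma$ (tested against continuous compactly supported functions; mass may be lost in (a)). $\sqrt{D^2V}$ is the positive semidefinite square root of the Hessian of $V$, which is positive semidefinite on $\{V=0\}$. The right-hand side in (b) may be $+\infty$. *)

theory Defs
  imports "HOL-Probability.Probability"
begin

definition partial_deriv :: "'n::finite \<Rightarrow> (real^'n \<Rightarrow> real) \<Rightarrow> real^'n \<Rightarrow> real" where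
  "partial_deriv i f x = frechet_derivative f (at x) (axis i 1)"

text \<open>\<open>Ck_on k U f\<close>: the function \<open>f\<close> is of class \<open>C^k\<close> on \<open>U\<close>; meant for open \<open>U\<close> only.\<close>

primrec Ck_on :: "nat \<Rightarrow> (real^'n::finite) set \<Rightarrow> (real^'n \<Rightarrow> real) \<Rightarrow> bool" where
  "Ck_on 0 U f \<longleftrightarrow> continuous_on U f"
| "Ck_on (Suc k) U f \<longleftrightarrow>
     (\<forall>x\<in>U. f differentiable (at x)) \<and> (\<forall>i. Ck_on k U (partial_deriv i f))"

definition hessian :: "(real^'n::finite \<Rightarrow> real) \<Rightarrow> real^'n \<Rightarrow> real^'n^'n" where
  "hessian f x = (\<chi> i j. partial_deriv i (partial_deriv j f) x)"

definition pos_semidef :: "real^'n^'n::finite \<Rightarrow> bool" where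
  "pos_semidef A \<longleftrightarrow> transpose A = A \<and> (\<forall>x. 0 \<le> x \<bullet> (A *v x))"

text \<open>The positive semidefinite square root, which is unique if \<open>A\<close> is positive semidefinite.
  The value is unspecified for all other matrices.\<close>

definition psd_sqrt :: "real^'n^'n::finite \<Rightarrow> real^'n^'n" where
  "psd_sqrt A = (THE B. pos_semidef B \<and> B ** B = A)"

definition compactly_supported :: "(real^'n::finite \<Rightarrow> real) \<Rightarrow> bool" where
  "compactly_supported f \<longleftrightarrow> compact (closure {x. f x \<noteq> 0})"

definition test_function :: "(real^'n::finite \<Rightarrow> real) \<Rightarrow> bool" where
  "test_function \<phi> \<longleftrightarrow> (\<forall>k. Ck_on k UNIV \<phi>) \<and> compactly_supported \<phi>"

text \<open>
  Wave functions take values in a scalar field \<open>'k\<close> of sort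
  \<open>{real_normed_field, euclidean_space}\<close>. Up to isomorphism the only such fields are the reals
  and the complex numbers, so both the real and the complex \<open>H^1\<close> are covered.
  Elements of \<open>H^1\<close> are represented by Borel functions, not by classes modulo null sets.
\<close>

definition locally_integrable ::
  "(real^'n::finite \<Rightarrow> 'b::euclidean_space) \<Rightarrow> bool" where
  "locally_integrable f \<longleftrightarrow> (\<forall>K. compact K \<longrightarrow> set_integrable lborel K f)"

definition is_weak_gradient ::
  "(real^'n::finite \<Rightarrow> 'k::{real_normed_field,euclidean_space}) \<Rightarrow> (real^'n \<Rightarrow> 'k^'n) \<Rightarrow> bool" where
  "is_weak_gradient \<psi> G \<longleftrightarrow> locally_integrable \<psi> \<and> locally_integrable G \<and>
     (\<forall>\<phi> i. test_function \<phi> \<longrightarrow>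
        (LINT x|lborel. partial_deriv i \<phi> x *\<^sub>R \<psi> x) = - (LINT x|lborel. \<phi> x *\<^sub>R (G x $ i)))"

text \<open>Weak gradients are unique up to null sets, so the choice below does not affect integrals.\<close>

definition weak_gradient ::
  "(real^'n::finite \<Rightarrow> 'k::{real_normed_field,euclidean_space}) \<Rightarrow> real^'n \<Rightarrow> 'k^'n" where
  "weak_gradient \<psi> = (SOME G. is_weak_gradient \<psi> G)"

definition H1 :: "(real^'n::finite \<Rightarrow> 'k::{real_normed_field,euclidean_space}) set" where
  "H1 = {\<psi>. \<psi> \<in> borel_measurable lborel \<and> integrable lborel (\<lambda>x. (norm (\<psi> x))\<^sup>2) \<and>
         (\<exists>G. is_weak_gradient \<psi> G \<and> integrable lborel (\<lambda>x. (norm (G x))\<^sup>2))}"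

text \<open>The norm on \<open>'k^'n\<close> is the Euclidean one, as required for the Dirichlet term. The energy is
  extended-valued since \<open>V\<close> may be unbounded.\<close>

definition energy ::
  "(real^'n::finite \<Rightarrow> real) \<Rightarrow> real \<Rightarrow> (real^'n \<Rightarrow> 'k::{real_normed_field,euclidean_space}) \<Rightarrow> ennreal"
  where
  "energy V \<epsilon> \<psi> =
     (\<integral>\<^sup>+ x. ennreal (\<epsilon> powr (1/2) * ((norm (weak_gradient \<psi> x))\<^sup>2 / 2)
                    + \<epsilon> powr (-1/2) * V x * (norm (\<psi> x))\<^sup>2) \<partial>lborel)"

definition mass_measure ::
  "(real^'n::finite \<Rightarrow> 'k::{real_normed_field,euclidean_space}) \<Rightarrow> (real^'n) measure" where
  "mass_measure \<psi> = density lborel (\<lambda>x. ennreal ((norm (\<psi> x))\<^sup>2))"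

definition weakly_converges ::
  "('i \<Rightarrow> (real^'n::finite) measure) \<Rightarrow> (real^'n) measure \<Rightarrow> 'i filter \<Rightarrow> bool" where
  "weakly_converges \<mu> \<gamma> F \<longleftrightarrow>
     (\<forall>\<phi>. continuous_on UNIV \<phi> \<and> compactly_supported \<phi> \<longrightarrow>
        ((\<lambda>i. LINT x|\<mu> i. \<phi> x) \<longlongrightarrow> (LINT x|\<gamma>. \<phi> x)) F)"

text \<open>For the measures of interest, with no mass on \<open>{V > 0}\<close>, the unspecified values of
  \<open>psd_sqrt\<close> off the zero set of \<open>V\<close> do not matter (cf. \<open>nn_integral_cong_AE\<close>, which requires no
  measurability). On the zero set of \<open>V\<close> the trace is nonnegative.\<close>

definition limit_energy :: "(real^'n::finite \<Rightarrow> real) \<Rightarrow> (real^'n) measure \<Rightarrow> ennreal" where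
  "limit_energy V \<gamma> = ennreal (1/2) * (\<integral>\<^sup>+ x. ennreal (trace (psd_sqrt (hessian V x))) \<partial>\<gamma>)"

end

theory Submission
  imports Defs
begin

text \<open>
  Lower bound. If a compactly supported \<open>C\<^sup>1\<close> vector field \<open>w\<close> satisfies \<open>|w|\<^sup>2 \<le> 2 V\<close>, expanding
  \<open>|\<epsilon>\<^sup>1\<^sup>/\<^sup>2 \<nabla>\<psi> + w \<psi>|\<^sup>2 \<ge> 0\<close> and integrating by parts gives \<open>E\<^sub>\<epsilon>(\<psi>) \<ge> 1/2 \<integral> div w |\<psi>|\<^sup>2\<close>, which passes to
  the weak limit. Near a zero \<open>x\<^sub>0\<close> of \<open>V\<close>, with \<open>B = sqrt(D\<^sup>2V(x\<^sub>0)) + \<eta>\<close>, the field \<open>w = B\<^sup>-\<^sup>1 \<nabla>V\<close> is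
  admissible because \<open>0 \<le> V(x - B\<^sup>-\<^sup>2 \<nabla>V(x))\<close>, and its divergence on \<open>{V = 0}\<close> exceeds
  \<open>tr sqrt(D\<^sup>2V) - O(\<eta>)\<close>. Since \<open>w\<close> vanishes on \<open>{V = 0}\<close>, such fields can be glued with cutoffs \<open>\<beta>\<^sub>j\<close>
  as \<open>m \<Sum>\<beta>\<^sub>j w\<^sub>j / (1 + m \<Sum>\<beta>\<^sub>j)\<close> whose divergence there is the corresponding weighted sum of the \<open>div w\<^sub>j\<close>; the weights add up to 1 as \<open>m \<rightarrow> \<infinity>\<close>.

  Upper bound. Around a zero \<open>y\<close> the rescaling \<open>x = y + \<epsilon>\<^sup>1\<^sup>/\<^sup>4 z\<close> turns the energy into that of the harmonic
  oscillator with Hessian \<open>D\<^sup>2V(y)\<close>, whose ground state energy \<open>tr sqrt(D\<^sup>2V(y)) / 2\<close> is approached by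
  compactly supported profiles. Finitely many such profiles with disjoint supports realize a discretization of
  \<open>\<gamma>\<close> with atoms chosen near the infimum of \<open>tr sqrt(D\<^sup>2V)\<close> on each cell; a diagonal argument concludes.
\<close>

subsection \<open>Square roots of positive semidefinite matrices\<close>

text \<open>The field \<open>w\<close> imitates the ground state: ideally it is the gradient of a
  phase \<open>s\<close> with |grad s|^2 = 2 V. At a zero with Hessian A this suggests s = x .
  sqrt(A) x / 2 to leading order, that is, w = A^(-1/2) grad V with divergence tr sqrt(A). The shift
  by \<eta> supplies an inverse where A is singular. Three obstacles shape the details. The bound
  |w|^2 \<le> 2 V must hold exactly, since any error in it would be multiplied by \<epsilon>^(-1/2);
  the gluing keeps it because the coefficients sum to at most 1. The integrand tr sqrt(D^2 V) has
  prescribed values only on the zero set of V, so the arguments avoid its measurability: the lower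
  bound works with simple functions below it, the upper bound with step functions below it. Finally,
  mass may escape to infinity; compact support of \<open>w\<close> makes the lower bound insensitive
  to this, and the limit measure is obtained by transporting everything to probability measures on
  [0, 1].\<close>

lemma pos_semidef_sym: "pos_semidef A \<Longrightarrow> x \<bullet> (A *v y) = (A *v x) \<bullet> y"
  by (metis dot_lmul_matrix pos_semidef_def transpose_matrix_vector vector_transpose_matrix)

text \<open>The form is nonnegative and vanishes at \<open>v\<close>, so \<open>v\<close> minimizes
  it; its first-order term in the direction \<open>B *v v\<close> is a multiple of |B v|^2 and has
  to vanish.\<close>

lemma pos_semidef_zero_form:
  fixes B :: "real^'n^'n"
  assumes B: "pos_semidef B" and v: "v \<bullet> (B *v v) = 0"
  shows "B *v v = 0"
proof -
  define w where "w = B *v v"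
  define c where "c = w \<bullet> (B *v w)"
  have c: "c \<ge> 0" using B by (simp add: pos_semidef_def c_def)
  have "0 \<le> - 2 * t * (w \<bullet> w) + t^2 * c" for t
  proof -
    have "0 \<le> (v - t *\<^sub>R w) \<bullet> (B *v (v - t *\<^sub>R w))"
      using B by (simp add: pos_semidef_def)
    also have "\<dots> = v \<bullet> (B *v v) - t * (v \<bullet> (B *v w)) - t * (w \<bullet> w) + t^2 * c"
      by (simp add: algebra_simps inner_diff_left inner_diff_right matrix_vector_mult_diff_distrib
        matrix_vector_mult_scaleR w_def c_def power2_eq_square)
    also have "v \<bullet> (B *v w) = w \<bullet> w" using pos_semidef_sym[OF B] by (simp add: w_def)
    finally show ?thesis using v by simp
  qed
  \<comment> \<open>The quadratic in \<open>t\<close> is smallest at |w|^2 / c; the extra 1 keeps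
    the denominator positive when \<open>c\<close> is 0.\<close>
  from this[of "(w \<bullet> w) / (c + 1)"]
  have "2 * (w \<bullet> w)^2 / (c+1) \<le> (w \<bullet> w)^2 / (c+1) * (c / (c+1))"
    using c by (simp add: power2_eq_square field_simps)
  also have "\<dots> \<le> (w \<bullet> w)^2 / (c+1) * 1" using c by (intro mult_left_mono) auto
  finally have "(w \<bullet> w)^2 / (c+1) \<le> 0" by simp
  then have "(w \<bullet> w)^2 \<le> 0" using c by (simp add: divide_le_0_iff)
  then show ?thesis by (simp add: w_def)
qed

text \<open>The eigenvector maximizes the Rayleigh quotient on the unit sphere. With
  \<open>l\<close> the maximum, l - A is positive semidefinite and its form vanishes at the
  maximizer, so \<open>pos_semidef_zero_form\<close> yields the eigenvalue equation.\<close>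

lemma pos_semidef_top_eigenvector:
  fixes A :: "real^'n^'n"
  assumes A: "pos_semidef A" and nz: "A \<noteq> 0"
  obtains e l where "l > 0" "norm e = 1" "A *v e = l *\<^sub>R e"
proof -
  let ?S = "sphere 0 1 :: (real^'n) set"
  have "\<exists>x\<in>?S. \<forall>y\<in>?S. y \<bullet> (A *v y) \<le> x \<bullet> (A *v x)"
    by (intro continuous_attains_sup continuous_intros) auto
  then obtain e where e: "norm e = 1" and mx: "\<And>y. norm y = 1 \<Longrightarrow> y \<bullet> (A *v y) \<le> e \<bullet> (A *v e)"
    by auto
  define l where "l = e \<bullet> (A *v e)"
  have le: "x \<bullet> (A *v x) \<le> l * (x \<bullet> x)" for x
  proof (cases "x = 0")
    case False
    define y where "y = x /\<^sub>R norm x"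
    have "norm y = 1" using False by (simp add: y_def)
    from mx[OF this] have "y \<bullet> (A *v y) \<le> l" by (simp add: l_def)
    moreover have "x = norm x *\<^sub>R y" using False by (simp add: y_def)
    then have "x \<bullet> (A *v x) = (norm x)^2 * (y \<bullet> (A *v y))"
      by (metis inner_scaleR_left inner_scaleR_right matrix_vector_mult_scaleR mult.assoc power2_eq_square)
    ultimately show ?thesis
      using mult_left_mono[of "y \<bullet> (A *v y)" l "x \<bullet> x"]
      by (simp add: power2_norm_eq_inner mult.commute[of l])
  qed simp
  let ?C = "l *\<^sub>R mat 1 - A"
  have Cv: "?C *v x = l *\<^sub>R x - A *v x" for x
    by (simp add: matrix_vector_mult_diff_rdistrib scaleR_matrix_vector_assoc[symmetric])
  have tA: "transpose A = A" using A by (simp add: pos_semidef_def)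
  have "transpose ?C = ?C"
    using tA by (simp add: vec_eq_iff transpose_def mat_def)
  then have C: "pos_semidef ?C"
    unfolding pos_semidef_def Cv using le by (simp add: inner_diff_right)
  have "e \<bullet> (?C *v e) = 0"
    unfolding Cv using e by (simp add: inner_diff_right l_def norm_eq_1)
  from pos_semidef_zero_form[OF C this] have ev: "A *v e = l *\<^sub>R e" by (simp add: Cv)
  have "l \<noteq> 0"
  proof
    assume "l = 0"
    have "x \<bullet> (A *v x) = 0" for x
      using le[of x] A \<open>l = 0\<close> by (simp add: pos_semidef_def order_antisym)
    then have "A *v x = 0" for x by (rule pos_semidef_zero_form[OF A])
    then show False using nz by (metis matrix_eq matrix_vector_mult_0)
  qed
  moreover have "l \<ge> 0" using A by (simp add: pos_semidef_def l_def)
  ultimately have "l > 0" by simp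
  from that[OF this e ev] show thesis .
qed

text \<open>Deflation: subtracting l e e^T from A enlarges the kernel by \<open>e\<close> and keeps
  the form nonnegative, whence the induction on the codimension of the kernel. A root
  \<open>S\<close> of the deflated matrix annihilates \<open>e\<close>, so S + sqrt(l) e e^T squares
  to A without cross terms.\<close>

lemma pos_semidef_sqrt_exists:
  fixes A :: "real^'n^'n"
  assumes "pos_semidef A"
  shows "\<exists>B. pos_semidef B \<and> B ** B = A"
  using assms
proof (induction "CARD('n) - dim {x. A *v x = 0}" arbitrary: A rule: less_induct)
  case less
  show ?case
  proof (cases "A = 0")
    case True
    then have "pos_semidef (0::real^'n^'n) \<and> 0 ** 0 = A"
      by (simp add: pos_semidef_def transpose_def vec_eq_iff)
    then show ?thesis by blast
  next
    case False
    then obtain e l where l: "l > 0" and e: "norm e = 1" and ev: "A *v e = l *\<^sub>R e"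
      using pos_semidef_top_eigenvector less.prems by metis
    have ee: "e \<bullet> e = 1" using e by (simp add: norm_eq_1)
    have tA: "transpose A = A" using less.prems by (simp add: pos_semidef_def)
    define E where "E = (\<chi> i j. e$i * e$j)"
    have Ev: "E *v x = (e \<bullet> x) *\<^sub>R e" for x
      by (simp add: vec_eq_iff E_def matrix_vector_mult_def inner_vec_def sum_distrib_left
        sum_distrib_right mult_ac)
    have tE: "transpose E = E" by (simp add: E_def transpose_def mult.commute)
    define A' where "A' = A - l *\<^sub>R E"
    have A'v: "A' *v x = A *v x - (l * (e \<bullet> x)) *\<^sub>R e" for x
      by (simp add: A'_def matrix_vector_mult_diff_rdistrib Ev scaleR_matrix_vector_assoc[symmetric])
    have tA': "transpose A' = A'" using tA tE by (simp add: A'_def transpose_def vec_eq_iff)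
    have eA: "e \<bullet> (A *v x) = l * (e \<bullet> x)" for x
      using pos_semidef_sym[OF less.prems, of e x] by (simp add: ev)
    have A': "pos_semidef A'"
      unfolding pos_semidef_def
    proof (intro conjI allI tA')
      fix x
      \<comment> \<open>The form of \<open>A'\<close> at \<open>x\<close> is the form of
        \<open>A\<close> at the component of \<open>x\<close> orthogonal to
        \<open>e\<close>.\<close>
      define y where "y = x - (e \<bullet> x) *\<^sub>R e"
      have "0 \<le> y \<bullet> (A *v y)" using less.prems by (simp add: pos_semidef_def)
      also have "A *v y = A *v x - ((e \<bullet> x) * l) *\<^sub>R e"
        by (simp add: y_def matrix_vector_mult_diff_distrib matrix_vector_mult_scaleR ev)
      also have "y \<bullet> \<dots> = x \<bullet> (A' *v x)"
        using inner_commute[of x e]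
        by (simp add: y_def A'v inner_diff_left inner_diff_right ee eA)
      finally show "0 \<le> x \<bullet> (A' *v x)" .
    qed
    have A'e: "A' *v e = 0" by (simp add: A'v ev ee)
    have sub: "subspace {x. B *v x = 0}" for B :: "real^'n^'n"
      by (auto simp: subspace_def matrix_vector_right_distrib matrix_vector_mult_scaleR)
    have "{x. A *v x = 0} \<subset> {x. A' *v x = 0}"
    proof
      show "{x. A *v x = 0} \<subseteq> {x. A' *v x = 0}"
        using eA l by (auto simp: A'v) (metis inner_zero_right less_irrefl mult_eq_0_iff)
      show "{x. A *v x = 0} \<noteq> {x. A' *v x = 0}"
        using A'e ev l e by (auto simp: set_eq_iff) (metis norm_zero scaleR_eq_0_iff less_irrefl zero_neq_one)
    qed
    then have "dim {x. A *v x = 0} < dim {x. A' *v x = 0}"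
      by (intro dim_psubset) (metis sub span_eq_iff)
    moreover have "dim {x. A' *v x = 0} \<le> CARD('n)"
      using dim_subset_UNIV[of "{x. A' *v x = 0}"] by (simp add: dim_UNIV)
    ultimately obtain S where S: "pos_semidef S" and SS: "S ** S = A'"
      using less.hyps[OF _ A'] by (meson diff_less_mono2 order_less_le_trans)
    have "(S *v e) \<bullet> (S *v e) = e \<bullet> (S *v (S *v e))" using pos_semidef_sym[OF S] by simp
    also have "\<dots> = 0" by (simp add: matrix_vector_mul_assoc SS A'e)
    finally have Se: "S *v e = 0" by simp
    define R where "R = S + sqrt l *\<^sub>R E"
    have Rv: "R *v x = S *v x + (sqrt l * (e \<bullet> x)) *\<^sub>R e" for x
      by (simp add: R_def matrix_vector_mult_add_rdistrib Ev scaleR_matrix_vector_assoc[symmetric])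
    have eS: "e \<bullet> (S *v x) = 0" for x using pos_semidef_sym[OF S, of e x] by (simp add: Se)
    have "pos_semidef R"
      unfolding pos_semidef_def
    proof (intro conjI allI)
      show "transpose R = R" using S tE
        by (simp add: pos_semidef_def R_def transpose_def vec_eq_iff)
      have "x \<bullet> (R *v x) = x \<bullet> (S *v x) + sqrt l * (e \<bullet> x)\<^sup>2" for x
        by (simp add: Rv inner_add_right inner_commute[of x e] power2_eq_square)
      then show "0 \<le> x \<bullet> (R *v x)" for x
        using S l by (simp add: pos_semidef_def)
    qed
    moreover have "R ** R = A"
    proof (subst matrix_eq, intro allI)
      fix x
      have "(R ** R) *v x = R *v (R *v x)" by (simp add: matrix_vector_mul_assoc)
      also have "\<dots> = S *v (S *v x) + (l * (e \<bullet> x)) *\<^sub>R e"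
        using l by (simp add: Rv matrix_vector_right_distrib matrix_vector_mult_scaleR Se eS ee
          inner_add_right flip: power2_eq_square mult.assoc)
      also have "\<dots> = A *v x" by (simp add: matrix_vector_mul_assoc SS A'v)
      finally show "(R ** R) *v x = A *v x" .
    qed
    ultimately show ?thesis by blast
  qed
qed

lemma trace_pos_semidef_nonneg: "pos_semidef A \<Longrightarrow> 0 \<le> trace A"
  unfolding trace_def pos_semidef_def
  by (intro sum_nonneg) (metis inner_axis' matrix_vector_mul_component inner_commute real_inner_1_right matrix_vector_mult_basis column_def vec_lambda_beta mult_1)

lemma pos_semidef_congruence:
  assumes "pos_semidef P" "transpose X = X"
  shows "pos_semidef (X ** P ** X)"
proof -
  have "x \<bullet> ((X ** P ** X) *v x) = (X *v x) \<bullet> (P *v (X *v x))" for x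
    by (metis assms(2) dot_lmul_matrix matrix_vector_mul_assoc transpose_matrix_vector vector_transpose_matrix)
  then show ?thesis using assms
    by (simp add: pos_semidef_def matrix_transpose_mul matrix_mul_assoc)
qed

text \<open>The diagonal entries are values of the form at the basis vectors. Being nonnegative with
  sum 0 they vanish, and \<open>pos_semidef_zero_form\<close> then kills every column.\<close>

lemma pos_semidef_trace_zero:
  fixes A :: "real^'n^'n"
  assumes A: "pos_semidef A" and "trace A = 0"
  shows "A = 0"
proof -
  have d: "A $ i $ i = axis i 1 \<bullet> (A *v axis i 1)" for i
    by (simp add: inner_axis' matrix_vector_mult_basis column_def)
  have nn: "A $ i $ i \<ge> 0" for i unfolding d using A by (simp add: pos_semidef_def)
  have "A $ i $ i = 0" for i using assms(2) nn
    by (simp add: trace_def sum_nonneg_eq_0_iff)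
  then have "A *v axis i 1 = 0" for i
    using pos_semidef_zero_form[OF A] d by metis
  then show ?thesis by (simp add: matrix_vector_mult_basis column_def vec_eq_iff)
qed

lemma pos_semidef_add: "pos_semidef A \<Longrightarrow> pos_semidef B \<Longrightarrow> pos_semidef (A + B)"
  by (simp add: pos_semidef_def transpose_def vec_eq_iff matrix_vector_mult_add_rdistrib inner_add_right)

text \<open>With X = B - C and P = B + C, the sum X P + P X = 2 (B^2 - C^2) is 0. Multiplying by X
  and taking traces gives trace (X P X) = 0, so the form of P, hence the forms of B and C, vanish on
  the range of X. Thus X vanishes on its own range, and a symmetric matrix with square 0 is
  0.\<close>

lemma pos_semidef_sqrt_unique:
  fixes B C :: "real^'n^'n"
  assumes B: "pos_semidef B" and C: "pos_semidef C" and eq: "B ** B = C ** C"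
  shows "B = C"
proof -
  define X where "X = B - C"
  define P where "P = B + C"
  have tX: "transpose X = X" using B C by (simp add: pos_semidef_def X_def transpose_def vec_eq_iff)
  have P: "pos_semidef P" unfolding P_def by (rule pos_semidef_add[OF B C])
  have add_l: "(K + L) ** M = K ** M + L ** M" for K L M :: "real^'n^'n"
    by (simp add: matrix_matrix_mult_def vec_eq_iff sum.distrib algebra_simps)
  have sub_l: "(K - L) ** M = K ** M - L ** M" for K L M :: "real^'n^'n"
    by (simp add: matrix_matrix_mult_def vec_eq_iff sum_subtractf algebra_simps)
  have sub_r: "M ** (K - L) = M ** K - M ** L" for K L M :: "real^'n^'n"
    by (simp add: matrix_matrix_mult_def vec_eq_iff sum_subtractf algebra_simps)
  have sylv: "X ** P + P ** X = 0"
    using eq by (simp add: X_def P_def add_l sub_l sub_r matrix_add_ldistrib)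
  have "trace (X ** (X ** P + P ** X)) = trace (X ** X ** P) + trace (X ** P ** X)"
    by (simp add: matrix_add_ldistrib matrix_mul_assoc trace_add)
  also have "trace (X ** X ** P) = trace (X ** P ** X)"
    by (metis matrix_mul_assoc trace_mul_sym)
  finally have "trace (X ** P ** X) = 0" using sylv by (simp add: trace_def)
  with pos_semidef_congruence[OF P tX] have XPX: "X ** P ** X = 0"
    by (rule pos_semidef_trace_zero)
  have "X *v z = 0" for z
  proof -
    define v where "v = X *v z"
    have xs: "a \<bullet> (X *v b) = (X *v a) \<bullet> b" for a b
      by (metis tX dot_lmul_matrix transpose_matrix_vector vector_transpose_matrix)
    have "v \<bullet> (P *v v) = z \<bullet> ((X ** P ** X) *v z)"
      unfolding v_def by (simp add: xs matrix_vector_mul_assoc[symmetric])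
    then have "v \<bullet> (P *v v) = 0" by (simp add: XPX)
    then have "v \<bullet> (B *v v) + v \<bullet> (C *v v) = 0"
      by (simp add: P_def matrix_vector_mult_add_rdistrib inner_add_right)
    moreover have "v \<bullet> (B *v v) \<ge> 0" "v \<bullet> (C *v v) \<ge> 0" using B C by (auto simp: pos_semidef_def)
    ultimately have "B *v v = 0" "C *v v = 0"
      using pos_semidef_zero_form B C by (auto simp: add_nonneg_eq_0_iff)
    then have "X *v v = 0" by (simp add: X_def matrix_vector_mult_diff_rdistrib)
    then have "v \<bullet> v = 0" using xs[of v z] by (simp add: v_def)
    then show ?thesis by (simp add: v_def)
  qed
  then have "X = 0" by (metis matrix_eq matrix_vector_mult_0)
  then show ?thesis by (simp add: X_def)
qed

lemma psd_sqrt: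
  assumes "pos_semidef A"
  shows "pos_semidef (psd_sqrt A)" "psd_sqrt A ** psd_sqrt A = A"
proof -
  have "\<exists>!B. pos_semidef B \<and> B ** B = A"
    using pos_semidef_sqrt_exists[OF assms] pos_semidef_sqrt_unique by metis
  from theI'[OF this] show "pos_semidef (psd_sqrt A)" "psd_sqrt A ** psd_sqrt A = A"
    by (auto simp: psd_sqrt_def)
qed

subsection \<open>Second-order Taylor expansion\<close>

definition grad :: "(real^'n::finite \<Rightarrow> real) \<Rightarrow> real^'n \<Rightarrow> real^'n" where
  "grad f x = (\<chi> i. partial_deriv i f x)"

lemma has_derivative_grad:
  fixes f :: "real^'n::finite \<Rightarrow> real"
  assumes "f differentiable (at x)"
  shows "(f has_derivative (\<lambda>h. grad f x \<bullet> h)) (at x)"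
proof -
  let ?D = "frechet_derivative f (at x)"
  have D: "(f has_derivative ?D) (at x)" using assms frechet_derivative_works by blast
  then interpret bounded_linear ?D by (rule has_derivative_bounded_linear)
  have "?D h = grad f x \<bullet> h" for h
  proof -
    have "?D h = ?D (\<Sum>i\<in>UNIV. h $ i *\<^sub>R axis i 1)"
      by (metis (no_types, lifting) basis_expansion scalar_mult_eq_scaleR sum.cong)
    also have "\<dots> = grad f x \<bullet> h"
      by (simp add: sum scaleR inner_vec_def grad_def partial_deriv_def mult.commute)
    finally show ?thesis .
  qed
  then have "?D = (\<lambda>h. grad f x \<bullet> h)" by blast
  with D show ?thesis by metis
qed

lemma partial_deriv_eq:
  assumes "(f has_derivative D) (at x)"
  shows "partial_deriv i f x = D (axis i 1)"
  using frechet_derivative_at[OF assms] by (simp add: partial_deriv_def)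

lemma Ck_on_2D:
  assumes "Ck_on 2 U V"
  shows "\<And>x. x \<in> U \<Longrightarrow> V differentiable (at x)"
    and "\<And>x i. x \<in> U \<Longrightarrow> partial_deriv i V differentiable (at x)"
    and "continuous_on U (hessian V)"
    and "continuous_on U (grad V)"
proof -
  show "\<And>x. x \<in> U \<Longrightarrow> V differentiable (at x)" and p: "\<And>x i. x \<in> U \<Longrightarrow> partial_deriv i V differentiable (at x)"
    using assms by (auto simp: numeral_2_eq_2)
  show "continuous_on U (hessian V)"
    using assms unfolding hessian_def by (auto simp: numeral_2_eq_2 intro!: continuous_on_vec_lambda)
  show "continuous_on U (grad V)"
    unfolding grad_def using p
    by (intro continuous_on_vec_lambda continuous_at_imp_continuous_on ballI) (auto simp: differentiable_imp_continuous_within)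
qed

text \<open>The entry (i, j) of \<open>hessian\<close> differentiates the j-th component of the
  gradient in direction i, so the Jacobian of \<open>grad V\<close> is the transpose; symmetry is
  established only in \<open>hessian_symmetric\<close>.\<close>

lemma has_derivative_grad_hessian:
  fixes V :: "real^'n::finite \<Rightarrow> real"
  assumes C2: "Ck_on 2 U V" and x: "x \<in> U"
  shows "(grad V has_derivative (\<lambda>h. transpose (hessian V x) *v h)) (at x)"
proof -
  have "((\<lambda>y. grad V y \<bullet> b) has_derivative (\<lambda>h. (transpose (hessian V x) *v h) \<bullet> b)) (at x)"
    if b: "b \<in> Basis" for b
  proof -
    obtain i :: 'n where i: "b = axis i 1" using b by (auto simp: Basis_vec_def)
    have "(\<lambda>h. (transpose (hessian V x) *v h) \<bullet> b) = (\<lambda>h. grad (partial_deriv i V) x \<bullet> h)"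
      by (simp add: i inner_axis) (simp add: vector_matrix_mult_def hessian_def grad_def inner_vec_def mult.commute)
    moreover have "(\<lambda>y. grad V y \<bullet> b) = partial_deriv i V" by (simp add: i inner_axis grad_def fun_eq_iff)
    ultimately show ?thesis using has_derivative_grad[OF Ck_on_2D(2)[OF C2 x]] by simp
  qed
  then show ?thesis using has_derivative_componentwise_within by blast
qed

lemma bilinear_form_bound:
  fixes M :: "real^'n^'n"
  shows "\<bar>h \<bullet> (M *v h)\<bar> \<le> (real CARD('n))\<^sup>2 * norm M * (norm h)\<^sup>2"
proof -
  have ent: "\<bar>M $ i $ j\<bar> \<le> norm M" for i j
    using component_le_norm_cart[of "M $ i" j] Finite_Cartesian_Product.norm_nth_le[of M i] by (meson order_trans)
  have "onorm ((*v) M) \<le> real CARD('n) * real CARD('n) * norm M"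
    by (rule onorm_le_matrix_component) (rule ent)
  moreover have "norm (M *v h) \<le> onorm ((*v) M) * norm h"
    by (rule onorm[OF matrix_vector_mul_bounded_linear])
  ultimately have "norm (M *v h) \<le> (real CARD('n))\<^sup>2 * norm M * norm h"
    unfolding power2_eq_square by (meson mult_right_mono norm_ge_zero order_trans)
  then have "norm h * norm (M *v h) \<le> norm h * ((real CARD('n))\<^sup>2 * norm M * norm h)"
    by (intro mult_left_mono) auto
  moreover have "\<bar>h \<bullet> (M *v h)\<bar> \<le> norm h * norm (M *v h)" by (rule Cauchy_Schwarz_ineq2)
  ultimately show ?thesis by (simp add: power2_eq_square mult_ac)
qed

text \<open>The base point \<open>x\<close> varies while the Hessian is frozen at \<open>x0\<close>:
  the lower bound expands at every point near a zero, with a step depending on that point.\<close>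

lemma Taylor2:
  assumes U: "open U" and C2: "Ck_on 2 U V" and x0: "x0 \<in> U" and d: "\<delta> > 0"
  obtains r where "r > 0" "ball x0 r \<subseteq> U"
    "\<And>x h. x \<in> ball x0 r \<Longrightarrow> x + h \<in> ball x0 r \<Longrightarrow>
       \<bar>V (x + h) - V x - grad V x \<bullet> h - (h \<bullet> (hessian V x0 *v h)) / 2\<bar> \<le> \<delta> * (norm h)\<^sup>2 / 2"
proof -
  let ?H = "hessian V"
  \<comment> \<open>Cancels the dimension factor of \<open>bilinear_form_bound\<close>.\<close>
  define e where "e = \<delta> / (real CARD('a))\<^sup>2"
  have e: "e > 0" using d by (simp add: e_def)
  have "continuous (at x0) ?H"
    using Ck_on_2D(3)[OF C2] U x0 by (simp add: continuous_on_eq_continuous_at)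
  then obtain r1 where r1: "r1 > 0" "\<And>y. dist y x0 < r1 \<Longrightarrow> dist (?H y) (?H x0) < e"
    using e unfolding continuous_at_eps_delta by metis
  obtain r2 where r2: "r2 > 0" "ball x0 r2 \<subseteq> U" using U x0 openE by blast
  define r where "r = min r1 r2"
  show thesis
  proof (rule that)
    show "r > 0" using r1 r2 by (simp add: r_def)
    show "ball x0 r \<subseteq> U" using r2 by (auto simp: r_def)
    fix x h assume x: "x \<in> ball x0 r" and xh: "x + h \<in> ball x0 r"
    have seg: "x + t *\<^sub>R h \<in> ball x0 r" if "0 \<le> t" "t \<le> 1" for t
    proof -
      have "(1 - t) *\<^sub>R x + t *\<^sub>R (x + h) \<in> ball x0 r"
        using x xh that by (intro convexD[OF convex_ball]) auto
      then show ?thesis by (simp add: algebra_simps)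
    qed
    have d1: "((\<lambda>t. V (x + t *\<^sub>R h)) has_real_derivative grad V (x + t *\<^sub>R h) \<bullet> h) (at t)"
      if "0 \<le> t" "t \<le> 1" for t
    proof -
      have "x + t *\<^sub>R h \<in> U" using seg[OF that] r2 by (auto simp: r_def)
      from has_derivative_grad[OF Ck_on_2D(1)[OF C2 this]]
      have "(V has_derivative (\<lambda>k. grad V (x + t *\<^sub>R h) \<bullet> k)) (at (x + t *\<^sub>R h))" .
      then have "((\<lambda>t. V (x + t *\<^sub>R h)) has_derivative (\<lambda>s. grad V (x + t *\<^sub>R h) \<bullet> (s *\<^sub>R h))) (at t)"
        by (rule has_derivative_compose[rotated]) (auto intro!: derivative_eq_intros)
      then show ?thesis by (rule has_derivative_imp_has_field_derivative) auto
    qed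
    have d2: "((\<lambda>t. grad V (x + t *\<^sub>R h) \<bullet> h) has_real_derivative h \<bullet> (?H (x + t *\<^sub>R h) *v h)) (at t)"
      if "0 \<le> t" "t \<le> 1" for t
    proof -
      have "x + t *\<^sub>R h \<in> U" using seg[OF that] r2 by (auto simp: r_def)
      from has_derivative_grad_hessian[OF C2 this]
      have "((\<lambda>t. grad V (x + t *\<^sub>R h)) has_derivative (\<lambda>s. transpose (?H (x + t *\<^sub>R h)) *v (s *\<^sub>R h))) (at t)"
        by (rule has_derivative_compose[rotated]) (auto intro!: derivative_eq_intros)
      then have "((\<lambda>t. grad V (x + t *\<^sub>R h) \<bullet> h) has_derivative (\<lambda>s. (transpose (?H (x + t *\<^sub>R h)) *v (s *\<^sub>R h)) \<bullet> h)) (at t)"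
        by (rule has_derivative_inner_left)
      moreover have "(transpose (?H (x + t *\<^sub>R h)) *v (s *\<^sub>R h)) \<bullet> h = s * (h \<bullet> (?H (x + t *\<^sub>R h) *v h))" for s
        by (metis dot_lmul_matrix inner_scaleR_left matrix_vector_mult_scaleR transpose_matrix_vector)
      ultimately show ?thesis by (intro has_derivative_imp_has_field_derivative) (auto simp: mult.commute)
    qed
    \<comment> \<open>The derivatives of orders 0, 1 and 2 of \<open>V\<close> along the segment, in
      the format of \<open>Maclaurin\<close>.\<close>
    define D where "D = (\<lambda>(m::nat) t. if m = 0 then V (x + t *\<^sub>R h) else if m = 1 then grad V (x + t *\<^sub>R h) \<bullet> h
        else h \<bullet> (?H (x + t *\<^sub>R h) *v h))"
    have "\<exists>t. 0 < t \<and> t < 1 \<and> V (x + 1 *\<^sub>R h) = (\<Sum>m<2. (D m 0 / fact m) * 1 ^ m) + (D 2 t / fact 2) * 1 ^ 2"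
    proof (rule Maclaurin)
      show "D 0 = (\<lambda>t. V (x + t *\<^sub>R h))" by (simp add: D_def)
      show "\<forall>m t. m < 2 \<and> 0 \<le> t \<and> t \<le> 1 \<longrightarrow> (D m has_real_derivative D (Suc m) t) (at t)"
        using d1 d2 by (auto simp: D_def less_2_cases_iff)
    qed auto
    then obtain t where t: "0 < t" "t < 1" and
      eq: "V (x + h) = V x + grad V x \<bullet> h + (h \<bullet> (?H (x + t *\<^sub>R h) *v h)) / 2"
      by (auto simp: D_def numeral_2_eq_2)
    define M where "M = ?H (x + t *\<^sub>R h) - ?H x0"
    have "norm M < e" using seg[of t] t r1(2)[of "x + t *\<^sub>R h"]
      by (simp add: M_def dist_norm r_def norm_minus_commute)
    then have "(real CARD('a))\<^sup>2 * norm M * (norm h)\<^sup>2 \<le> (real CARD('a))\<^sup>2 * e * (norm h)\<^sup>2"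
      by (intro mult_right_mono mult_left_mono) auto
    also have "\<dots> = \<delta> * (norm h)\<^sup>2" by (simp add: e_def)
    finally have "\<bar>h \<bullet> (M *v h)\<bar> \<le> \<delta> * (norm h)\<^sup>2" using bilinear_form_bound[of h M] by linarith
    moreover have "h \<bullet> (?H (x + t *\<^sub>R h) *v h) - h \<bullet> (?H x0 *v h) = h \<bullet> (M *v h)"
      by (simp add: M_def matrix_vector_mult_diff_rdistrib inner_diff_right)
    ultimately show "\<bar>V (x + h) - V x - grad V x \<bullet> h - (h \<bullet> (?H x0 *v h)) / 2\<bar> \<le> \<delta> * (norm h)\<^sup>2 / 2"
      unfolding eq by (simp add: abs_le_iff field_simps)
  qed
qed

text \<open>Both orders of differentiation are limits of the same second difference quotient.\<close>

lemma hessian_symmetric: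
  fixes V :: "real^'n::finite \<Rightarrow> real"
  assumes U: "open U" and C2: "Ck_on 2 U V" and x: "x \<in> U"
  shows "transpose (hessian V x) = hessian V x"
proof -
  let ?H = "hessian V x"
  let ?L = "\<lambda>h. transpose ?H *v h"
  have "\<bar>?H $ i $ j - ?H $ j $ i\<bar> \<le> 6 * e" if e: "e > 0" for e i j
  proof -
    from has_derivative_grad_hessian[OF C2 x] e obtain r1 where r1: "r1 > 0"
      "\<And>y. norm (y - x) < r1 \<Longrightarrow> norm (grad V y - grad V x - ?L (y - x)) \<le> e * norm (y - x)"
      unfolding has_derivative_at_alt by blast
    obtain r2 where r2: "r2 > 0" "ball x r2 \<subseteq> U" using U x openE by blast
    define s where "s = min r1 r2 / 4"
    have s: "s > 0" "2 * s < r1" "2 * s < r2" using r1 r2 by (auto simp: s_def)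
    define \<Delta> where "\<Delta> = (\<lambda>h k. V (x + h + k) - V (x + h) - V (x + k) + V x)"
    \<comment> \<open>The mean value theorem along \<open>k\<close> reduces the second difference to
      a difference of gradients. Their linearization errors at distances at most 2 s and s add up to
      3 e s, and pairing with \<open>k\<close> contributes the other factor s.\<close>
    have est: "\<bar>\<Delta> h k - ?L h \<bullet> k\<bar> \<le> 3 * e * s\<^sup>2" if h: "norm h = s" and k: "norm k = s" for h k
    proof -
      have dd: "((\<lambda>t. V (y + t *\<^sub>R k)) has_real_derivative grad V (y + t *\<^sub>R k) \<bullet> k) (at t)"
        if "norm (y - x) \<le> s" "0 \<le> t" "t \<le> 1" for t y
      proof -
        have "norm (y + t *\<^sub>R k - x) \<le> norm (y - x) + norm (t *\<^sub>R k)"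
          by (metis add_diff_eq add.commute norm_triangle_ineq)
        also have "\<dots> \<le> s + 1 * s" using that k s by (intro add_mono) (auto simp: mult_left_le_one_le)
        finally have "y + t *\<^sub>R k \<in> U" using s r2 by (auto simp: dist_norm norm_minus_commute)
        from has_derivative_grad[OF Ck_on_2D(1)[OF C2 this]]
        have "((\<lambda>t. V (y + t *\<^sub>R k)) has_derivative (\<lambda>s. grad V (y + t *\<^sub>R k) \<bullet> (s *\<^sub>R k))) (at t)"
          by (rule has_derivative_compose[rotated]) (auto intro!: derivative_eq_intros)
        then show ?thesis by (rule has_derivative_imp_has_field_derivative) auto
      qed
      have "\<exists>t. 0 < t \<and> t < 1 \<and> (V (x + h + 1 *\<^sub>R k) - V (x + 1 *\<^sub>R k)) - (V (x + h + 0 *\<^sub>R k) - V (x + 0 *\<^sub>R k))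
         = (1 - 0) * (grad V (x + h + t *\<^sub>R k) \<bullet> k - grad V (x + t *\<^sub>R k) \<bullet> k)"
        by (rule MVT2) (use dd[of "x + h"] dd[of x] h s in \<open>auto intro!: DERIV_diff\<close>)
      then obtain t where t: "0 < t" "t < 1"
        and eq: "\<Delta> h k = (grad V (x + h + t *\<^sub>R k) - grad V (x + t *\<^sub>R k)) \<bullet> k"
        by (auto simp: \<Delta>_def inner_diff_left algebra_simps)
      have tk: "norm (t *\<^sub>R k) \<le> s" using t k s by (simp add: mult_left_le_one_le)
      have htk: "norm (h + t *\<^sub>R k) \<le> 2 * s" using norm_triangle_ineq[of h "t *\<^sub>R k"] tk h by linarith
      define R where "R = (\<lambda>y. grad V (x + y) - grad V x - ?L y)"
      have R: "norm (R y) \<le> e * norm y" if "norm y < r1" for y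
        using r1(2)[of "x + y"] that by (simp add: R_def)
      have "norm (R (h + t *\<^sub>R k)) \<le> e * (2 * s)"
        using R[of "h + t *\<^sub>R k"] htk s e by (meson mult_left_mono order_le_less_trans order_less_imp_le order_trans)
      moreover have "norm (R (t *\<^sub>R k)) \<le> e * s"
        using R[of "t *\<^sub>R k"] tk s e by (smt (verit) mult_left_mono)
      ultimately have "norm (R (h + t *\<^sub>R k) - R (t *\<^sub>R k)) \<le> 3 * e * s"
        using norm_triangle_ineq4[of "R (h + t *\<^sub>R k)" "R (t *\<^sub>R k)"] by linarith
      then have "\<bar>(R (h + t *\<^sub>R k) - R (t *\<^sub>R k)) \<bullet> k\<bar> \<le> 3 * e * s * s"
        using Cauchy_Schwarz_ineq2[of "R (h + t *\<^sub>R k) - R (t *\<^sub>R k)" k] k s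
        by (smt (verit) mult_right_mono)
      moreover have "\<Delta> h k - ?L h \<bullet> k = (R (h + t *\<^sub>R k) - R (t *\<^sub>R k)) \<bullet> k"
        by (simp add: eq R_def matrix_vector_right_distrib algebra_simps inner_diff_left inner_add_left)
      ultimately show ?thesis by (simp add: power2_eq_square mult.assoc)
    qed
    define h k where "h = (s *\<^sub>R axis i 1 :: real^'n)" and "k = (s *\<^sub>R axis j 1 :: real^'n)"
    have nh: "norm h = s" "norm k = s" using s by (auto simp: h_def k_def norm_axis_1)
    have L1: "?L h \<bullet> k = s\<^sup>2 * ?H $ i $ j"
      by (simp add: h_def k_def matrix_vector_mult_scaleR matrix_vector_mult_basis column_def transpose_def inner_axis power2_eq_square)
    have L2: "?L k \<bullet> h = s\<^sup>2 * ?H $ j $ i"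
      by (simp add: h_def k_def matrix_vector_mult_scaleR matrix_vector_mult_basis column_def transpose_def inner_axis power2_eq_square)
    have "\<Delta> h k = \<Delta> k h" by (simp add: \<Delta>_def algebra_simps)
    with est[OF nh] est[OF nh(2) nh(1)] have "\<bar>?L h \<bullet> k - ?L k \<bullet> h\<bar> \<le> 6 * e * s\<^sup>2" by linarith
    then have "s\<^sup>2 * \<bar>?H $ i $ j - ?H $ j $ i\<bar> \<le> s\<^sup>2 * (6 * e)"
      unfolding L1 L2 by (simp add: abs_mult mult_ac flip: right_diff_distrib)
    then show ?thesis using s by simp
  qed
  note * = this
  have "\<bar>?H $ i $ j - ?H $ j $ i\<bar> \<le> 0" for i j
  proof (rule field_le_epsilon)
    fix e :: real assume "e > 0"
    then show "\<bar>?H $ i $ j - ?H $ j $ i\<bar> \<le> 0 + e" using *[of "e / 6" i j] by simp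
  qed
  then show ?thesis by (simp add: transpose_def vec_eq_iff)
qed

text \<open>The necessary conditions at a minimum. For the second one, \<open>Taylor2\<close> is
  applied to small multiples of \<open>v\<close>, where the error relative to the square of the
  multiple is at most \<delta>.\<close>

lemma
  fixes V :: "real^'n::finite \<Rightarrow> real"
  assumes U: "open U" and C2: "Ck_on 2 U V" and x: "x \<in> U" and nn: "\<And>y. 0 \<le> V y" and z: "V x = 0"
  shows grad_zero_at_zero: "grad V x = 0"
    and hessian_psd_at_zero: "pos_semidef (hessian V x)"
proof -
  have "\<forall>\<^sub>F y in at x. V x \<le> V y" using nn z by (simp add: always_eventually)
  then have "(\<lambda>h. grad V x \<bullet> h) = (\<lambda>h. 0)"
    by (rule has_derivative_local_min[OF has_derivative_grad[OF Ck_on_2D(1)[OF C2 x]]])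
  then show g: "grad V x = 0" by (metis inner_eq_zero_iff)
  show "pos_semidef (hessian V x)"
    unfolding pos_semidef_def
  proof (intro conjI allI hessian_symmetric[OF U C2 x])
    fix v
    have "0 \<le> v \<bullet> (hessian V x *v v) + \<delta>" if "\<delta> > 0" for \<delta>
    proof -
      define d where "d = \<delta> / ((norm v)\<^sup>2 + 1)"
      have d: "d > 0" using that by (simp add: d_def add_nonneg_pos)
      have "(norm v)\<^sup>2 / ((norm v)\<^sup>2 + 1) \<le> 1" by (simp add: divide_le_eq add_nonneg_pos)
      then have dv: "d * (norm v)\<^sup>2 \<le> \<delta>" using mult_left_le[of "(norm v)\<^sup>2 / ((norm v)\<^sup>2 + 1)" \<delta>] that
        by (simp add: d_def)
      obtain r where r: "r > 0" "\<And>y h. y \<in> ball x r \<Longrightarrow> y + h \<in> ball x r \<Longrightarrow>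
       \<bar>V (y + h) - V y - grad V y \<bullet> h - (h \<bullet> (hessian V x *v h)) / 2\<bar> \<le> d * (norm h)\<^sup>2 / 2"
        using Taylor2[OF U C2 x d] by metis
      define t where "t = r / (2 * (norm v + 1))"
      have t: "t > 0" using r by (simp add: t_def add_nonneg_pos)
      have "t * norm v < r" using r by (simp add: t_def field_simps add_nonneg_pos add_pos_nonneg)
      then have "x + t *\<^sub>R v \<in> ball x r" using t by (simp add: dist_norm)
      from r(2)[OF _ this] r(1) have "0 \<le> (t *\<^sub>R v) \<bullet> (hessian V x *v (t *\<^sub>R v)) + d * (norm (t *\<^sub>R v))\<^sup>2"
        using nn[of "x + t *\<^sub>R v"] z g by (simp add: abs_le_iff field_simps)
      also have "\<dots> = t\<^sup>2 * (v \<bullet> (hessian V x *v v) + d * (norm v)\<^sup>2)"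
        by (simp add: matrix_vector_mult_scaleR power2_eq_square algebra_simps)
      finally have "0 \<le> v \<bullet> (hessian V x *v v) + d * (norm v)\<^sup>2"
        using t by (simp add: zero_le_mult_iff)
      then show ?thesis using dv by linarith
    qed
    then show "0 \<le> v \<bullet> (hessian V x *v v)" by (rule field_le_epsilon)
  qed
qed

subsection \<open>Test functions and the fundamental lemma\<close>

lemma Ck_on_const: "Ck_on k UNIV (\<lambda>x. c)"
proof (induction k arbitrary: c)
  case (Suc k)
  have "partial_deriv i (\<lambda>x. c) = (\<lambda>x. 0)" for i :: 'a
    by (simp add: fun_eq_iff partial_deriv_def)
  with Suc[of 0] show ?case by simp
qed simp

lemma Ck_on_SucD: "Ck_on (Suc k) UNIV f \<Longrightarrow> Ck_on k UNIV f"
proof (induction k arbitrary: f)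
  case 0
  then show ?case
    by (auto intro!: continuous_at_imp_continuous_on differentiable_imp_continuous_within)
next
  case (Suc k)
  then show ?case by (metis Ck_on.simps(2))
qed

lemma Ck_on_add: "Ck_on k UNIV f \<Longrightarrow> Ck_on k UNIV g \<Longrightarrow> Ck_on k UNIV (\<lambda>x. f x + g x)"
proof (induction k arbitrary: f g)
  case 0
  then show ?case by (auto intro!: continuous_intros)
next
  case (Suc k)
  have "partial_deriv i (\<lambda>x. f x + g x) = (\<lambda>x. partial_deriv i f x + partial_deriv i g x)" for i
  proof
    fix x
    have "(f has_derivative frechet_derivative f (at x)) (at x)" "(g has_derivative frechet_derivative g (at x)) (at x)"
      using Suc.prems by (simp_all add: frechet_derivative_works[symmetric])
    from partial_deriv_eq[OF has_derivative_add[OF this]]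
    show "partial_deriv i (\<lambda>x. f x + g x) x = partial_deriv i f x + partial_deriv i g x"
      by (simp add: partial_deriv_def)
  qed
  then show ?case using Suc by (auto intro!: differentiable_add)
qed

lemma Ck_on_mult: "Ck_on k UNIV f \<Longrightarrow> Ck_on k UNIV g \<Longrightarrow> Ck_on k UNIV (\<lambda>x. f x * g x)"
proof (induction k arbitrary: f g)
  case 0
  then show ?case by (auto intro!: continuous_intros)
next
  case (Suc k)
  have *: "partial_deriv i (\<lambda>x. f x * g x) = (\<lambda>x. f x * partial_deriv i g x + partial_deriv i f x * g x)" for i
  proof
    fix x
    have "(f has_derivative frechet_derivative f (at x)) (at x)" "(g has_derivative frechet_derivative g (at x)) (at x)"
      using Suc.prems by (simp_all add: frechet_derivative_works[symmetric])
    from partial_deriv_eq[OF has_derivative_mult[OF this]]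
    show "partial_deriv i (\<lambda>x. f x * g x) x = f x * partial_deriv i g x + partial_deriv i f x * g x"
      by (simp add: partial_deriv_def)
  qed
  have "Ck_on k UNIV f" "Ck_on k UNIV g" using Suc.prems Ck_on_SucD by blast+
  moreover have "Ck_on k UNIV (partial_deriv i f)" "Ck_on k UNIV (partial_deriv i g)" for i
    using Suc.prems by auto
  ultimately have "Ck_on k UNIV (\<lambda>x. f x * partial_deriv i g x + partial_deriv i f x * g x)" for i
    using Suc.IH by (intro Ck_on_add) auto
  then show ?case using Suc.prems * by (auto intro!: differentiable_mult)
qed

lemma Ck_on_prod:
  assumes "finite I" "\<And>i. i \<in> I \<Longrightarrow> Ck_on k UNIV (f i)"
  shows "Ck_on k UNIV (\<lambda>x. \<Prod>i\<in>I. f i x)"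
  using assms by (induction I rule: finite_induct) (auto intro: Ck_on_const Ck_on_mult)

lemma Ck_on_translate: "Ck_on k UNIV f \<Longrightarrow> Ck_on k UNIV (\<lambda>x. f (x + c))"
proof (induction k arbitrary: f)
  case 0
  then show ?case by (auto intro!: continuous_intros continuous_on_compose2[of UNIV f])
next
  case (Suc k)
  have d: "((\<lambda>x. f (x + c)) has_derivative frechet_derivative f (at (x + c))) (at x)" for x
  proof -
    have "(f has_derivative frechet_derivative f (at (x + c))) (at (x + c))"
      using Suc.prems frechet_derivative_works by auto
    then show ?thesis by (rule has_derivative_compose[rotated]) (auto intro!: derivative_eq_intros)
  qed
  then have "partial_deriv i (\<lambda>x. f (x + c)) = (\<lambda>x. partial_deriv i f (x + c))" for i
    using partial_deriv_eq[OF d] by (auto simp: partial_deriv_def)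
  then show ?case using Suc d by (auto simp: differentiable_def)
qed

lemma partial_deriv_translate:
  assumes "Ck_on (Suc k) UNIV f"
  shows "partial_deriv i (\<lambda>x. f (x + c)) x = partial_deriv i f (x + c)"
proof -
  have "(f has_derivative frechet_derivative f (at (x + c))) (at (x + c))"
    using assms frechet_derivative_works by auto
  then have "((\<lambda>x. f (x + c)) has_derivative frechet_derivative f (at (x + c))) (at x)"
    by (rule has_derivative_compose[rotated]) (auto intro!: derivative_eq_intros)
  from partial_deriv_eq[OF this] show ?thesis by (simp add: partial_deriv_def)
qed

section \<open>Smooth bump functions on the line and on boxes\<close>

text \<open>The derivatives of \<open>exp (- 1 / t)\<close> on the positive half-line are \<open>poly (bump_poly n) (1 / t) * exp (- 1 / t)\<close>.\<close>

primrec bump_poly :: "nat \<Rightarrow> real poly" where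
  "bump_poly 0 = 1"
| "bump_poly (Suc n) = [:0, 0, 1:] * (bump_poly n - pderiv (bump_poly n))"

definition bump :: "nat \<Rightarrow> real \<Rightarrow> real" where
  "bump n t = (if t > 0 then poly (bump_poly n) (1 / t) * exp (- (1 / t)) else 0)"

lemma poly_exp_tendsto_0: "((\<lambda>s. poly p s * exp (- s)) \<longlongrightarrow> (0::real)) at_top"
proof -
  have "((\<lambda>s. \<Sum>i\<le>degree p. coeff p i * (s ^ i / exp s)) \<longlongrightarrow> (\<Sum>i\<le>degree p. coeff p i * 0)) at_top"
    by (intro tendsto_sum tendsto_mult tendsto_const tendsto_power_div_exp_0)
  moreover have "poly p s * exp (- s) = (\<Sum>i\<le>degree p. coeff p i * (s ^ i / exp s))" for s
    by (simp add: poly_altdef exp_minus sum_distrib_right divide_inverse mult.assoc)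
  ultimately show ?thesis by simp
qed

text \<open>Away from 0 this is the chain rule. At 0 the substitution s = 1 / t turns the right
  difference quotient into a polynomial times exp (- s) at infinity.\<close>

lemma bump_has_derivative: "(bump n has_real_derivative bump (Suc n) t) (at t)"
proof -
  consider "t > 0" | "t < 0" | "t = 0" by linarith
  then show ?thesis
  proof cases
    case 1
    have "((\<lambda>t. poly (bump_poly n) (1 / t) * exp (- (1 / t))) has_real_derivative
        poly (pderiv (bump_poly n)) (1 / t) * (- (1 / t\<^sup>2)) * exp (- (1 / t)) +
        poly (bump_poly n) (1 / t) * (exp (- (1 / t)) * (1 / t\<^sup>2))) (at t)"
      using 1 by (auto intro!: derivative_eq_intros DERIV_chain2[OF poly_DERIV] simp: power2_eq_square field_simps)
    also have "poly (pderiv (bump_poly n)) (1 / t) * (- (1 / t\<^sup>2)) * exp (- (1 / t)) +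
        poly (bump_poly n) (1 / t) * (exp (- (1 / t)) * (1 / t\<^sup>2)) = bump (Suc n) t"
      using 1 by (simp add: bump_def algebra_simps power2_eq_square)
    finally show ?thesis
      by (rule has_field_derivative_transform_within_open[where S = "{0<..}"]) (use 1 in \<open>auto simp: bump_def\<close>)
  next
    case 2
    have "((\<lambda>t. 0) has_real_derivative bump (Suc n) t) (at t)" using 2 by (simp add: bump_def)
    then show ?thesis
      by (rule has_field_derivative_transform_within_open[where S = "{..<0}"]) (use 2 in \<open>auto simp: bump_def\<close>)
  next
    case 3
    \<comment> \<open>\<open>pCons 0\<close> multiplies the polynomial by its variable, which
      accounts for the factor 1 / t of the difference quotient.\<close>
    have "((\<lambda>s. poly (pCons 0 (bump_poly n)) (inverse s) * exp (- inverse s)) \<longlongrightarrow> (0::real)) (at_right 0)"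
      by (rule filterlim_compose[OF poly_exp_tendsto_0 filterlim_inverse_at_top_right])
    then have "((\<lambda>s. (bump n s - bump n 0) / (s - 0)) \<longlongrightarrow> 0) (at_right 0)"
      by (rule Lim_transform_eventually)
        (auto simp: eventually_at_right_less bump_def divide_inverse mult_ac
          intro: eventually_mono[OF eventually_at_right_less[of 0]])
    moreover have "((\<lambda>s. (bump n s - bump n 0) / (s - 0)) \<longlongrightarrow> 0) (at_left 0)"
      by (rule Lim_transform_eventually[OF tendsto_const])
        (auto simp: bump_def eventually_at_filter)
    ultimately show ?thesis
      using 3 by (simp add: has_field_derivative_iff filterlim_at_split bump_def[of "Suc n"])
  qed
qed

text \<open>Stated for all \<open>n\<close> so that the induction on \<open>k\<close> can pass to
  the partial derivatives, which are multiples of \<open>bump (Suc n)\<close>.\<close>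

lemma Ck_on_bump: "Ck_on k UNIV (\<lambda>x::real^'n::finite. bump n (m * x $ j + c))"
proof (induction k arbitrary: n)
  case 0
  have "continuous_on UNIV (bump n)"
    using bump_has_derivative DERIV_continuous_on by blast
  then show ?case by (auto intro!: continuous_intros continuous_on_compose2[of UNIV "bump n"])
next
  case (Suc k)
  have d: "((\<lambda>x::real^'n. bump n (m * x $ j + c)) has_derivative (\<lambda>h. bump (Suc n) (m * x $ j + c) * (m * h $ j))) (at x)" for x
  proof -
    have "((\<lambda>x::real^'n. m * x $ j + c) has_derivative (\<lambda>h. m * h $ j)) (at x)"
      by (auto intro!: derivative_eq_intros bounded_linear_imp_has_derivative[OF bounded_linear_vec_nth])
    from has_derivative_compose[OF this bump_has_derivative[unfolded has_field_derivative_def]]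
    show ?thesis by simp
  qed
  have "partial_deriv i (\<lambda>x::real^'n. bump n (m * x $ j + c)) =
     (\<lambda>x. (if i = j then m else 0) * bump (Suc n) (m * x $ j + c))" for i
    using partial_deriv_eq[OF d] by (auto simp: axis_def)
  moreover have "Ck_on k UNIV (\<lambda>x::real^'n. (if i = j then m else 0) * bump (Suc n) (m * x $ j + c))" for i
    using Suc[of "Suc n"] by (intro Ck_on_mult Ck_on_const) auto
  ultimately show ?case using d by (auto simp: differentiable_def)
qed

text \<open>A smooth approximation of the indicator of the open box: each factor is exp (- 1 / (m
  s)) with s the distance to a face, and tends to 1 as m grows. The arguments are written in the
  affine form required by \<open>Ck_on_bump\<close>.\<close>

definition box_bump :: "nat \<Rightarrow> real^'n::finite \<Rightarrow> real^'n \<Rightarrow> real^'n \<Rightarrow> real" where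
  "box_bump m a b x = (\<Prod>j\<in>UNIV. bump 0 (real m * x $ j + - (real m * a $ j)) * bump 0 (- real m * x $ j + real m * b $ j))"

lemma bump_0_bounds: "0 \<le> bump 0 t" "bump 0 t \<le> 1"
  by (auto simp: bump_def)

lemma box_bump_eq_0: "x \<notin> box a b \<Longrightarrow> box_bump m a b x = 0"
proof -
  assume "x \<notin> box a b"
  then obtain j where "\<not> (a $ j < x $ j \<and> x $ j < b $ j)" by (auto simp: mem_box_cart)
  then have "real m * x $ j + - (real m * a $ j) \<le> 0 \<or> - real m * x $ j + real m * b $ j \<le> 0"
    by (auto simp: not_less mult_left_mono)
  then have "bump 0 (real m * x $ j + - (real m * a $ j)) * bump 0 (- real m * x $ j + real m * b $ j) = 0"
    by (auto simp: bump_def)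
  then show "box_bump m a b x = 0" unfolding box_bump_def by (auto intro!: prod_zero)
qed

lemma box_bump_bounds: "0 \<le> box_bump m a b x" "box_bump m a b x \<le> 1"
  unfolding box_bump_def by (auto intro!: prod_nonneg prod_le_1 mult_le_one simp: bump_0_bounds)

lemma test_function_box_bump: "test_function (box_bump m a b)"
  unfolding test_function_def compactly_supported_def
proof (intro conjI allI)
  show "Ck_on k UNIV (box_bump m a b)" for k
    unfolding box_bump_def by (intro Ck_on_prod Ck_on_mult Ck_on_bump) auto
  have "closure {x. box_bump m a b x \<noteq> 0} \<subseteq> cbox a b"
    by (intro closure_minimal) (use box_bump_eq_0 box_subset_cbox in \<open>blast, auto\<close>)
  then show "compact (closure {x. box_bump m a b x \<noteq> 0})"
    by (meson bounded_cbox bounded_subset closed_closure compact_eq_bounded_closed)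
qed

lemma box_bump_tendsto: "(\<lambda>m. box_bump m a b x) \<longlonglongrightarrow> indicator (box a b) x"
proof (cases "x \<in> box a b")
  case True
  have lim: "(\<lambda>m. bump 0 (real m * s)) \<longlonglongrightarrow> 1" if "s > 0" for s :: real
  proof -
    have "(\<lambda>m. exp (- (1 / s) * inverse (real m))) \<longlonglongrightarrow> exp (- (1 / s) * 0)"
      by (intro tendsto_intros lim_inverse_n)
    moreover have "\<forall>\<^sub>F m in sequentially. exp (- (1 / s) * inverse (real m)) = bump 0 (real m * s)"
      using eventually_gt_at_top[of 0] by eventually_elim (use that in \<open>simp add: bump_def field_simps\<close>)
    ultimately show ?thesis by (simp add: Lim_transform_eventually)
  qed
  have "(\<lambda>m. \<Prod>j\<in>UNIV. bump 0 (real m * (x $ j - a $ j)) * bump 0 (real m * (b $ j - x $ j))) \<longlonglongrightarrow> (\<Prod>j\<in>(UNIV::'a set). 1 * 1)"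
    using True by (intro tendsto_prod tendsto_mult lim) (auto simp: mem_box_cart)
  then show ?thesis using True by (simp add: box_bump_def algebra_simps)
qed (simp add: box_bump_eq_0)

section \<open>The fundamental lemma of the calculus of variations\<close>

text \<open>The positive and negative parts of \<open>f\<close> are densities of two measures that
  agree on boxes. Boxes form an intersection-stable generator of the Borel sets, so the measures,
  and then the densities, coincide; both parts are equal only where \<open>f\<close> is 0.\<close>

lemma AE_zero_if_box_integrals_zero:
  fixes f :: "'a::euclidean_space \<Rightarrow> real"
  assumes [measurable]: "f \<in> borel_measurable borel"
    and int: "\<And>a b. integrable lborel (\<lambda>x. indicator (box a b) x * f x)"
    and zero: "\<And>a b. (LINT x|lborel. indicator (box a b) x * f x) = 0"
  shows "AE x in lborel. f x = 0"
proof -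
  \<comment> \<open>\<open>ennreal\<close> sends negative numbers to 0, so \<open>N 1\<close> and
    \<open>N (-1)\<close> have the positive and the negative part of \<open>f\<close> as
    densities.\<close>
  define N where "N = (\<lambda>s. density lborel (\<lambda>x. ennreal (s * f x)))"
  have em: "emeasure (N s) (box a b) = (\<integral>\<^sup>+x. ennreal (s * (indicator (box a b) x * f x)) \<partial>lborel)" for s a b
    unfolding N_def by (subst emeasure_density) (auto intro!: nn_integral_cong split: split_indicator)
  have fin: "emeasure (N s) (box a b) \<noteq> \<infinity>" if "s = 1 \<or> s = -1" for s a b
    using int[of a b] that unfolding em real_integrable_def by auto
  have eq: "emeasure (N 1) (box a b) = emeasure (N (-1)) (box a b)" for a b
  proof -
    have "enn2real (emeasure (N 1) (box a b)) = enn2real (emeasure (N (-1)) (box a b))"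
      using zero[of a b] real_lebesgue_integral_def[OF int[of a b]] by (simp add: em)
    moreover have "emeasure (N 1) (box a b) < \<top>" "emeasure (N (-1)) (box a b) < \<top>"
      using fin[of 1 a b] fin[of "-1" a b] by (auto simp: less_top)
    ultimately show ?thesis by (metis ennreal_enn2real)
  qed
  let ?E = "range (\<lambda>(a, b). box a b :: 'a set)"
  have "N 1 = N (-1)"
  proof (rule measure_eqI_generator_eq[where E = ?E and \<Omega> = UNIV and A = "\<lambda>n. box (- (real n *\<^sub>R One)) (real n *\<^sub>R One)"])
    show "Int_stable ?E" by (auto simp: Int_stable_def box_Int_box)
    show "sets (N 1) = sigma_sets UNIV ?E" "sets (N (-1)) = sigma_sets UNIV ?E"
      by (simp_all add: borel_eq_box N_def)
    show "emeasure (N 1) X = emeasure (N (-1)) X" if "X \<in> ?E" for X using that eq by auto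
    show "(\<Union>n::nat. box (- (real n *\<^sub>R One)) (real n *\<^sub>R One)) = (UNIV::'a set)"
      by (rule UN_box_eq_UNIV)
    show "emeasure (N 1) (box (- (real n *\<^sub>R One)) (real n *\<^sub>R One)) \<noteq> \<infinity>" for n :: nat
      using fin by blast
  qed auto
  then have "AE x in lborel. ennreal (1 * f x) = ennreal (-1 * f x)"
    unfolding N_def by (intro sigma_finite_measure.density_unique[OF sigma_finite_lborel]) auto
  then show ?thesis
    by eventually_elim (smt (verit) ennreal_eq_0_iff ennreal_inj)
qed

text \<open>\<open>F\<close> is the pointwise limit of its truncations to balls, each of which is
  integrable.\<close>

lemma locally_integrable_borel_measurable:
  fixes F :: "real^'n::finite \<Rightarrow> 'b::euclidean_space"
  assumes "locally_integrable F"
  shows "F \<in> borel_measurable borel"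
proof (rule borel_measurable_LIMSEQ_metric)
  show "(\<lambda>x. indicator (cball 0 (real n)) x *\<^sub>R F x) \<in> borel_measurable borel" for n
  proof -
    have "integrable lborel (\<lambda>x. indicator (cball 0 (real n)) x *\<^sub>R F x)"
      using assms by (simp add: locally_integrable_def set_integrable_def)
    then show ?thesis by (auto dest: borel_measurable_integrable)
  qed
  show "(\<lambda>n. indicator (cball 0 (real n)) x *\<^sub>R F x) \<longlonglongrightarrow> F x" for x
  proof (rule tendsto_eventually)
    show "\<forall>\<^sub>F n in sequentially. indicator (cball 0 (real n)) x *\<^sub>R F x = F x"
      using eventually_ge_at_top[of "nat \<lceil>norm x\<rceil>"] by eventually_elim (auto simp: indicator_def)
  qed
qed

lemma compactly_supported_zero: "x \<notin> closure {x. f x \<noteq> 0} \<Longrightarrow> f x = 0"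
  using closure_subset[of "{x. f x \<noteq> 0}"] by blast

lemma compactly_supported_bounded:
  assumes "continuous_on UNIV f" "compactly_supported f"
  obtains B where "0 \<le> B" "\<And>x. \<bar>f x\<bar> \<le> B"
proof -
  let ?K = "closure {x. f x \<noteq> 0}"
  have "bounded (f ` ?K)"
    using assms by (intro compact_imp_bounded compact_continuous_image)
      (auto simp: compactly_supported_def intro: continuous_on_subset)
  then obtain B where B: "\<And>x. x \<in> ?K \<Longrightarrow> \<bar>f x\<bar> \<le> B"
    unfolding bounded_iff by auto
  have "\<bar>f x\<bar> \<le> max 0 B" for x
    using B[of x] compactly_supported_zero[of x f] by (cases "x \<in> ?K") auto
  then show thesis using that[of "max 0 B"] by auto
qed

lemma integrable_compactly_supported:
  fixes H :: "real^'n::finite \<Rightarrow> 'b::euclidean_space"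
  assumes c: "continuous_on UNIV f" and s: "compactly_supported f" and H: "locally_integrable H"
  shows "integrable lborel (\<lambda>x. f x *\<^sub>R H x)"
proof -
  let ?K = "closure {x. f x \<noteq> 0}"
  note [measurable] = borel_measurable_continuous_onI[OF c] locally_integrable_borel_measurable[OF H]
  obtain B where B: "0 \<le> B" "\<And>x. \<bar>f x\<bar> \<le> B" using compactly_supported_bounded[OF c s] by blast
  have "integrable lborel (\<lambda>x. B *\<^sub>R (indicator ?K x *\<^sub>R H x))"
    using H s by (intro integrable_scaleR_right) (auto simp: locally_integrable_def set_integrable_def compactly_supported_def)
  then show ?thesis
  proof (rule Bochner_Integration.integrable_bound)
    show "AE x in lborel. norm (f x *\<^sub>R H x) \<le> norm (B *\<^sub>R (indicator ?K x *\<^sub>R H x))"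
    proof (intro AE_I2)
      fix x
      show "norm (f x *\<^sub>R H x) \<le> norm (B *\<^sub>R (indicator ?K x *\<^sub>R H x))"
        using B compactly_supported_zero[of x f] by (cases "x \<in> ?K") (auto simp: mult_right_mono)
    qed
  qed simp
qed

text \<open>Dominated convergence along \<open>box_bump\<close> transfers the vanishing from test
  functions to indicators of boxes; the scalar case is then applied to each coordinate.\<close>

lemma AE_zero_if_test_integrals_zero:
  fixes F :: "real^'n::finite \<Rightarrow> 'b::euclidean_space"
  assumes F: "locally_integrable F"
    and zero: "\<And>\<phi>. test_function \<phi> \<Longrightarrow> (LINT x|lborel. \<phi> x *\<^sub>R F x) = 0"
  shows "AE x in lborel. F x = 0"
proof -
  note [measurable] = locally_integrable_borel_measurable[OF F]
  have box: "integrable lborel (\<lambda>x. indicator (box a b) x *\<^sub>R F x)"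
     "(LINT x|lborel. indicator (box a b) x *\<^sub>R F x) = 0" for a b
  proof -
    \<comment> \<open>The dominating function lives on the closed box because local integrability
      speaks of compact sets.\<close>
    have c: "integrable lborel (\<lambda>x. norm (indicator (cbox a b) x *\<^sub>R F x))"
      using F by (intro integrable_norm) (simp add: locally_integrable_def set_integrable_def)
    have [measurable]: "box_bump m a b \<in> borel_measurable borel" for m
      by (rule borel_measurable_continuous_onI)
        (use test_function_box_bump[of m a b] in \<open>auto simp: test_function_def dest: spec[of _ 0]\<close>)
    have bd: "AE x in lborel. norm (box_bump m a b x *\<^sub>R F x) \<le> norm (indicator (cbox a b) x *\<^sub>R F x)" for m
      using box_bump_bounds[of m a b] box_bump_eq_0[of _ a b m] box_subset_cbox[of a b]
      by (intro AE_I2) (force simp: indicator_def mult_left_le_one_le)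
    have lim: "AE x in lborel. (\<lambda>m. box_bump m a b x *\<^sub>R F x) \<longlonglongrightarrow> indicator (box a b) x *\<^sub>R F x"
      by (intro AE_I2 tendsto_intros box_bump_tendsto)
    note dct = integrable_dominated_convergence[OF _ _ c lim bd] integral_dominated_convergence[OF _ _ c lim bd]
    show "integrable lborel (\<lambda>x. indicator (box a b) x *\<^sub>R F x)" by (rule dct) auto
    have "(\<lambda>m. LINT x|lborel. box_bump m a b x *\<^sub>R F x) \<longlonglongrightarrow> (LINT x|lborel. indicator (box a b) x *\<^sub>R F x)"
      by (rule dct) auto
    then show "(LINT x|lborel. indicator (box a b) x *\<^sub>R F x) = 0"
      by (simp add: zero test_function_box_bump LIMSEQ_const_iff)
  qed
  have "AE x in lborel. F x \<bullet> e = 0" for e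
  proof (rule AE_zero_if_box_integrals_zero)
    show "integrable lborel (\<lambda>x. indicator (box a b) x * (F x \<bullet> e))" for a b
      using integrable_inner_left[of e, OF box(1)[of a b]] by simp
    show "(LINT x|lborel. indicator (box a b) x * (F x \<bullet> e)) = 0" for a b
      using integral_inner_left[of e, OF box(1)[of a b]] box(2)[of a b] by simp
  qed simp
  then have "AE x in lborel. \<forall>e\<in>Basis. F x \<bullet> e = 0"
    by (intro AE_finite_allI) auto
  then show ?thesis by eventually_elim (simp add: euclidean_all_zero_iff)
qed

text \<open>Allows the gradient selected by \<open>SOME\<close> inside \<open>energy\<close> to be
  exchanged for any explicit one.\<close>

lemma weak_gradient_unique:
  fixes \<psi> :: "real^'n::finite \<Rightarrow> 'k::{real_normed_field,euclidean_space}"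
  assumes G: "is_weak_gradient \<psi> G" and G': "is_weak_gradient \<psi> G'"
  shows "AE x in lborel. G x = G' x"
proof -
  have comp: "locally_integrable (\<lambda>x. H x $ i)" if "locally_integrable H" for H :: "real^'n \<Rightarrow> 'k^'n" and i
    unfolding locally_integrable_def set_integrable_def
  proof (intro allI impI)
    fix K :: "(real^'n) set" assume "compact K"
    then have "integrable lborel (\<lambda>x. (indicator K x *\<^sub>R H x) $ i)"
      using that unfolding locally_integrable_def set_integrable_def
      by (intro integrable_bounded_linear[OF bounded_linear_vec_nth]) auto
    then show "integrable lborel (\<lambda>x. indicator K x *\<^sub>R (H x $ i))" by simp
  qed
  have "AE x in lborel. G x $ i - G' x $ i = 0" for i
  proof (rule AE_zero_if_test_integrals_zero)
    have li: "locally_integrable (\<lambda>x. G x $ i)" "locally_integrable (\<lambda>x. G' x $ i)"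
      using G G' comp by (auto simp: is_weak_gradient_def)
    then show "locally_integrable (\<lambda>x. G x $ i - G' x $ i)"
      by (auto simp: locally_integrable_def set_integrable_def algebra_simps intro!: Bochner_Integration.integrable_diff)
    fix \<phi> :: "real^'n \<Rightarrow> real" assume \<phi>: "test_function \<phi>"
    have i: "integrable lborel (\<lambda>x. \<phi> x *\<^sub>R H x)" if "locally_integrable H" for H :: "real^'n \<Rightarrow> 'k"
      using \<phi> that by (intro integrable_compactly_supported) (auto simp: test_function_def dest: spec[of _ 0])
    have "(LINT x|lborel. \<phi> x *\<^sub>R (G x $ i - G' x $ i)) = (LINT x|lborel. \<phi> x *\<^sub>R (G x $ i)) - (LINT x|lborel. \<phi> x *\<^sub>R (G' x $ i))"
      using Bochner_Integration.integral_diff[OF i[OF li(1)] i[OF li(2)]] by (simp add: scaleR_diff_right)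
    also have "\<dots> = 0"
    proof -
      have "(LINT x|lborel. partial_deriv i \<phi> x *\<^sub>R \<psi> x) = - (LINT x|lborel. \<phi> x *\<^sub>R (H x $ i))"
        if "is_weak_gradient \<psi> H" for H
        using that \<phi> by (simp add: is_weak_gradient_def)
      from this[OF G] this[OF G'] show ?thesis by simp
    qed
    finally show "(LINT x|lborel. \<phi> x *\<^sub>R (G x $ i - G' x $ i)) = 0" .
  qed
  then have "AE x in lborel. \<forall>i\<in>UNIV. G x $ i - G' x $ i = 0" by (intro AE_finite_allI) auto
  then show ?thesis by eventually_elim (simp add: vec_eq_iff)
qed

subsection \<open>Difference quotients of Sobolev functions\<close>

lemma integrable_translate_iff:
  fixes f :: "'a::euclidean_space \<Rightarrow> 'b::{banach, second_countable_topology}"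
  assumes [measurable]: "f \<in> borel_measurable borel"
  shows "integrable lborel (\<lambda>x. f (x + c)) \<longleftrightarrow> integrable lborel f"
proof -
  have "integrable (distr lborel borel ((+) c)) f \<longleftrightarrow> integrable lborel (\<lambda>x. f (c + x))"
    by (rule integrable_distr_eq) auto
  then show ?thesis by (simp add: lborel_distr_plus add.commute)
qed

lemma integral_translate:
  fixes f :: "'a::euclidean_space \<Rightarrow> 'b::{banach, second_countable_topology}"
  assumes [measurable]: "f \<in> borel_measurable borel"
  shows "(LINT x|lborel. f (x + c)) = (LINT x|lborel. f x)"
proof -
  have "(LINT x|distr lborel borel ((+) c). f x) = (LINT x|lborel. f (c + x))"
    by (rule integral_distr) auto
  then show ?thesis by (simp add: lborel_distr_plus add.commute)
qed

lemma nn_integral_translate: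
  fixes f :: "'a::euclidean_space \<Rightarrow> ennreal"
  assumes [measurable]: "f \<in> borel_measurable borel"
  shows "(\<integral>\<^sup>+x. f (x + c) \<partial>lborel) = (\<integral>\<^sup>+x. f x \<partial>lborel)"
proof -
  have "(\<integral>\<^sup>+x. f x \<partial>distr lborel borel ((+) c)) = (\<integral>\<^sup>+x. f (c + x) \<partial>lborel)"
    by (rule nn_integral_distr) auto
  then show ?thesis by (simp add: lborel_distr_plus add.commute)
qed

text \<open>On a compact set the pointwise bound |f| \<le> 1 + |f|^2 has an integrable right-hand
  side.\<close>

lemma locally_integrable_L2:
  fixes f :: "real^'n::finite \<Rightarrow> 'b::euclidean_space"
  assumes [measurable]: "f \<in> borel_measurable borel" and i: "integrable lborel (\<lambda>x. (norm (f x))\<^sup>2)"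
  shows "locally_integrable f"
  unfolding locally_integrable_def set_integrable_def
proof (intro allI impI)
  fix K :: "(real^'n) set" assume K: "compact K"
  then have [measurable]: "K \<in> sets borel" by (simp add: compact_imp_closed)
  have "integrable lborel (\<lambda>x. indicator K x *\<^sub>R (1::real))"
    by (rule borel_integrable_compact[OF K]) auto
  then have "integrable lborel (\<lambda>x. indicator K x *\<^sub>R (1::real) + (norm (f x))\<^sup>2)"
    using i by (rule Bochner_Integration.integrable_add)
  then show "integrable lborel (\<lambda>x. indicator K x *\<^sub>R f x)"
  proof (rule Bochner_Integration.integrable_bound)
    have "norm (f x) \<le> 1 + (norm (f x))\<^sup>2" for x
      using sum_squares_bound[of "norm (f x)" 1] norm_ge_zero[of "f x"] by (simp del: norm_ge_zero)
    then show "AE x in lborel. norm (indicator K x *\<^sub>R f x) \<le> norm (indicator K x *\<^sub>R (1::real) + (norm (f x))\<^sup>2)"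
      by (auto simp: indicator_def abs_of_nonneg)
  qed simp
qed

lemma indicator_square: "(indicator K x)\<^sup>2 = (indicator K x :: 'a::semiring_1)"
  by (auto split: split_indicator)

text \<open>Square integrability makes the integrand of all Fubini arguments below integrable on the strip.\<close>

lemma integrable_strip:
  fixes u :: "real^'n::finite \<Rightarrow> real" and v :: "real^'n \<Rightarrow> 'b::euclidean_space"
  assumes [measurable]: "u \<in> borel_measurable borel" "v \<in> borel_measurable borel"
    and u: "integrable lborel (\<lambda>x. (u x)\<^sup>2)" and v: "integrable lborel (\<lambda>x. (norm (v x))\<^sup>2)" and h: "0 \<le> h"
  shows "integrable (lborel \<Otimes>\<^sub>M lborel) (\<lambda>(x, t). indicator {0..h} t *\<^sub>R (u (x + t *\<^sub>R a) *\<^sub>R v (x + t *\<^sub>R b)))"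
proof -
  let ?g = "\<lambda>(x, t). indicator {0..h} t * ((u (x + t *\<^sub>R a))\<^sup>2 + (norm (v (x + t *\<^sub>R b)))\<^sup>2)"
  let ?G = "\<lambda>p. ennreal (?g p)"
  have "(\<integral>\<^sup>+p. ?G p \<partial>(lborel \<Otimes>\<^sub>M lborel)) = (\<integral>\<^sup>+t. \<integral>\<^sup>+x. ?G (x, t) \<partial>lborel \<partial>lborel)"
    by (rule lborel_pair.nn_integral_snd[symmetric]) measurable
  also have "\<dots> = (\<integral>\<^sup>+t. (\<integral>\<^sup>+x. (u x)\<^sup>2 \<partial>lborel) * indicator {0..h} t + (\<integral>\<^sup>+x. (norm (v x))\<^sup>2 \<partial>lborel) * indicator {0..h} t \<partial>lborel)"
  proof (intro nn_integral_cong)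
    fix t :: real
    have "(\<integral>\<^sup>+x. ?G (x, t) \<partial>lborel) =
       (\<integral>\<^sup>+x. ennreal (indicator {0..h} t) * ennreal ((u (x + t *\<^sub>R a))\<^sup>2) + ennreal (indicator {0..h} t) * ennreal ((norm (v (x + t *\<^sub>R b)))\<^sup>2) \<partial>lborel)"
      by (intro nn_integral_cong) (auto split: split_indicator simp flip: ennreal_plus)
    also have "\<dots> = ennreal (indicator {0..h} t) * (\<integral>\<^sup>+x. (u (x + t *\<^sub>R a))\<^sup>2 \<partial>lborel) + ennreal (indicator {0..h} t) * (\<integral>\<^sup>+x. (norm (v (x + t *\<^sub>R b)))\<^sup>2 \<partial>lborel)"
      by (subst nn_integral_add) (auto simp: nn_integral_cmult)
    also have "(\<integral>\<^sup>+x. (u (x + t *\<^sub>R a))\<^sup>2 \<partial>lborel) = (\<integral>\<^sup>+x. (u x)\<^sup>2 \<partial>lborel)"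
      by (rule nn_integral_translate[of "\<lambda>x. ennreal ((u x)\<^sup>2)"]) simp
    also have "(\<integral>\<^sup>+x. (norm (v (x + t *\<^sub>R b)))\<^sup>2 \<partial>lborel) = (\<integral>\<^sup>+x. (norm (v x))\<^sup>2 \<partial>lborel)"
      by (rule nn_integral_translate[of "\<lambda>x. ennreal ((norm (v x))\<^sup>2)"]) simp
    finally show "(\<integral>\<^sup>+x. ?G (x, t) \<partial>lborel) = (\<integral>\<^sup>+x. (u x)\<^sup>2 \<partial>lborel) * indicator {0..h} t + (\<integral>\<^sup>+x. (norm (v x))\<^sup>2 \<partial>lborel) * indicator {0..h} t"
      by (auto split: split_indicator)
  qed
  also have "\<dots> = (\<integral>\<^sup>+x. (u x)\<^sup>2 \<partial>lborel) * ennreal h + (\<integral>\<^sup>+x. (norm (v x))\<^sup>2 \<partial>lborel) * ennreal h"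
    using h by (subst nn_integral_add) (auto simp: nn_integral_cmult_indicator)
  also have "\<dots> < \<infinity>"
    using integrableD(2)[OF u] integrableD(2)[OF v] by (simp add: ennreal_mult_less_top less_top)
  finally have "integrable (lborel \<Otimes>\<^sub>M lborel) ?g"
    by (intro integrableI_nonneg) (auto simp: case_prod_unfold)
  then show ?thesis
  proof (rule Bochner_Integration.integrable_bound)
    have "\<bar>u y\<bar> * norm (v z) \<le> (u y)\<^sup>2 + (norm (v z))\<^sup>2" for y z
    proof -
      have "0 \<le> \<bar>u y\<bar> * norm (v z)" by simp
      moreover have "2 * (\<bar>u y\<bar> * norm (v z)) \<le> (u y)\<^sup>2 + (norm (v z))\<^sup>2"
        using sum_squares_bound[of "\<bar>u y\<bar>" "norm (v z)"] by (simp add: mult.assoc)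
      ultimately show ?thesis by linarith
    qed
    then show "AE p in lborel \<Otimes>\<^sub>M lborel. norm (case p of (x, t) \<Rightarrow> indicator {0..h} t *\<^sub>R (u (x + t *\<^sub>R a) *\<^sub>R v (x + t *\<^sub>R b))) \<le> norm (?g p)"
      by (intro AE_I2) (auto split: split_indicator simp: abs_of_nonneg)
  qed measurable
qed

lemma test_functionD:
  assumes "test_function \<phi>"
  shows "Ck_on k UNIV \<phi>" "compactly_supported \<phi>" "continuous_on UNIV \<phi>" "continuous_on UNIV (partial_deriv i \<phi>)"
    "\<phi> \<in> borel_measurable borel" "partial_deriv i \<phi> \<in> borel_measurable borel"
    "(\<phi> has_derivative frechet_derivative \<phi> (at x)) (at x)"
proof -
  show "Ck_on k UNIV \<phi>" "compactly_supported \<phi>" using assms by (auto simp: test_function_def)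
  have "Ck_on 0 UNIV \<phi>" "Ck_on (Suc 0) UNIV \<phi>" using assms by (auto simp: test_function_def)
  then show "continuous_on UNIV \<phi>" "continuous_on UNIV (partial_deriv i \<phi>)"
     "(\<phi> has_derivative frechet_derivative \<phi> (at x)) (at x)"
    by (auto simp: frechet_derivative_works[symmetric])
  then show "\<phi> \<in> borel_measurable borel" "partial_deriv i \<phi> \<in> borel_measurable borel"
    by (auto intro: borel_measurable_continuous_onI)
qed

lemma compactly_supported_mono:
  assumes "compactly_supported f" "\<And>x. x \<notin> closure {x. f x \<noteq> 0} \<Longrightarrow> g x = 0"
  shows "compactly_supported g"
proof -
  have "closure {x. g x \<noteq> 0} \<subseteq> closure {x. f x \<noteq> 0}"
    using assms(2) by (intro closure_minimal) auto
  then show ?thesis using assms(1) unfolding compactly_supported_def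
    by (meson bounded_subset closed_closure compact_eq_bounded_closed)
qed

lemma has_derivative_zero_outside_support:
  fixes f :: "'a::real_normed_vector \<Rightarrow> 'b::real_normed_vector"
  assumes "(f has_derivative D) (at x)" "x \<notin> closure {x. f x \<noteq> 0}"
  shows "D = (\<lambda>h. 0)"
proof -
  have "(f has_derivative (\<lambda>h. 0)) (at x)"
  proof (rule has_derivative_transform_within_open[OF has_derivative_const[of 0]])
    show "open (- closure {x. f x \<noteq> 0})" by auto
    show "\<And>y. y \<in> - closure {x. f x \<noteq> 0} \<Longrightarrow> 0 = f y"
      using closure_subset[of "{x. f x \<noteq> 0}"] by auto
  qed (use assms in auto)
  then show ?thesis using assms(1) has_derivative_unique by blast
qed

lemma compactly_supported_partial_deriv:
  assumes "test_function \<phi>" shows "compactly_supported (partial_deriv i \<phi>)"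
proof (rule compactly_supported_mono)
  show "compactly_supported \<phi>" using assms by (rule test_functionD)
  show "partial_deriv i \<phi> x = 0" if "x \<notin> closure {x. \<phi> x \<noteq> 0}" for x
    using has_derivative_zero_outside_support[OF test_functionD(7)[OF assms] that]
    by (simp add: partial_deriv_def)
qed

lemma test_function_translate:
  assumes "test_function \<phi>" shows "test_function (\<lambda>x. \<phi> (x + c))"
proof -
  have "{x. \<phi> (x + c) \<noteq> 0} = (\<lambda>x. - c + x) ` {x. \<phi> x \<noteq> 0}"
    by (force simp: image_iff)
  then have "closure {x. \<phi> (x + c) \<noteq> 0} = (\<lambda>x. - c + x) ` closure {x. \<phi> x \<noteq> 0}"
    by (simp only: closure_translation)
  moreover have "compact ((\<lambda>x. - c + x) ` closure {x. \<phi> x \<noteq> 0})"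
    using assms by (intro compact_translation) (auto simp: test_function_def compactly_supported_def)
  ultimately show ?thesis using assms by (auto simp: test_function_def compactly_supported_def intro: Ck_on_translate)
qed

lemma integrable_compactly_supported_real:
  fixes f :: "real^'n::finite \<Rightarrow> real"
  assumes c: "continuous_on UNIV f" and s: "compactly_supported f"
  shows "integrable lborel f"
proof -
  have "locally_integrable (\<lambda>x::real^'n. 1::real)"
    using borel_integrable_compact[of _ "\<lambda>x::real^'n. 1::real"]
    by (simp add: locally_integrable_def set_integrable_def)
  from integrable_compactly_supported[OF c s this] show ?thesis by simp
qed

lemma integrable_square_compactly_supported:
  fixes f :: "real^'n::finite \<Rightarrow> real"
  assumes c: "continuous_on UNIV f" and s: "compactly_supported f"
  shows "integrable lborel (\<lambda>x. (f x)\<^sup>2)"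
proof -
  have "locally_integrable f"
    using borel_integrable_compact[of _ f] continuous_on_subset[OF c]
    by (simp add: locally_integrable_def set_integrable_def)
  from integrable_compactly_supported[OF c s this] show ?thesis by (simp add: power2_eq_square)
qed

text \<open>The fundamental theorem of calculus for weak gradients, proved by testing against
  \<phi>. Translation moves the shift onto the test function, where the definition of the weak
  gradient applies; Fubini and the classical theorem for \<phi> then produce \<phi>(x) - \<phi>(x -
  h e), which is the difference operator transposed.\<close>

lemma weak_gradient_difference:
  fixes \<psi> :: "real^'n::finite \<Rightarrow> 'k::{real_normed_field,euclidean_space}"
  assumes G: "is_weak_gradient \<psi> G" and \<psi>2: "integrable lborel (\<lambda>x. (norm (\<psi> x))\<^sup>2)"
    and G2: "integrable lborel (\<lambda>x. (norm (G x $ i))\<^sup>2)" and h: "0 \<le> h"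
  shows "AE x in lborel. \<psi> (x + h *\<^sub>R axis i 1) - \<psi> x = (LINT t|lborel. indicator {0..h} t *\<^sub>R (G (x + t *\<^sub>R axis i 1) $ i))"
proof -
  define e where "e = (axis i 1 :: real^'n)"
  define g where "g = (\<lambda>x. G x $ i)"
  define R where "R = (\<lambda>x. LINT t|lborel. indicator {0..h} t *\<^sub>R g (x + t *\<^sub>R e))"
  have [measurable]: "\<psi> \<in> borel_measurable borel"
    using G by (auto simp: is_weak_gradient_def intro: locally_integrable_borel_measurable)
  have "G \<in> borel_measurable borel"
    using G by (auto simp: is_weak_gradient_def intro: locally_integrable_borel_measurable)
  then have g[measurable]: "g \<in> borel_measurable borel"
    unfolding g_def by (rule measurable_compose) (auto intro!: borel_measurable_continuous_onI continuous_intros)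
  have g2: "integrable lborel (\<lambda>x. (norm (g x))\<^sup>2)" using G2 by (simp add: g_def)
  have Rm[measurable]: "R \<in> borel_measurable borel"
    unfolding R_def by measurable
  have liR: "locally_integrable R"
    unfolding locally_integrable_def set_integrable_def
  proof (intro allI impI)
    fix K :: "(real^'n) set" assume K: "compact K"
    then have [measurable]: "K \<in> sets borel" by (simp add: compact_imp_closed)
    have "integrable lborel (\<lambda>x. (indicator K x)\<^sup>2 :: real)"
      using borel_integrable_compact[OF K, of "\<lambda>x. 1::real"] by (simp add: indicator_square)
    \<comment> \<open>The indicator of \<open>K\<close> is the square-integrable scalar factor,
      taken without shift.\<close>
    from lborel_pair.integrable_fst'[OF integrable_strip[OF _ g this g2 h, of 0 e]]
    have "integrable lborel (\<lambda>x. LINT t|lborel. indicator {0..h} t *\<^sub>R (indicator K x *\<^sub>R g (x + t *\<^sub>R e)))"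
      by simp
    also have "(\<lambda>x. LINT t|lborel. indicator {0..h} t *\<^sub>R (indicator K x *\<^sub>R g (x + t *\<^sub>R e))) = (\<lambda>x. indicator K x *\<^sub>R R x)"
      by (auto simp: R_def fun_eq_iff split: split_indicator)
    finally show "integrable lborel (\<lambda>x. indicator K x *\<^sub>R R x)" .
  qed
  have li\<psi>: "locally_integrable \<psi>" using G by (simp add: is_weak_gradient_def)
  have \<psi>h2: "integrable lborel (\<lambda>x. (norm (\<psi> (x + h *\<^sub>R e)))\<^sup>2)"
    using \<psi>2 by (subst integrable_translate_iff) auto
  have li\<psi>h: "locally_integrable (\<lambda>x. \<psi> (x + h *\<^sub>R e))"
    by (rule locally_integrable_L2[OF _ \<psi>h2]) simp
  have "AE x in lborel. \<psi> (x + h *\<^sub>R e) - \<psi> x - R x = 0"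
  proof (rule AE_zero_if_test_integrals_zero)
    show "locally_integrable (\<lambda>x. \<psi> (x + h *\<^sub>R e) - \<psi> x - R x)"
      using liR li\<psi> li\<psi>h unfolding locally_integrable_def set_integrable_def
      by (auto simp: scaleR_diff_right)
    fix \<phi> :: "real^'n \<Rightarrow> real" assume \<phi>: "test_function \<phi>"
    note [measurable] = test_functionD(5,6)[OF \<phi>]
    note c = test_functionD(3)[OF \<phi>] and s = test_functionD(2)[OF \<phi>]
    note pc = test_functionD(4)[OF \<phi>, of i] and ps = compactly_supported_partial_deriv[OF \<phi>, of i]
    have \<phi>2: "integrable lborel (\<lambda>x. (\<phi> x)\<^sup>2)" by (rule integrable_square_compactly_supported[OF c s])
    have p2: "integrable lborel (\<lambda>x. (partial_deriv i \<phi> x)\<^sup>2)" by (rule integrable_square_compactly_supported[OF pc ps])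
    have inner: "(LINT x|lborel. \<phi> x *\<^sub>R g (x + t *\<^sub>R e)) = - (LINT x|lborel. partial_deriv i \<phi> (x + t *\<^sub>R (- e)) *\<^sub>R \<psi> x)" for t
    proof -
      have "(LINT x|lborel. \<phi> x *\<^sub>R g (x + t *\<^sub>R e)) = (LINT x|lborel. \<phi> (x + (- t *\<^sub>R e)) *\<^sub>R g x)"
        using integral_translate[of "\<lambda>x. \<phi> x *\<^sub>R g (x + t *\<^sub>R e)" "- t *\<^sub>R e"] by simp
      also have "\<dots> = - (LINT x|lborel. partial_deriv i (\<lambda>x. \<phi> (x + (- t *\<^sub>R e))) x *\<^sub>R \<psi> x)"
        using G test_function_translate[OF \<phi>, of "- t *\<^sub>R e"] unfolding is_weak_gradient_def g_def by simp
      also have "(\<lambda>x. partial_deriv i (\<lambda>x. \<phi> (x + (- t *\<^sub>R e))) x) = (\<lambda>x. partial_deriv i \<phi> (x + t *\<^sub>R (- e)))"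
        using partial_deriv_translate[OF test_functionD(1)[OF \<phi>], of i "- t *\<^sub>R e"] by simp
      finally show ?thesis by (simp add: fun_eq_iff)
    qed
    have ftc: "(LINT t|lborel. indicator {0..h} t *\<^sub>R partial_deriv i \<phi> (x + t *\<^sub>R (- e))) = \<phi> x - \<phi> (x - h *\<^sub>R e)" for x
    proof -
      have "(LINT t|lborel. indicator {0..h} t *\<^sub>R partial_deriv i \<phi> (x + t *\<^sub>R (- e))) =
         - \<phi> (x + h *\<^sub>R (- e)) - - \<phi> (x + 0 *\<^sub>R (- e))"
      proof (rule integral_FTC_Icc[OF h])
        fix t
        have "((\<lambda>t. \<phi> (x + t *\<^sub>R (- e))) has_derivative (\<lambda>s. frechet_derivative \<phi> (at (x + t *\<^sub>R (- e))) (s *\<^sub>R (- e)))) (at t within {0..h})"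
          by (rule has_derivative_compose[OF _ test_functionD(7)[OF \<phi>]]) (auto intro!: derivative_eq_intros)
        moreover have "frechet_derivative \<phi> (at (x + t *\<^sub>R (- e))) (s *\<^sub>R (- e)) = - (s * partial_deriv i \<phi> (x + t *\<^sub>R (- e)))" for s
        proof -
          note l = has_derivative_linear[OF test_functionD(7)[OF \<phi>, of "x + t *\<^sub>R (- e)"]]
          show ?thesis
            by (simp only: partial_deriv_def e_def[symmetric] linear_cmul[OF l] linear_neg[OF l] real_scaleR_def mult_minus_right)
        qed
        ultimately have "((\<lambda>t. \<phi> (x + t *\<^sub>R (- e))) has_vector_derivative - partial_deriv i \<phi> (x + t *\<^sub>R (- e))) (at t within {0..h})"
          by (simp add: has_vector_derivative_def)
        then show "((\<lambda>t. - \<phi> (x + t *\<^sub>R (- e))) has_vector_derivative partial_deriv i \<phi> (x + t *\<^sub>R (- e))) (at t within {0..h})"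
          by (auto intro: derivative_eq_intros)
        show "continuous_on {0..h} (\<lambda>t. partial_deriv i \<phi> (x + t *\<^sub>R (- e)))"
          by (intro continuous_on_compose2[OF pc] continuous_intros) auto
      qed
      then show ?thesis by simp
    qed
    have "(LINT x|lborel. \<phi> x *\<^sub>R R x) = (LINT x|lborel. LINT t|lborel. indicator {0..h} t *\<^sub>R (\<phi> x *\<^sub>R g (x + t *\<^sub>R e)))"
      by (simp add: R_def mult.commute flip: integral_scaleR_right)
    also have "\<dots> = (LINT t|lborel. LINT x|lborel. indicator {0..h} t *\<^sub>R (\<phi> x *\<^sub>R g (x + t *\<^sub>R e)))"
      using lborel_pair.Fubini_integral[of "\<lambda>x t. indicator {0..h} t *\<^sub>R (\<phi> x *\<^sub>R g (x + t *\<^sub>R e))"]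
        integrable_strip[OF _ g \<phi>2 g2 h, of 0 e] by simp
    also have "\<dots> = (LINT t|lborel. LINT x|lborel. - (indicator {0..h} t *\<^sub>R (partial_deriv i \<phi> (x + t *\<^sub>R (- e)) *\<^sub>R \<psi> x)))"
    proof (rule Bochner_Integration.integral_cong[OF refl])
      show "(LINT x|lborel. indicator {0..h} t *\<^sub>R (\<phi> x *\<^sub>R g (x + t *\<^sub>R e)))
        = (LINT x|lborel. - (indicator {0..h} t *\<^sub>R (partial_deriv i \<phi> (x + t *\<^sub>R (- e)) *\<^sub>R \<psi> x)))" for t
        by (cases "t \<in> {0..h}") (simp_all add: inner)
    qed
    also have "\<dots> = - (LINT t|lborel. LINT x|lborel. indicator {0..h} t *\<^sub>R (partial_deriv i \<phi> (x + t *\<^sub>R (- e)) *\<^sub>R \<psi> x))"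
      by simp
    also have "(LINT t|lborel. LINT x|lborel. indicator {0..h} t *\<^sub>R (partial_deriv i \<phi> (x + t *\<^sub>R (- e)) *\<^sub>R \<psi> x))
      = (LINT x|lborel. LINT t|lborel. indicator {0..h} t *\<^sub>R (partial_deriv i \<phi> (x + t *\<^sub>R (- e)) *\<^sub>R \<psi> x))"
      using lborel_pair.Fubini_integral[of "\<lambda>x t. indicator {0..h} t *\<^sub>R (partial_deriv i \<phi> (x + t *\<^sub>R (- e)) *\<^sub>R \<psi> x)"]
        integrable_strip[OF _ _ p2 \<psi>2 h, of "- e" 0] by simp
    also have "\<dots> = (LINT x|lborel. (LINT t|lborel. indicator {0..h} t *\<^sub>R partial_deriv i \<phi> (x + t *\<^sub>R (- e))) *\<^sub>R \<psi> x)"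
    proof (intro Bochner_Integration.integral_cong refl)
      fix x
      have "continuous_on {0..h} (\<lambda>t. partial_deriv i \<phi> (x + t *\<^sub>R (- e)))"
        by (intro continuous_on_compose2[OF pc] continuous_intros) auto
      from borel_integrable_compact[OF _ this]
      have "integrable lborel (\<lambda>t. indicator {0..h} t *\<^sub>R partial_deriv i \<phi> (x + t *\<^sub>R (- e)))" by simp
      from integral_scaleR_left[OF this]
      show "(LINT t|lborel. indicator {0..h} t *\<^sub>R (partial_deriv i \<phi> (x + t *\<^sub>R (- e)) *\<^sub>R \<psi> x)) = (LINT t|lborel. indicator {0..h} t *\<^sub>R partial_deriv i \<phi> (x + t *\<^sub>R (- e))) *\<^sub>R \<psi> x"
        by simp
    qed
    also have "\<dots> = (LINT x|lborel. \<phi> x *\<^sub>R \<psi> x - \<phi> (x - h *\<^sub>R e) *\<^sub>R \<psi> x)"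
      by (simp only: ftc scaleR_diff_left)
    finally have R_eq: "(LINT x|lborel. \<phi> x *\<^sub>R R x) = - (LINT x|lborel. \<phi> x *\<^sub>R \<psi> x - \<phi> (x - h *\<^sub>R e) *\<^sub>R \<psi> x)" .
    have i1: "integrable lborel (\<lambda>x. \<phi> x *\<^sub>R \<psi> x)" by (rule integrable_compactly_supported[OF c s li\<psi>])
    have i2: "integrable lborel (\<lambda>x. \<phi> x *\<^sub>R \<psi> (x + h *\<^sub>R e))" by (rule integrable_compactly_supported[OF c s li\<psi>h])
    have i3: "integrable lborel (\<lambda>x. \<phi> x *\<^sub>R R x)" by (rule integrable_compactly_supported[OF c s liR])
    have i4: "integrable lborel (\<lambda>x. \<phi> (x - h *\<^sub>R e) *\<^sub>R \<psi> x)"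
      using integrable_translate_iff[of "\<lambda>x. \<phi> x *\<^sub>R \<psi> (x + h *\<^sub>R e)" "- h *\<^sub>R e"] i2 by simp
    have e4: "(LINT x|lborel. \<phi> (x - h *\<^sub>R e) *\<^sub>R \<psi> x) = (LINT x|lborel. \<phi> x *\<^sub>R \<psi> (x + h *\<^sub>R e))"
      using integral_translate[of "\<lambda>x. \<phi> x *\<^sub>R \<psi> (x + h *\<^sub>R e)" "- h *\<^sub>R e"] by simp
    show "(LINT x|lborel. \<phi> x *\<^sub>R (\<psi> (x + h *\<^sub>R e) - \<psi> x - R x)) = 0"
      using R_eq i1 i2 i3 i4 e4 by (simp add: scaleR_diff_right)
  qed
  then show ?thesis by eventually_elim (simp add: R_def g_def e_def)
qed

text \<open>Cauchy-Schwarz in \<open>t\<close> over the interval of length \<open>h\<close> costs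
  one factor \<open>h\<close>; translation invariance of the remaining integral in \<open>x\<close>
  gives the other.\<close>

lemma weak_gradient_difference_L2:
  fixes \<psi> :: "real^'n::finite \<Rightarrow> 'k::{real_normed_field,euclidean_space}"
  assumes G: "is_weak_gradient \<psi> G" and \<psi>2: "integrable lborel (\<lambda>x. (norm (\<psi> x))\<^sup>2)"
    and G2: "integrable lborel (\<lambda>x. (norm (G x $ i))\<^sup>2)" and h: "0 \<le> h"
  shows "integrable lborel (\<lambda>x. (norm (\<psi> (x + h *\<^sub>R axis i 1) - \<psi> x))\<^sup>2)" (is ?I)
    and "(LINT x|lborel. (norm (\<psi> (x + h *\<^sub>R axis i 1) - \<psi> x))\<^sup>2) \<le> h\<^sup>2 * (LINT x|lborel. (norm (G x $ i))\<^sup>2)" (is ?L)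
proof -
  define e where "e = (axis i 1 :: real^'n)"
  define g where "g = (\<lambda>x. G x $ i)"
  have [measurable]: "\<psi> \<in> borel_measurable borel"
    using G by (auto simp: is_weak_gradient_def intro: locally_integrable_borel_measurable)
  have "G \<in> borel_measurable borel"
    using G by (auto simp: is_weak_gradient_def intro: locally_integrable_borel_measurable)
  then have g[measurable]: "g \<in> borel_measurable borel"
    unfolding g_def by (rule measurable_compose) (auto intro!: borel_measurable_continuous_onI continuous_intros)
  have pw: "ennreal ((norm (LINT t|lborel. indicator {0..h} t *\<^sub>R g (x + t *\<^sub>R e)))\<^sup>2)
    \<le> ennreal h * (\<integral>\<^sup>+t. ennreal (indicator {0..h} t * (norm (g (x + t *\<^sub>R e)))\<^sup>2) \<partial>lborel)" for x
  proof (cases "integrable lborel (\<lambda>t. indicator {0..h} t *\<^sub>R g (x + t *\<^sub>R e))")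
    case True
    from integral_norm_bound_ennreal[OF this]
    have "ennreal (norm (LINT t|lborel. indicator {0..h} t *\<^sub>R g (x + t *\<^sub>R e)))
      \<le> (\<integral>\<^sup>+t. indicator {0..h} t * ennreal (indicator {0..h} t * norm (g (x + t *\<^sub>R e))) \<partial>lborel)"
      by (rule order_trans) (auto intro!: nn_integral_mono split: split_indicator)
    then have "(ennreal (norm (LINT t|lborel. indicator {0..h} t *\<^sub>R g (x + t *\<^sub>R e))))\<^sup>2 \<le> \<dots>\<^sup>2"
      by (intro power_mono) auto
    also have "\<dots> \<le> (\<integral>\<^sup>+t. (indicator {0..h} t)\<^sup>2 \<partial>lborel) * (\<integral>\<^sup>+t. (ennreal (indicator {0..h} t * norm (g (x + t *\<^sub>R e))))\<^sup>2 \<partial>lborel)"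
      by (rule Cauchy_Schwarz_nn_integral) auto
    also have "(\<integral>\<^sup>+t. (indicator {0..h} t)\<^sup>2 \<partial>lborel) = ennreal h"
      using h by (simp add: indicator_square)
    also have "(\<integral>\<^sup>+t. (ennreal (indicator {0..h} t * norm (g (x + t *\<^sub>R e))))\<^sup>2 \<partial>lborel) = (\<integral>\<^sup>+t. ennreal (indicator {0..h} t * (norm (g (x + t *\<^sub>R e)))\<^sup>2) \<partial>lborel)"
      by (intro nn_integral_cong) (auto split: split_indicator simp: ennreal_power)
    finally show ?thesis by (simp add: ennreal_power)
  \<comment> \<open>If the slice is not integrable, its Bochner integral is 0 by convention and the
    bound is trivial.\<close>
  qed (simp add: not_integrable_integral_eq)
  have "(\<integral>\<^sup>+x. ennreal ((norm (\<psi> (x + h *\<^sub>R e) - \<psi> x))\<^sup>2) \<partial>lborel) = (\<integral>\<^sup>+x. ennreal ((norm (LINT t|lborel. indicator {0..h} t *\<^sub>R g (x + t *\<^sub>R e)))\<^sup>2) \<partial>lborel)"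
    using weak_gradient_difference[OF G \<psi>2 G2 h] by (intro nn_integral_cong_AE) (auto simp: g_def e_def)
  also have "\<dots> \<le> (\<integral>\<^sup>+x. ennreal h * (\<integral>\<^sup>+t. ennreal (indicator {0..h} t * (norm (g (x + t *\<^sub>R e)))\<^sup>2) \<partial>lborel) \<partial>lborel)"
    by (intro nn_integral_mono pw)
  also have "\<dots> = ennreal h * (\<integral>\<^sup>+x. (\<integral>\<^sup>+t. ennreal (indicator {0..h} t * (norm (g (x + t *\<^sub>R e)))\<^sup>2) \<partial>lborel) \<partial>lborel)"
    by (rule nn_integral_cmult) simp
  also have "(\<integral>\<^sup>+x. (\<integral>\<^sup>+t. ennreal (indicator {0..h} t * (norm (g (x + t *\<^sub>R e)))\<^sup>2) \<partial>lborel) \<partial>lborel) = (\<integral>\<^sup>+t. (\<integral>\<^sup>+x. ennreal (indicator {0..h} t * (norm (g (x + t *\<^sub>R e)))\<^sup>2) \<partial>lborel) \<partial>lborel)"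
    by (rule lborel_pair.Fubini'[symmetric]) measurable
  also have "\<dots> = (\<integral>\<^sup>+t. (\<integral>\<^sup>+x. ennreal ((norm (g x))\<^sup>2) \<partial>lborel) * indicator {0..h} t \<partial>lborel)"
  proof (intro nn_integral_cong)
    fix t
    show "(\<integral>\<^sup>+x. ennreal (indicator {0..h} t * (norm (g (x + t *\<^sub>R e)))\<^sup>2) \<partial>lborel) = (\<integral>\<^sup>+x. ennreal ((norm (g x))\<^sup>2) \<partial>lborel) * indicator {0..h} t"
      using nn_integral_translate[of "\<lambda>x. ennreal ((norm (g x))\<^sup>2)" "t *\<^sub>R e"] by (auto split: split_indicator)
  qed
  also have "\<dots> = (\<integral>\<^sup>+x. ennreal ((norm (g x))\<^sup>2) \<partial>lborel) * ennreal h"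
    using h by (simp add: nn_integral_cmult_indicator)
  also have "(\<integral>\<^sup>+x. ennreal ((norm (g x))\<^sup>2) \<partial>lborel) = ennreal (LINT x|lborel. (norm (g x))\<^sup>2)"
    using G2 by (intro nn_integral_eq_integral) (auto simp: g_def)
  finally have le: "(\<integral>\<^sup>+x. ennreal ((norm (\<psi> (x + h *\<^sub>R e) - \<psi> x))\<^sup>2) \<partial>lborel) \<le> ennreal (h\<^sup>2 * (LINT x|lborel. (norm (g x))\<^sup>2))"
    using h by (simp add: ennreal_mult power2_eq_square mult_ac)
  show I: ?I
    unfolding e_def[symmetric]
    by (rule integrableI_nonneg) (use le_less_trans[OF le] in auto)
  show ?L
    using le I unfolding e_def[symmetric] g_def
    by (subst (asm) nn_integral_eq_integral) (auto simp: ennreal_le_iff)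
qed

section \<open>Integration by parts against |\<psi>|^2\<close>

text \<open>Factor |a|^2 - |b|^2 as (a - b) . (a + b), apply Young's inequality and bound |a + b|^2
  by the parallelogram law. The weight c / h is the one for which both terms are of order
  \<open>h\<close> after integration, as the integral of |a - b|^2 is of order h^2.\<close>

lemma product_difference_bound:
  fixes a b :: "'b::real_inner"
  assumes "c > (0::real)" "h > 0"
  shows "- (w * ((norm a)\<^sup>2 - (norm b)\<^sup>2)) \<le> c / h * (norm (a - b))\<^sup>2 + h / (2 * c) * (w\<^sup>2 * ((norm a)\<^sup>2 + (norm b)\<^sup>2))"
proof -
  define s where "s = c / h"
  have s: "s > 0" using assms by (simp add: s_def)
  have "(norm a)\<^sup>2 - (norm b)\<^sup>2 = (a - b) \<bullet> (a + b)"
    by (simp add: power2_norm_eq_inner inner_add_right inner_diff_left inner_commute[of b a])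
  then have "- (w * ((norm a)\<^sup>2 - (norm b)\<^sup>2)) \<le> \<bar>w\<bar> * \<bar>(a - b) \<bullet> (a + b)\<bar>"
    by (metis abs_ge_minus_self abs_mult)
  also have "\<dots> \<le> \<bar>w\<bar> * (norm (a - b) * norm (a + b))"
    by (intro mult_left_mono Cauchy_Schwarz_ineq2) auto
  also have "\<dots> \<le> s * (norm (a - b))\<^sup>2 + (1 / (4 * s)) * (w\<^sup>2 * (norm (a + b))\<^sup>2)"
  proof -
    have "0 \<le> s * (norm (a - b) - \<bar>w\<bar> * norm (a + b) / (2 * s))\<^sup>2" using s by simp
    also have "\<dots> = s * (norm (a - b))\<^sup>2 + (1 / (4 * s)) * (w\<^sup>2 * (norm (a + b))\<^sup>2) - \<bar>w\<bar> * (norm (a - b) * norm (a + b))"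
      using s by (simp add: power2_diff power_mult_distrib power_divide) (simp add: field_simps power2_eq_square)
    finally show ?thesis by simp
  qed
  also have "(1 / (4 * s)) * (w\<^sup>2 * (norm (a + b))\<^sup>2) \<le> (1 / (4 * s)) * (w\<^sup>2 * (2 * ((norm a)\<^sup>2 + (norm b)\<^sup>2)))"
  proof (intro mult_left_mono)
    have "(norm (a + b))\<^sup>2 + (norm (a - b))\<^sup>2 = 2 * ((norm a)\<^sup>2 + (norm b)\<^sup>2)"
      by (simp add: power2_norm_eq_inner inner_add_right inner_diff_left inner_add_left inner_diff_right)
    then show "(norm (a + b))\<^sup>2 \<le> 2 * ((norm a)\<^sup>2 + (norm b)\<^sup>2)" by (smt (verit) zero_le_power2)
  qed (use s in auto)
  finally have "- (w * ((norm a)\<^sup>2 - (norm b)\<^sup>2)) \<le> s * (norm (a - b))\<^sup>2 + (1 / (4 * s)) * (w\<^sup>2 * (2 * ((norm a)\<^sup>2 + (norm b)\<^sup>2)))"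
    by simp
  moreover have "(1 / (4 * s)) * (u * (2 * v)) = h / (2 * c) * (u * v)" for u v
    using assms by (simp add: s_def field_simps)
  ultimately show ?thesis by (simp only: s_def)
qed

lemma integrable_bounded_mult:
  fixes f :: "'a::euclidean_space \<Rightarrow> real"
  assumes f: "integrable lborel f" and [measurable]: "u \<in> borel_measurable borel" and B: "\<And>x. \<bar>u x\<bar> \<le> B"
  shows "integrable lborel (\<lambda>x. u x * f x)"
proof (rule Bochner_Integration.integrable_bound)
  show "integrable lborel (\<lambda>x. B * f x)" using f by simp
  show "AE x in lborel. norm (u x * f x) \<le> norm (B * f x)"
    using order_trans[OF B abs_ge_self] by (intro AE_I2) (auto simp: abs_mult intro!: mult_right_mono)
qed (use f in auto)

text \<open>Formally the left side is -2 times the integral of w \<psi> . \<partial>\<psi>, and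
  Young's inequality with weight \<open>c\<close> finishes. To avoid a product rule for |\<psi>|^2,
  the derivative of \<open>w\<close> is replaced by a difference quotient, which translation moves
  onto |\<psi>|^2; \<open>product_difference_bound\<close> and
  \<open>weak_gradient_difference_L2\<close> bound the result uniformly in \<open>h\<close>, and
  dominated convergence removes \<open>h\<close>.\<close>

lemma weak_gradient_scalar_inequality:
  fixes \<psi> :: "real^'n::finite \<Rightarrow> 'k::{real_normed_field,euclidean_space}"
  assumes G: "is_weak_gradient \<psi> G" and \<psi>2: "integrable lborel (\<lambda>x. (norm (\<psi> x))\<^sup>2)"
    and G2: "integrable lborel (\<lambda>x. (norm (G x $ i))\<^sup>2)" and c: "c > 0"
    and w: "\<And>x. (w has_derivative D x) (at x)" and D: "continuous_on UNIV (\<lambda>x. D x (axis i 1))"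
    and cs: "compactly_supported w"
  shows "(LINT x|lborel. D x (axis i 1) * (norm (\<psi> x))\<^sup>2)
     \<le> c * (LINT x|lborel. (norm (G x $ i))\<^sup>2) + 1 / c * (LINT x|lborel. (w x)\<^sup>2 * (norm (\<psi> x))\<^sup>2)"
proof -
  define e where "e = (axis i 1 :: real^'n)"
  define w' where "w' = (\<lambda>x. D x e)"
  define N where "N = (\<lambda>x. (norm (\<psi> x))\<^sup>2)"
  have wc: "continuous_on UNIV w"
    using w by (meson continuous_at_imp_continuous_on has_derivative_continuous)
  have w'c: "continuous_on UNIV w'" using D by (simp add: w'_def e_def)
  have cs': "compactly_supported w'"
    by (rule compactly_supported_mono[OF cs])
      (use has_derivative_zero_outside_support[OF w] in \<open>auto simp: w'_def\<close>)
  obtain B where B: "0 \<le> B" "\<And>x. \<bar>w x\<bar> \<le> B" using compactly_supported_bounded[OF wc cs] by blast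
  obtain B' where B': "0 \<le> B'" "\<And>x. \<bar>w' x\<bar> \<le> B'" using compactly_supported_bounded[OF w'c cs'] by blast
  have B2: "\<bar>(w x)\<^sup>2\<bar> \<le> B\<^sup>2" for x using power_mono[OF B(2)[of x], of 2] by simp
  note [measurable] = borel_measurable_continuous_onI[OF wc] borel_measurable_continuous_onI[OF w'c]
  have [measurable]: "\<psi> \<in> borel_measurable borel"
    using G by (auto simp: is_weak_gradient_def intro: locally_integrable_borel_measurable)
  have Nm[measurable]: "N \<in> borel_measurable borel" by (simp add: N_def)
  have N: "integrable lborel N" using \<psi>2 by (simp add: N_def)
  have Nh: "integrable lborel (\<lambda>x. N (x + h *\<^sub>R e))" for h using N by (subst integrable_translate_iff) auto
  have der: "((\<lambda>t. w (x + t *\<^sub>R e)) has_real_derivative w' (x + t *\<^sub>R e)) (at t)" for x t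
  proof -
    have "((\<lambda>t. w (x + t *\<^sub>R e)) has_derivative (\<lambda>s. D (x + t *\<^sub>R e) (s *\<^sub>R e))) (at t)"
      by (rule has_derivative_compose[OF _ w]) (auto intro!: derivative_eq_intros)
    moreover have "D y (s *\<^sub>R e) = w' y * s" for y s
      using linear_cmul[OF has_derivative_linear[OF w[of y]], of s e] by (simp add: w'_def)
    ultimately show ?thesis by (simp add: has_field_derivative_def)
  qed
  \<comment> \<open>A backward quotient of \<open>w\<close>, because translation turns it into a
    forward difference of \<open>N\<close>.\<close>
  define q where "q = (\<lambda>h x. (w x - w (x - h *\<^sub>R e)) / h)"
  have q_bound: "\<bar>q h x\<bar> \<le> B'" if h: "h > 0" for h x
  proof -
    obtain t where "w (x + 0 *\<^sub>R e) - w (x + (- h) *\<^sub>R e) = (0 - (- h)) * w' (x + t *\<^sub>R e)"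
      using MVT2[of "- h" 0 "\<lambda>t. w (x + t *\<^sub>R e)" "\<lambda>t. w' (x + t *\<^sub>R e)"] der h by auto
    then have "q h x = w' (x + t *\<^sub>R e)" using h by (simp add: q_def)
    then show ?thesis using B' by simp
  qed
  have main: "(LINT x|lborel. q h x * N x) \<le> c * (LINT x|lborel. (norm (G x $ i))\<^sup>2)
      + 1 / (2 * c) * (LINT x|lborel. ((w x)\<^sup>2 + (w (x - h *\<^sub>R e))\<^sup>2) * N x)" if h: "h > 0" for h
  proof -
    let ?d = "\<lambda>x. (norm (\<psi> (x + h *\<^sub>R e) - \<psi> x))\<^sup>2"
    note dL2 = weak_gradient_difference_L2[OF G \<psi>2 G2 order_less_imp_le[OF h], folded e_def]
    have i1: "integrable lborel (\<lambda>x. w x * N x)" "integrable lborel (\<lambda>x. w x * N (x + h *\<^sub>R e))"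
      "integrable lborel (\<lambda>x. w (x - h *\<^sub>R e) * N x)"
      by (rule integrable_bounded_mult[OF _ _ B(2)] integrable_bounded_mult[OF N, where B = B]; use N Nh B in simp)+
    have i2: "integrable lborel (\<lambda>x. (w x)\<^sup>2 * N x)" "integrable lborel (\<lambda>x. (w x)\<^sup>2 * N (x + h *\<^sub>R e))"
      "integrable lborel (\<lambda>x. (w (x - h *\<^sub>R e))\<^sup>2 * N x)"
      by (rule integrable_bounded_mult[OF _ _ B2] integrable_bounded_mult[OF N, where B = "B\<^sup>2"]; use N Nh B2 in simp)+
    have t1: "(LINT x|lborel. w x * N (x + h *\<^sub>R e)) = (LINT x|lborel. w (x - h *\<^sub>R e) * N x)"
      using integral_translate[of "\<lambda>x. w x * N (x + h *\<^sub>R e)" "- h *\<^sub>R e"] by simp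
    have t2: "(LINT x|lborel. (w x)\<^sup>2 * N (x + h *\<^sub>R e)) = (LINT x|lborel. (w (x - h *\<^sub>R e))\<^sup>2 * N x)"
      using integral_translate[of "\<lambda>x. (w x)\<^sup>2 * N (x + h *\<^sub>R e)" "- h *\<^sub>R e"] by simp
    have "h * (LINT x|lborel. q h x * N x) = (LINT x|lborel. w x * N x - w (x - h *\<^sub>R e) * N x)"
    proof -
      have "w x * N x - w (x - h *\<^sub>R e) * N x = h * (q h x * N x)" for x
        using h by (simp add: q_def left_diff_distrib)
      then show ?thesis by simp
    qed
    also have "\<dots> = (LINT x|lborel. w x * N x) - (LINT x|lborel. w x * N (x + h *\<^sub>R e))"
      using i1 by (simp add: t1)
    also have "\<dots> = (LINT x|lborel. - (w x * (N (x + h *\<^sub>R e) - N x)))"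
      using i1 by (simp add: algebra_simps)
    also have "\<dots> \<le> (LINT x|lborel. c / h * ?d x + h / (2 * c) * ((w x)\<^sup>2 * (N (x + h *\<^sub>R e) + N x)))"
    proof (rule integral_mono)
      show "integrable lborel (\<lambda>x. - (w x * (N (x + h *\<^sub>R e) - N x)))" using i1 by (simp add: algebra_simps)
      show "integrable lborel (\<lambda>x. c / h * ?d x + h / (2 * c) * ((w x)\<^sup>2 * (N (x + h *\<^sub>R e) + N x)))"
        using i2 dL2(1) by (simp add: distrib_left)
    qed (use product_difference_bound[OF c h] in \<open>simp add: N_def\<close>)
    also have "\<dots> = c / h * (LINT x|lborel. ?d x) + h / (2 * c) * (LINT x|lborel. ((w x)\<^sup>2 + (w (x - h *\<^sub>R e))\<^sup>2) * N x)"
      using i2 dL2(1) by (simp add: distrib_left distrib_right t2 add.commute)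
    also have "c / h * (LINT x|lborel. ?d x) \<le> c / h * (h\<^sup>2 * (LINT x|lborel. (norm (G x $ i))\<^sup>2))"
      using dL2(2) c h by (intro mult_left_mono) auto
    finally have "h * (LINT x|lborel. q h x * N x) \<le> h * (c * (LINT x|lborel. (norm (G x $ i))\<^sup>2)
      + 1 / (2 * c) * (LINT x|lborel. ((w x)\<^sup>2 + (w (x - h *\<^sub>R e))\<^sup>2) * N x))"
      using h by (simp add: power2_eq_square algebra_simps)
    then show ?thesis using h by simp
  qed
  define hn where "hn = (\<lambda>n. inverse (real (Suc n)))"
  have hn: "hn n > 0" for n by (simp add: hn_def)
  have hn0: "hn \<longlonglongrightarrow> 0" unfolding hn_def by (rule LIMSEQ_inverse_real_of_nat)
  have lim1: "(\<lambda>n. LINT x|lborel. q (hn n) x * N x) \<longlonglongrightarrow> (LINT x|lborel. w' x * N x)"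
  proof (rule integral_dominated_convergence[where w = "\<lambda>x. B' * N x"])
    show "AE x in lborel. (\<lambda>n. q (hn n) x * N x) \<longlonglongrightarrow> w' x * N x"
    proof (intro AE_I2 tendsto_intros)
      fix x
      have "((\<lambda>h. (w (x + (0 + h) *\<^sub>R e) - w (x + 0 *\<^sub>R e)) / h) \<longlongrightarrow> w' (x + 0 *\<^sub>R e)) (at 0)"
        using der[of x 0] unfolding DERIV_def .
      moreover have "filterlim (\<lambda>n. - hn n) (at 0) sequentially"
        using hn tendsto_minus[OF hn0] by (intro filterlim_atI) (auto simp: less_imp_neq[symmetric])
      ultimately have "(\<lambda>n. (w (x + (0 + - hn n) *\<^sub>R e) - w (x + 0 *\<^sub>R e)) / (- hn n)) \<longlonglongrightarrow> w' (x + 0 *\<^sub>R e)"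
        by (rule filterlim_compose)
      then show "(\<lambda>n. q (hn n) x) \<longlonglongrightarrow> w' x"
        by (simp add: q_def minus_divide_right[symmetric] minus_divide_left)
    qed
    show "AE x in lborel. norm (q (hn n) x * N x) \<le> B' * N x" for n
      using q_bound[OF hn] by (intro AE_I2) (auto simp: abs_mult N_def intro!: mult_right_mono)
  qed (use N in \<open>auto simp: q_def\<close>)
  have lim2: "(\<lambda>n. LINT x|lborel. ((w x)\<^sup>2 + (w (x - hn n *\<^sub>R e))\<^sup>2) * N x) \<longlonglongrightarrow> (LINT x|lborel. ((w x)\<^sup>2 + (w (x - 0 *\<^sub>R e))\<^sup>2) * N x)"
  proof (rule integral_dominated_convergence[where w = "\<lambda>x. (B\<^sup>2 + B\<^sup>2) * N x"])
    show "AE x in lborel. (\<lambda>n. ((w x)\<^sup>2 + (w (x - hn n *\<^sub>R e))\<^sup>2) * N x) \<longlonglongrightarrow> ((w x)\<^sup>2 + (w (x - 0 *\<^sub>R e))\<^sup>2) * N x"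
      by (intro AE_I2 tendsto_intros continuous_on_tendsto_compose[OF wc] hn0) auto
    show "AE x in lborel. norm (((w x)\<^sup>2 + (w (x - hn n *\<^sub>R e))\<^sup>2) * N x) \<le> (B\<^sup>2 + B\<^sup>2) * N x" for n
      using B2 by (intro AE_I2) (auto simp: abs_mult N_def intro!: mult_right_mono add_mono[of _ "B\<^sup>2" _ "B\<^sup>2", simplified])
  qed (use N in auto)
  have "(LINT x|lborel. w' x * N x) \<le> c * (LINT x|lborel. (norm (G x $ i))\<^sup>2)
      + 1 / (2 * c) * (LINT x|lborel. ((w x)\<^sup>2 + (w (x - 0 *\<^sub>R e))\<^sup>2) * N x)"
    by (rule LIMSEQ_le[OF lim1 tendsto_add[OF tendsto_const tendsto_mult[OF tendsto_const lim2]]]) (use main[OF hn] in blast)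
  also have "(LINT x|lborel. ((w x)\<^sup>2 + (w (x - 0 *\<^sub>R e))\<^sup>2) * N x) = 2 * (LINT x|lborel. (w x)\<^sup>2 * N x)"
    by (simp add: mult.assoc)
  finally show ?thesis by (simp add: w'_def e_def N_def)
qed

text \<open>Completing the square with a vector field below \<open>sqrt (2 * V)\<close>.\<close>

lemma energy_lower_bound:
  fixes \<psi> :: "real^'n::finite \<Rightarrow> 'k::{real_normed_field,euclidean_space}" and w :: "real^'n \<Rightarrow> real^'n"
  assumes \<psi>: "\<psi> \<in> H1" and \<epsilon>: "\<epsilon> > 0"
    and w: "\<And>x. (w has_derivative (\<lambda>h. J x *v h)) (at x)" and J: "continuous_on UNIV J"
    and cs: "compact (closure {x. w x \<noteq> 0})" and V: "\<And>x. (norm (w x))\<^sup>2 \<le> 2 * V x"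
  shows "ennreal ((LINT x|lborel. trace (J x) * (norm (\<psi> x))\<^sup>2) / 2) \<le> energy V \<epsilon> \<psi>"
proof -
  define c where "c = \<epsilon> powr (1/2)"
  have c: "c > 0" "\<epsilon> powr (-1/2) = 1 / c" using \<epsilon> by (auto simp: c_def powr_minus_divide)
  define G where "G = weak_gradient \<psi>"
  define N where "N = (\<lambda>x. (norm (\<psi> x))\<^sup>2)"
  obtain G' where G': "is_weak_gradient \<psi> G'" "integrable lborel (\<lambda>x. (norm (G' x))\<^sup>2)"
    and \<psi>2: "integrable lborel (\<lambda>x. (norm (\<psi> x))\<^sup>2)"
    using \<psi> by (auto simp: H1_def)
  have [measurable]: "\<psi> \<in> borel_measurable borel"
    using G' by (auto simp: is_weak_gradient_def intro: locally_integrable_borel_measurable)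
  have G: "is_weak_gradient \<psi> G"
    unfolding G_def weak_gradient_def using someI[of "is_weak_gradient \<psi>", OF G'(1)] .
  have Gm[measurable]: "G \<in> borel_measurable borel"
    using G by (auto simp: is_weak_gradient_def intro: locally_integrable_borel_measurable)
  have Gim[measurable]: "(\<lambda>x. G x $ i) \<in> borel_measurable borel" for i
    by (rule measurable_compose[OF Gm]) (auto intro!: borel_measurable_continuous_onI continuous_intros)
  have "G' \<in> borel_measurable borel"
    using G' by (auto simp: is_weak_gradient_def intro: locally_integrable_borel_measurable)
  \<comment> \<open>\<open>weak_gradient\<close> only guarantees some weak gradient; its square
    integrability is inherited from the witness in \<open>H1\<close> by uniqueness.\<close>
  then have G2: "integrable lborel (\<lambda>x. (norm (G x))\<^sup>2)"
    using G'(2) weak_gradient_unique[OF G G'(1)] by (subst integrable_cong_AE[where g = "\<lambda>x. (norm (G' x))\<^sup>2"]) auto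
  have Gi2: "integrable lborel (\<lambda>x. (norm (G x $ i))\<^sup>2)" for i
    by (rule Bochner_Integration.integrable_bound[OF G2])
      (auto intro!: AE_I2 power_mono Finite_Cartesian_Product.norm_nth_le)
  have normG: "(norm (G x))\<^sup>2 = (\<Sum>i\<in>UNIV. (norm (G x $ i))\<^sup>2)" for x
    by (simp add: norm_vec_def L2_set_def sum_nonneg)
  have normw: "(norm (w x))\<^sup>2 = (\<Sum>i\<in>UNIV. (w x $ i)\<^sup>2)" for x
    by (simp add: norm_vec_def L2_set_def sum_nonneg)
  have wi: "((\<lambda>x. w x $ i) has_derivative (\<lambda>h. (J x *v h) $ i)) (at x)" for x i
    by (rule bounded_linear.has_derivative[OF bounded_linear_vec_nth w])
  have Jii: "(J x *v axis i 1) $ i = J x $ i $ i" for x i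
    by (simp add: matrix_vector_mult_basis column_def)
  have Jc: "continuous_on UNIV (\<lambda>x. (J x *v axis i 1) $ i)" for i
    unfolding Jii using J by (intro continuous_intros)
  have csi: "compactly_supported (\<lambda>x. w x $ i)" for i
  proof -
    have "closure {x. w x $ i \<noteq> 0} \<subseteq> closure {x. w x \<noteq> 0}" by (intro closure_mono) auto
    then show ?thesis unfolding compactly_supported_def using cs
      by (meson bounded_subset closed_closure compact_eq_bounded_closed)
  qed
  have wic: "continuous_on UNIV (\<lambda>x. w x $ i)" for i
    using wi by (meson continuous_at_imp_continuous_on has_derivative_continuous)
  have csJ: "compactly_supported (\<lambda>x. J x $ i $ i)" for i
    by (rule compactly_supported_mono[OF csi[of i]])
      (use has_derivative_zero_outside_support[OF wi] in \<open>auto simp flip: Jii simp: fun_eq_iff\<close>)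
  have li: "locally_integrable N"
  proof -
    have "set_integrable lborel K N" if "compact K" for K
      unfolding set_integrable_def real_scaleR_def
      by (rule integrable_bounded_mult[where B = 1]) (use \<psi>2 that in \<open>auto simp: N_def compact_imp_closed split: split_indicator\<close>)
    then show ?thesis by (simp add: locally_integrable_def)
  qed
  have Ji: "integrable lborel (\<lambda>x. J x $ i $ i * N x)" for i
    using integrable_compactly_supported[OF _ csJ li, of i] Jc[of i] by (simp add: Jii)
  obtain B where B: "\<And>i. 0 \<le> B i" "\<And>i x. \<bar>w x $ i\<bar> \<le> B i"
  proof -
    have "\<exists>B. 0 \<le> B \<and> (\<forall>x. \<bar>w x $ i\<bar> \<le> B)" for i
      using compactly_supported_bounded[OF wic[of i] csi[of i]] by metis
    then show thesis using that by metis
  qed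
  have wm: "(\<lambda>x. w x $ i) \<in> borel_measurable borel" for i using wic by (rule borel_measurable_continuous_onI)
  have wN: "integrable lborel (\<lambda>x. (w x $ i)\<^sup>2 * N x)" for i
    by (rule integrable_bounded_mult[where B = "(B i)\<^sup>2"])
      (use \<psi>2 B wm power_mono[OF B(2)[of _ i] abs_ge_zero, where n = 2] in \<open>auto simp: N_def\<close>)
  have wN': "integrable lborel (\<lambda>x. (norm (w x))\<^sup>2 * N x)" using wN by (simp add: normw sum_distrib_right)
  have "(LINT x|lborel. trace (J x) * N x) = (\<Sum>i\<in>UNIV. LINT x|lborel. J x $ i $ i * N x)"
    using Ji by (simp add: trace_def sum_distrib_right)
  \<comment> \<open>The parameter of the scalar inequality is \<epsilon>^(1/2), for which the two
    sides carry exactly the weights of \<open>energy\<close>.\<close>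
  also have "\<dots> \<le> (\<Sum>i\<in>UNIV. c * (LINT x|lborel. (norm (G x $ i))\<^sup>2) + 1 / c * (LINT x|lborel. (w x $ i)\<^sup>2 * N x))"
    using weak_gradient_scalar_inequality[OF G \<psi>2 Gi2 c(1) wi Jc csi]
    by (intro sum_mono) (simp add: Jii N_def)
  also have "\<dots> = c * (LINT x|lborel. (norm (G x))\<^sup>2) + 1 / c * (LINT x|lborel. (norm (w x))\<^sup>2 * N x)"
    using Gi2 wN by (simp add: normG normw sum.distrib sum_distrib_right flip: sum_distrib_left sum_divide_distrib)
  also have "\<dots> = 2 * (LINT x|lborel. c * ((norm (G x))\<^sup>2 / 2) + 1 / c * ((norm (w x))\<^sup>2 / 2) * N x)"
    using G2 wN' by simp
  finally have le: "(LINT x|lborel. trace (J x) * N x) / 2 \<le> (LINT x|lborel. c * ((norm (G x))\<^sup>2 / 2) + 1 / c * ((norm (w x))\<^sup>2 / 2) * N x)"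
    by simp
  have "ennreal ((LINT x|lborel. trace (J x) * N x) / 2) \<le> ennreal (LINT x|lborel. c * ((norm (G x))\<^sup>2 / 2) + 1 / c * ((norm (w x))\<^sup>2 / 2) * N x)"
    using le by (rule ennreal_leI)
  also have "\<dots> = (\<integral>\<^sup>+x. ennreal (c * ((norm (G x))\<^sup>2 / 2) + 1 / c * ((norm (w x))\<^sup>2 / 2) * N x) \<partial>lborel)"
    using G2 wN' c(1) by (intro nn_integral_eq_integral[symmetric]) (auto intro!: AE_I2 add_nonneg_nonneg mult_nonneg_nonneg simp: N_def)
  also have "\<dots> \<le> energy V \<epsilon> \<psi>"
    unfolding energy_def c(2) c_def[symmetric] G_def[symmetric] N_def
  proof (intro nn_integral_mono ennreal_leI add_left_mono mult_right_mono mult_left_mono)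
    show "(norm (w x))\<^sup>2 / 2 \<le> V x" for x using V[of x] by simp
  qed (use c(1) in auto)
  finally show ?thesis by (simp add: N_def)
qed

subsection \<open>Vague compactness\<close>

text \<open>Schoenberg's space-filling curve: \<open>schoenberg_wave\<close> has period 2, vanishes on \<open>[0, 1/3]\<close>
  and equals 1 on \<open>[2/3, 1]\<close>, so evaluated at \<open>3 ^ j * t\<close> it reads off ternary digits 0 and 2.\<close>

definition schoenberg_wave :: "real \<Rightarrow> real" where
  "schoenberg_wave t = max 0 (min 1 ((1 - 2 * cos (pi * t)) / 2))"

lemma schoenberg_wave_bounds: "0 \<le> schoenberg_wave t" "schoenberg_wave t \<le> 1"
  by (auto simp: schoenberg_wave_def)

lemma continuous_schoenberg_wave: "continuous_on UNIV schoenberg_wave"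
  unfolding schoenberg_wave_def by (intro continuous_intros) auto

lemma schoenberg_wave_periodic: "schoenberg_wave (2 * real_of_int m + r) = schoenberg_wave r"
proof -
  have "cos (pi * (2 * real_of_int m + r)) = cos (pi * r)"
    using cos_int_2pin[of m] sin_int_2pin[of m]
    by (simp add: distrib_left cos_add mult_ac)
  then show ?thesis by (simp add: schoenberg_wave_def)
qed

lemma schoenberg_wave_low: "0 \<le> r \<Longrightarrow> r \<le> 1/3 \<Longrightarrow> schoenberg_wave r = 0"
proof -
  assume r: "0 \<le> r" "r \<le> 1/3"
  have "cos (pi / 3) \<le> cos (pi * r)" using r by (intro cos_monotone_0_pi_le) auto
  then show ?thesis by (simp add: schoenberg_wave_def cos_60)
qed

lemma schoenberg_wave_high: "2/3 \<le> r \<Longrightarrow> r \<le> 1 \<Longrightarrow> schoenberg_wave r = 1"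
proof -
  assume r: "2/3 \<le> r" "r \<le> 1"
  have "cos (pi * r) \<le> cos (pi * (2/3))" using r by (intro cos_monotone_0_pi_le) auto
  also have "cos (pi * (2/3)) = cos (pi - pi / 3)" by (simp add: field_simps)
  also have "\<dots> = - (1/2)" unfolding cos_diff by (simp add: cos_60)
  finally show ?thesis by (simp add: schoenberg_wave_def)
qed

text \<open>Multiplying by 3^j shifts the ternary expansion. As its digits are 0 and 2, the integer
  part dropped is even and invisible to a function of period 2; the remaining tail lies in [0, 1/3]
  or [2/3, 1] according to the digit at position \<open>j\<close>.\<close>

lemma schoenberg_wave_digit:
  fixes c :: "nat \<Rightarrow> real"
  assumes c: "\<And>j. c j = 0 \<or> c j = 1"
  shows "0 \<le> (\<Sum>i. 2 * c i / 3 ^ Suc i)" "(\<Sum>i. 2 * c i / 3 ^ Suc i) \<le> 1"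
    and "schoenberg_wave (3 ^ j * (\<Sum>i. 2 * c i / 3 ^ Suc i)) = c j"
proof -
  define S where "S = (\<lambda>j. \<Sum>i. 2 * c (j + i) / 3 ^ Suc i)"
  have geo: "(\<lambda>i. 2 / 3 ^ Suc i :: real) sums 1"
    using sums_mult[OF geometric_sums[of "1/3::real"], of "2/3"] by (simp add: power_one_over field_simps)
  have sm: "summable (\<lambda>i. 2 * c (j + i) / 3 ^ Suc i)" for j
  proof (rule summable_comparison_test'[OF sums_summable[OF geo], of 0])
    show "norm (2 * c (j + i) / 3 ^ Suc i) \<le> 2 / 3 ^ Suc i" for i using c[of "j + i"] by auto
  qed
  have S0: "0 \<le> S j" for j
    unfolding S_def using c by (intro suminf_nonneg sm divide_nonneg_nonneg) (metis mult_eq_0_iff order_refl mult_1_right zero_le_numeral, simp)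
  have S1: "S j \<le> 1" for j
  proof -
    have "S j \<le> (\<Sum>i. 2 / 3 ^ Suc i :: real)"
      unfolding S_def
    proof (rule suminf_le[OF _ sm sums_summable[OF geo]])
      show "2 * c (j + i) / 3 ^ Suc i \<le> 2 / 3 ^ Suc i" for i using c[of "j + i"] by auto
    qed
    then show ?thesis using sums_unique[OF geo] by simp
  qed
  have Srec: "S j = 2 * c j / 3 + S (Suc j) / 3" for j
  proof -
    have "S j = 2 * c (j + 0) / 3 ^ Suc 0 + (\<Sum>i. 2 * c (j + Suc i) / 3 ^ Suc (Suc i))"
      unfolding S_def using suminf_split_head[OF sm[of j]] by simp
    also have "(\<Sum>i. 2 * c (j + Suc i) / 3 ^ Suc (Suc i)) = (\<Sum>i. (2 * c (Suc j + i) / 3 ^ Suc i) / 3)"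
      by simp
    also have "\<dots> = S (Suc j) / 3"
      unfolding S_def by (rule suminf_divide[OF sm])
    finally show ?thesis by simp
  qed
  have ev: "\<exists>m::int. 3 ^ j * S 0 = 2 * real_of_int m + S j" for j
  proof (induction j)
    case 0
    show ?case by (intro exI[of _ 0]) simp
  next
    case (Suc j)
    then obtain m :: int where m: "3 ^ j * S 0 = 2 * real_of_int m + S j" by blast
    have "3 ^ Suc j * S 0 = 3 * (2 * real_of_int m + S j)" using m by simp
    also have "\<dots> = 2 * (3 * real_of_int m + c j) + S (Suc j)" using Srec[of j] by simp
    also have "c j = real_of_int (if c j = 0 then 0 else 1)" using c[of j] by auto
    finally show ?case by (intro exI[of _ "3 * m + (if c j = 0 then 0 else 1)"]) simp
  qed
  show "schoenberg_wave (3 ^ j * (\<Sum>i. 2 * c i / 3 ^ Suc i)) = c j"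
  proof -
    obtain m :: int where m: "3 ^ j * S 0 = 2 * real_of_int m + S j" using ev by blast
    have "schoenberg_wave (3 ^ j * S 0) = schoenberg_wave (S j)" unfolding m by (rule schoenberg_wave_periodic)
    also have "\<dots> = c j"
    proof (cases "c j = 0")
      case True
      then show ?thesis using Srec[of j] S0[of "Suc j"] S1[of "Suc j"] by (simp add: schoenberg_wave_low)
    next
      case False
      then have "c j = 1" using c by blast
      then show ?thesis using Srec[of j] S0[of "Suc j"] S1[of "Suc j"] by (simp add: schoenberg_wave_high)
    qed
    finally show ?thesis by (simp add: S_def)
  qed
  show "0 \<le> (\<Sum>i. 2 * c i / 3 ^ Suc i)" "(\<Sum>i. 2 * c i / 3 ^ Suc i) \<le> 1"
    using S0[of 0] S1[of 0] by (simp_all add: S_def)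
qed

definition binary_digit :: "real \<Rightarrow> nat \<Rightarrow> real" where
  "binary_digit y k = real_of_int \<lfloor>2 ^ Suc k * y\<rfloor> - 2 * real_of_int \<lfloor>2 ^ k * y\<rfloor>"

lemma binary_digit_cases: "binary_digit y k = 0 \<or> binary_digit y k = 1"
proof -
  define z where "z = 2 ^ k * y"
  have "\<lfloor>2 * z\<rfloor> = 2 * \<lfloor>z\<rfloor> \<or> \<lfloor>2 * z\<rfloor> = 2 * \<lfloor>z\<rfloor> + 1" by linarith
  moreover have "binary_digit y k = real_of_int \<lfloor>2 * z\<rfloor> - 2 * real_of_int \<lfloor>z\<rfloor>"
    by (simp add: binary_digit_def z_def mult.assoc)
  ultimately show ?thesis by auto
qed

lemma binary_digit_sums:
  assumes "0 \<le> y" "y < 1"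
  shows "(\<lambda>k. binary_digit y k / 2 ^ Suc k) sums y"
proof -
  define a where "a = (\<lambda>k. real_of_int \<lfloor>2 ^ k * y\<rfloor> / 2 ^ k)"
  have "(\<lambda>k. y - inverse (2 ^ k)) \<longlonglongrightarrow> y - 0"
    by (intro tendsto_intros LIMSEQ_inverse_realpow_zero) auto
  then have lower: "(\<lambda>k. y - inverse (2 ^ k)) \<longlonglongrightarrow> y" by simp
  have "a \<longlonglongrightarrow> y"
  proof (rule tendsto_sandwich[OF _ _ lower tendsto_const])
    show "\<forall>\<^sub>F k in sequentially. y - inverse (2 ^ k) \<le> a k"
    proof (intro always_eventually allI)
      fix k :: nat
      have "2 ^ k * y - 1 \<le> real_of_int \<lfloor>2 ^ k * y\<rfloor>" by linarith
      then have "(2 ^ k * y - 1) / 2 ^ k \<le> a k" unfolding a_def by (intro divide_right_mono) auto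
      then show "y - inverse (2 ^ k) \<le> a k" by (simp add: diff_divide_distrib inverse_eq_divide)
    qed
    show "\<forall>\<^sub>F k in sequentially. a k \<le> y"
      by (intro always_eventually allI) (simp add: a_def field_simps)
  qed
  then have "(\<lambda>k. a (Suc k) - a k) sums (y - a 0)" by (rule telescope_sums)
  moreover have "a (Suc k) - a k = binary_digit y k / 2 ^ Suc k" for k
    by (simp add: a_def binary_digit_def field_simps)
  moreover have "a 0 = 0" using assms by (simp add: a_def floor_eq_iff)
  ultimately show ?thesis by simp
qed

text \<open>Only a continuous \<open>f\<close> with a Borel right inverse \<open>s\<close> on the
  cube is needed to move measures from the cube to the line and back. The map \<open>s\<close>
  interleaves the binary digits of the coordinates into one ternary expansion, and \<open>f\<close>
  reads them off again with \<open>schoenberg_wave\<close>.\<close>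

lemma space_filling_curve:
  obtains f :: "real \<Rightarrow> real^'n::finite" and s :: "real^'n \<Rightarrow> real"
  where "continuous_on UNIV f" "s \<in> borel_measurable borel" "\<And>x. 0 \<le> s x" "\<And>x. s x \<le> 1"
    "\<And>x. (\<And>i. 0 \<le> x $ i \<and> x $ i < 1) \<Longrightarrow> f (s x) = x"
proof -
  let ?d = "CARD('n)"
  obtain e :: "'n \<Rightarrow> nat" where e: "bij_betw e UNIV {0..<?d}"
    using ex_bij_betw_finite_nat[of "UNIV :: 'n set"] by auto
  then have e_lt: "e i < ?d" and e_inv: "inv_into UNIV e (e i) = i" for i
    by (auto dest: bij_betwE simp: bij_betw_def)
  \<comment> \<open>Position \<open>j\<close> stores digit \<open>j div d\<close> of the coordinate
    numbered \<open>j mod d\<close>, where d is the dimension.\<close>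
  define c where "c = (\<lambda>(x::real^'n) j. binary_digit (x $ inv_into UNIV e (j mod ?d)) (j div ?d))"
  define s where "s = (\<lambda>x. \<Sum>j. 2 * c x j / 3 ^ Suc j)"
  define g where "g = (\<lambda>i t. \<Sum>k. schoenberg_wave (3 ^ (?d * k + e i) * t) / 2 ^ Suc k)"
  have half: "(\<lambda>k. 1 / 2 ^ Suc k :: real) sums 1"
    using power_half_series by (simp add: power_one_over)
  have g_cont: "continuous_on UNIV (g i)" for i
  proof (rule uniform_limit_theorem)
    show "uniform_limit UNIV (\<lambda>n t. \<Sum>k<n. schoenberg_wave (3 ^ (?d * k + e i) * t) / 2 ^ Suc k) (g i) sequentially"
      unfolding g_def
    proof (rule Weierstrass_m_test)
      show "norm (schoenberg_wave (3 ^ (?d * k + e i) * t) / 2 ^ Suc k) \<le> 1 / 2 ^ Suc k" for k t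
        using schoenberg_wave_bounds[of "3 ^ (?d * k + e i) * t"] by (simp add: divide_right_mono)
    qed (rule sums_summable[OF half])
    show "\<forall>\<^sub>F n in sequentially. continuous_on UNIV (\<lambda>t. \<Sum>k<n. schoenberg_wave (3 ^ (?d * k + e i) * t) / 2 ^ Suc k)"
      by (intro always_eventually allI continuous_intros continuous_on_compose2[OF continuous_schoenberg_wave]) auto
  qed auto
  show thesis
  proof (rule that[of "\<lambda>t. \<chi> i. g i t" s])
    show "continuous_on UNIV (\<lambda>t. \<chi> i. g i t)" using g_cont by (rule continuous_on_vec_lambda)
    have [measurable]: "(\<lambda>x::real^'n. x $ i) \<in> borel_measurable borel" for i
      by (intro borel_measurable_continuous_onI continuous_intros)
    show "s \<in> borel_measurable borel"
      unfolding s_def c_def binary_digit_def by measurable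
    have c01: "c x j = 0 \<or> c x j = 1" for x j
      unfolding c_def by (rule binary_digit_cases)
    show "0 \<le> s x" "s x \<le> 1" for x
      unfolding s_def by (rule schoenberg_wave_digit[of "c x", OF c01])+
    show "(\<chi> i. g i (s x)) = x" if x: "\<And>i. 0 \<le> x $ i \<and> x $ i < 1" for x
    proof -
      have "g i (s x) = x $ i" for i
      proof -
        have "schoenberg_wave (3 ^ (?d * k + e i) * s x) = binary_digit (x $ i) k" for k
          unfolding s_def schoenberg_wave_digit(3)[of "c x", OF c01]
          using e_lt[of i] e_inv[of i] by (simp add: c_def)
        then show ?thesis using sums_unique[OF binary_digit_sums, of "x $ i"] x[of i] by (simp add: g_def)
      qed
      then show ?thesis by (simp add: vec_eq_iff)
    qed
  qed
qed

section \<open>Transfer between the whole space, the open cube and the line\<close>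

definition squash :: "real^'n::finite \<Rightarrow> real^'n" where
  "squash x = (\<chi> i. (1 + x $ i / (1 + \<bar>x $ i\<bar>)) / 2)"

definition unsquash :: "real^'n::finite \<Rightarrow> real^'n" where
  "unsquash y = (\<chi> i. (2 * y $ i - 1) / (1 - \<bar>2 * y $ i - 1\<bar>))"

abbreviation open_cube :: "(real^'n::finite) set" where
  "open_cube \<equiv> box 0 1"

lemma squash_in_cube: "0 < squash x $ i" "squash x $ i < 1"
proof -
  have "\<bar>x $ i / (1 + \<bar>x $ i\<bar>)\<bar> < 1" by (simp add: abs_divide)
  then have "-1 < x $ i / (1 + \<bar>x $ i\<bar>)" "x $ i / (1 + \<bar>x $ i\<bar>) < 1" by linarith+
  then show "0 < squash x $ i" "squash x $ i < 1" unfolding squash_def by simp_all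
qed

lemma unsquash_squash: "unsquash (squash x) = x"
proof -
  have "unsquash (squash x) $ i = x $ i" for i
  proof -
    define t where "t = x $ i"
    have "1 - \<bar>t / (1 + \<bar>t\<bar>)\<bar> = 1 / (1 + \<bar>t\<bar>)" by (simp add: abs_divide field_simps)
    moreover have "2 * squash x $ i - 1 = t / (1 + \<bar>t\<bar>)"
    proof -
      have "2 * ((1 + u) / 2) - 1 = u" for u :: real by (simp add: field_simps)
      then show ?thesis unfolding squash_def vec_lambda_beta t_def .
    qed
    ultimately show ?thesis by (simp add: unsquash_def t_def[symmetric] add_pos_nonneg)
  qed
  then show ?thesis by (simp add: vec_eq_iff)
qed

lemma squash_unsquash:
  assumes "y \<in> open_cube"
  shows "squash (unsquash y) = y"
proof -
  have "squash (unsquash y) $ i = y $ i" for i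
  proof -
    define t where "t = 2 * y $ i - 1"
    have t: "\<bar>t\<bar> < 1" using assms by (auto simp: t_def mem_box_cart abs_less_iff)
    have "1 + \<bar>t / (1 - \<bar>t\<bar>)\<bar> = 1 / (1 - \<bar>t\<bar>)" using t by (simp add: abs_divide field_simps)
    then have "t / (1 - \<bar>t\<bar>) / (1 + \<bar>t / (1 - \<bar>t\<bar>)\<bar>) = t" using t by simp
    then have "(1 + t / (1 - \<bar>t\<bar>) / (1 + \<bar>t / (1 - \<bar>t\<bar>)\<bar>)) / 2 = y $ i" by (simp add: t_def)
    then show ?thesis by (simp add: squash_def unsquash_def t_def)
  qed
  then show ?thesis by (simp add: vec_eq_iff)
qed

lemma continuous_on_squash: "continuous_on A squash"
  unfolding squash_def by (intro continuous_intros) (auto simp: add_nonneg_eq_0_iff)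

lemma continuous_on_unsquash: "continuous_on open_cube unsquash"
  unfolding unsquash_def
proof (intro continuous_intros ballI)
  fix i and y :: "real^'a" assume "y \<in> open_cube"
  then have "\<bar>2 * y $ i - 1\<bar> < 1" by (auto simp: mem_box_cart abs_less_iff)
  then show "1 - \<bar>2 * y $ i - 1\<bar> \<noteq> 0" by simp
qed

text \<open>The images of the measures under \<open>s\<close> after \<open>squash\<close> live on
  [0, 1] and are therefore tight, so Helly selection on the line applies. The limit is carried back
  by the continuous map \<open>f\<close> and \<open>unsquash\<close>.\<close>

lemma vague_compactness:
  fixes \<mu> :: "nat \<Rightarrow> (real^'n::finite) measure"
  assumes \<mu>: "\<And>n. prob_space (\<mu> n)" and sets: "\<And>n. sets (\<mu> n) = sets borel"
  obtains r \<gamma> where "strict_mono (r :: nat \<Rightarrow> nat)" "sets \<gamma> = sets borel" "emeasure \<gamma> UNIV \<le> 1"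
    "weakly_converges (\<lambda>k. \<mu> (r k)) \<gamma> sequentially"
proof -
  obtain f :: "real \<Rightarrow> real^'n" and s where f: "continuous_on UNIV f"
    and s[measurable]: "s \<in> borel_measurable borel" and s01: "\<And>x. 0 \<le> s x" "\<And>x. s x \<le> 1"
    and fs: "\<And>x. (\<And>i. 0 \<le> x $ i \<and> x $ i < 1) \<Longrightarrow> f (s x) = x"
    using space_filling_curve by blast
  have fm[measurable]: "f \<in> borel_measurable borel" using f by (rule borel_measurable_continuous_onI)
  have [measurable]: "squash \<in> borel_measurable borel"
    using continuous_on_squash by (rule borel_measurable_continuous_onI)
  define \<nu> where "\<nu> = (\<lambda>n. distr (\<mu> n) borel (\<lambda>x. s (squash x)))"
  have meas: "(\<lambda>x. s (squash x)) \<in> measurable (\<mu> n) borel" for n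
    using sets[of n] measurable_cong_sets[OF sets[of n] refl] by simp
  have rd: "real_distribution (\<nu> n)" for n
    unfolding \<nu>_def using prob_space.real_distribution_distr[OF \<mu>] meas by blast
  have "tight \<nu>"
    unfolding tight_def
  proof (intro conjI allI impI rd)
    fix \<epsilon> :: real assume "\<epsilon> > 0"
    \<comment> \<open>The left end is -1 because \<open>tight\<close> asks for half-open intervals
      and \<open>s\<close> may take the value 0.\<close>
    have "measure (\<nu> n) {-1<..1} = 1" for n
    proof -
      have "(\<lambda>x. s (squash x)) -` {-1<..1} \<inter> space (\<mu> n) = space (\<mu> n)"
        using s01 by (auto simp: less_le_trans[of "-1" 0])
      then show ?thesis unfolding \<nu>_def using meas[of n] by (simp add: measure_distr prob_space.prob_space[OF \<mu>])
    qed
    then show "\<exists>a b. a < b \<and> (\<forall>n. 1 - \<epsilon> < measure (\<nu> n) {a<..b})"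
      using \<open>\<epsilon> > 0\<close> by (intro exI[of _ "-1"] exI[of _ 1]) auto
  qed
  from tight_imp_convergent_subsubsequence[OF this strict_mono_id]
  obtain r M where r: "strict_mono (r :: nat \<Rightarrow> nat)" and M: "real_distribution M"
    and conv: "weak_conv_m (\<lambda>k. \<nu> (r k)) M"
    by (auto simp: comp_def)
  interpret M: real_distribution M by (rule M)
  \<comment> \<open>Limit mass whose image under \<open>f\<close> leaves the open cube is the mass
    that escaped to infinity; restricting to \<open>A\<close> discards it.\<close>
  define A where "A = {t. f t \<in> open_cube}"
  have Am[measurable]: "A \<in> sets borel" unfolding A_def by measurable
  \<comment> \<open>Extended by 0 off the cube in order to be Borel on the whole space.\<close>
  define \<tau> where "\<tau> = (\<lambda>y::real^'n. indicator open_cube y *\<^sub>R unsquash y)"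
  have [measurable]: "\<tau> \<in> borel_measurable borel"
    unfolding \<tau>_def by (rule borel_measurable_continuous_on_indicator) (auto intro: continuous_on_unsquash)
  define \<gamma> where "\<gamma> = distr (density M (indicator A)) borel (\<lambda>t. \<tau> (f t))"
  show thesis
  proof (rule that[OF r])
    show "sets \<gamma> = sets borel" by (simp add: \<gamma>_def)
    have "emeasure \<gamma> UNIV = emeasure M A"
      by (simp add: \<gamma>_def emeasure_distr emeasure_density nn_integral_indicator flip: times_ennreal.rep_eq)
    then show "emeasure \<gamma> UNIV \<le> 1" using M.emeasure_space_1 emeasure_space[of M A] by simp
    show "weakly_converges (\<lambda>k. \<mu> (r k)) \<gamma> sequentially"
      unfolding weakly_converges_def
    proof (intro allI impI)
      fix \<phi> :: "real^'n \<Rightarrow> real" assume "continuous_on UNIV \<phi> \<and> compactly_supported \<phi>"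
      then have \<phi>: "continuous_on UNIV \<phi>" "compactly_supported \<phi>" by auto
      have [measurable]: "\<phi> \<in> borel_measurable borel" using \<phi>(1) by (rule borel_measurable_continuous_onI)
      obtain B where B: "0 \<le> B" "\<And>x. \<bar>\<phi> x\<bar> \<le> B" using compactly_supported_bounded[OF \<phi>] by blast
      \<comment> \<open>A test function read in the cube. Its support is the \<open>squash\<close>
        image of a compact set, at positive distance from the boundary of the cube, so the extension
        by 0 is continuous.\<close>
      define \<Psi> where "\<Psi> = (\<lambda>y. indicator open_cube y * \<phi> (unsquash y))"
      let ?K = "squash ` closure {x. \<phi> x \<noteq> 0}"
      have "compact ?K"
        using \<phi>(2) by (intro compact_continuous_image continuous_on_squash) (simp add: compactly_supported_def)
      then have oK: "open (- ?K)" by (simp add: compact_imp_closed open_Compl)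
      have zK: "\<Psi> y = 0" if "y \<notin> ?K" for y
      proof (cases "y \<in> open_cube")
        case True
        then have "unsquash y \<notin> closure {x. \<phi> x \<noteq> 0}"
          using that imageI[of "unsquash y" "closure {x. \<phi> x \<noteq> 0}" squash] squash_unsquash[OF True] by auto
        from compactly_supported_zero[OF this] show ?thesis by (simp add: \<Psi>_def)
      qed (simp add: \<Psi>_def)
      have "continuous_on open_cube (\<lambda>y. \<phi> (unsquash y))"
        by (rule continuous_on_compose2[OF \<phi>(1) continuous_on_unsquash]) auto
      then have "continuous_on open_cube \<Psi>"
        by (rule continuous_on_eq) (simp add: \<Psi>_def)
      moreover have "continuous_on (- ?K) \<Psi>"
        using continuous_on_const[of "- ?K" 0] by (rule continuous_on_eq) (use zK in auto)
      ultimately have "continuous_on (open_cube \<union> - ?K) \<Psi>"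
        using oK by (intro continuous_on_open_Un) auto
      moreover have "?K \<subseteq> open_cube" using squash_in_cube by (auto simp: mem_box_cart)
      then have "open_cube \<union> - ?K = UNIV" by auto
      ultimately have \<Psi>: "continuous_on UNIV \<Psi>" by simp
      then have [measurable]: "\<Psi> \<in> borel_measurable borel" by (rule borel_measurable_continuous_onI)
      have "continuous_on UNIV (\<lambda>t. \<Psi> (f t))"
        by (rule continuous_on_compose2[OF \<Psi> f]) auto
      then have "isCont (\<lambda>t. \<Psi> (f t)) t" for t by (simp add: continuous_on_eq_continuous_at)
      moreover have "norm (\<Psi> (f t)) \<le> B" for t using B by (simp add: \<Psi>_def indicator_def)
      ultimately have "(\<lambda>k. LINT t|\<nu> (r k). \<Psi> (f t)) \<longlonglongrightarrow> (LINT t|M. \<Psi> (f t))"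
        by (intro weak_conv_imp_integral_bdd_continuous_conv[OF rd M conv]) auto
      moreover have "(LINT t|\<nu> n. \<Psi> (f t)) = (LINT x|\<mu> n. \<phi> x)" for n
      proof -
        have "(LINT t|\<nu> n. \<Psi> (f t)) = (LINT x|\<mu> n. \<Psi> (f (s (squash x))))"
          unfolding \<nu>_def using meas[of n] by (intro integral_distr) auto
        also have "(\<lambda>x. \<Psi> (f (s (squash x)))) = \<phi>"
        proof
          show "\<Psi> (f (s (squash x))) = \<phi> x" for x
            using fs[of "squash x"] squash_in_cube[of x] by (simp add: \<Psi>_def unsquash_squash less_imp_le mem_box_cart)
        qed
        finally show ?thesis by simp
      qed
      moreover have "(LINT t|M. \<Psi> (f t)) = (LINT x|\<gamma>. \<phi> x)"
      proof -
        have "(LINT x|\<gamma>. \<phi> x) = (LINT t|density M (\<lambda>t. ennreal (indicator A t)). \<phi> (\<tau> (f t)))"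
          unfolding \<gamma>_def ennreal_indicator by (intro integral_distr) auto
        also have "\<dots> = (LINT t|M. indicator A t *\<^sub>R \<phi> (\<tau> (f t)))"
          by (intro integral_density) auto
        also have "\<dots> = (LINT t|M. \<Psi> (f t))"
          by (intro Bochner_Integration.integral_cong) (auto simp: \<Psi>_def \<tau>_def A_def indicator_def)
        finally show ?thesis by simp
      qed
      ultimately show "(\<lambda>k. LINT x|\<mu> (r k). \<phi> x) \<longlonglongrightarrow> (LINT x|\<gamma>. \<phi> x)" by simp
    qed
  qed
qed

subsection \<open>Vector fields below the potential\<close>

lemma matrix_diff_rdistrib: "(A - B) ** C = A ** C - B ** (C :: real^'p::finite^'n::finite)"
  by (simp add: matrix_matrix_mult_def vec_eq_iff sum_subtractf algebra_simps)

lemma matrix_diff_ldistrib: "(C :: real^'p::finite^'n::finite) ** (A - B) = C ** A - C ** B"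
  by (simp add: matrix_matrix_mult_def vec_eq_iff sum_subtractf algebra_simps)

lemma trace_scaleR: "trace (c *\<^sub>R A) = c * trace (A :: real^'n::finite^'n)"
  by (simp add: trace_def sum_distrib_left)

lemma trace_mat_1: "trace (mat 1 :: real^'n::finite^'n) = real CARD('n)"
  by (simp add: trace_def mat_def)

text \<open>With \<open>B = psd_sqrt A + \<eta>\<close>, expand the trace of the positive semidefinite matrix
  \<open>(X - B) ** M ** (X - B)\<close>.\<close>

lemma regularized_inverse_sqrt:
  fixes A :: "real^'n::finite^'n"
  assumes A: "pos_semidef A" and \<eta>: "\<eta> > 0"
  obtains M where "transpose M = M"
    and "\<And>v. (M ** M *v v) \<bullet> (A *v (M ** M *v v)) + \<eta>\<^sup>2 * (norm (M ** M *v v))\<^sup>2 \<le> (norm (M *v v))\<^sup>2"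
    and "\<And>X. pos_semidef X \<Longrightarrow> 2 * trace X \<le> trace (M ** (X ** X)) + trace (M ** A) + 2 * \<eta> * real CARD('n)"
proof -
  define S where "S = psd_sqrt A"
  have S: "pos_semidef S" "S ** S = A" using psd_sqrt[OF A] by (auto simp: S_def)
  define B where "B = S + \<eta> *\<^sub>R mat 1"
  have Bv: "B *v v = S *v v + \<eta> *\<^sub>R v" for v
    by (simp add: B_def matrix_vector_mult_add_rdistrib scaleR_matrix_vector_assoc[symmetric])
  have tB: "transpose B = B" using S(1) by (simp add: B_def pos_semidef_def transpose_def vec_eq_iff mat_def)
  have form: "v \<bullet> (B *v v) \<ge> \<eta> * (v \<bullet> v)" for v
    using S(1) by (simp add: Bv inner_add_right pos_semidef_def)
  have "v = 0" if "B *v v = 0" for v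
  proof -
    have "v \<bullet> v \<le> 0" using form[of v] \<eta> that by (simp add: mult_le_0_iff)
    then have "v \<bullet> v = 0" by (rule order_antisym) simp
    then show ?thesis by simp
  qed
  then obtain M where MB: "M ** B = mat 1" using matrix_left_invertible_ker[of B] by blast
  then have BM: "B ** M = mat 1" by (rule matrix_left_right_inverse1)
  have "B ** transpose M = mat 1" using arg_cong[OF MB, of transpose] tB by (simp add: matrix_transpose_mul)
  then have tM: "transpose M = M" by (metis MB matrix_mul_assoc matrix_mul_lid matrix_mul_rid)
  have MBv: "M *v (B *v v) = v" and BMv: "B *v (M *v v) = v" for v
    using MB BM by (simp_all add: matrix_vector_mul_assoc)
  have psdM: "pos_semidef M"
    unfolding pos_semidef_def
  proof (intro conjI allI tM)
    fix v
    have "0 \<le> \<eta> * ((M *v v) \<bullet> (M *v v))" using \<eta> by simp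
    also have "\<dots> \<le> (M *v v) \<bullet> (B *v (M *v v))" by (rule form)
    finally show "0 \<le> v \<bullet> (M *v v)" by (simp add: BMv inner_commute)
  qed
  show thesis
  proof (rule that[OF tM])
    fix v
    define h where "h = M ** M *v v"
    have "B *v h = M *v v" by (simp add: h_def matrix_vector_mul_assoc[symmetric] BMv)
    then have "(norm (M *v v))\<^sup>2 = (B *v h) \<bullet> (B *v h)" by (simp add: power2_norm_eq_inner)
    also have "\<dots> = (S *v h) \<bullet> (S *v h) + 2 * \<eta> * (h \<bullet> (S *v h)) + \<eta>\<^sup>2 * (h \<bullet> h)"
      by (simp add: Bv inner_add_left inner_add_right inner_commute[of "S *v h" h] power2_eq_square algebra_simps)
    also have "(S *v h) \<bullet> (S *v h) = h \<bullet> (A *v h)"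
      using pos_semidef_sym[OF S(1), of h "S *v h"] by (simp add: matrix_vector_mul_assoc S(2))
    finally show "h \<bullet> (A *v h) + \<eta>\<^sup>2 * (norm h)\<^sup>2 \<le> (norm (M *v v))\<^sup>2"
      using S(1) \<eta> by (simp add: power2_norm_eq_inner pos_semidef_def)
  next
    fix X :: "real^'n^'n" assume X: "pos_semidef X"
    have t: "transpose (X - B) = X - B" using X tB by (simp add: pos_semidef_def transpose_def vec_eq_iff)
    have "0 \<le> trace ((X - B) ** M ** (X - B))"
      by (intro trace_pos_semidef_nonneg pos_semidef_congruence psdM t)
    also have "(X - B) ** M ** (X - B) = X ** M ** X - X - X + B"
      by (simp add: matrix_diff_rdistrib matrix_diff_ldistrib BM matrix_mul_assoc[symmetric] MB)
    also have "trace \<dots> = trace (X ** M ** X) - 2 * trace X + trace B"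
      by (simp only: trace_add trace_sub)
    also have "trace (X ** M ** X) = trace (M ** (X ** X))"
      by (metis matrix_mul_assoc trace_mul_sym)
    \<comment> \<open>Since M S = 1 - \<eta> M, the trace of M A is tr S - \<eta> d + \<eta>^2 tr M
      with d the dimension, whereas tr B = tr S + \<eta> d.\<close>
    also have "trace B \<le> trace (M ** A) + 2 * \<eta> * real CARD('n)"
    proof -
      have MS: "M ** S = mat 1 - \<eta> *\<^sub>R M"
        using MB by (simp add: B_def matrix_add_ldistrib matrix_scalar_ac eq_diff_eq)
      have "M ** A = S - \<eta> *\<^sub>R (M ** S)"
        by (simp add: S(2)[symmetric] matrix_mul_assoc MS matrix_diff_rdistrib scalar_matrix_assoc[symmetric])
      then have "trace (M ** A) = trace S - \<eta> * (real CARD('n) - \<eta> * trace M)"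
        by (simp add: MS trace_sub trace_scaleR trace_mat_1)
      moreover have "trace B = trace S + \<eta> * real CARD('n)"
        by (simp add: B_def trace_add trace_scaleR trace_mat_1)
      moreover have "0 \<le> \<eta> * (\<eta> * trace M)" using \<eta> trace_pos_semidef_nonneg[OF psdM] by simp
      ultimately show ?thesis by (simp add: algebra_simps)
    qed
    finally show "2 * trace X \<le> trace (M ** (X ** X)) + trace (M ** A) + 2 * \<eta> * real CARD('n)" by simp
  qed
qed

text \<open>The inequality \<open>0 \<le> V (x - N \<nabla>V)\<close> with \<open>N = M ** M\<close> bounds \<open>M \<nabla>V\<close> by \<open>sqrt (2 * V)\<close>.\<close>

lemma local_vector_field:
  fixes V :: "real^'n::finite \<Rightarrow> real"
  assumes U: "open U" and C2: "Ck_on 2 U V" and nn: "\<And>y. 0 \<le> V y"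
    and x0: "x0 \<in> U" "V x0 = 0" and \<eta>: "\<eta> > 0"
  obtains r M where "r > 0" "ball x0 r \<subseteq> U"
    "\<And>x. x \<in> ball x0 r \<Longrightarrow> (norm (M *v grad V x))\<^sup>2 \<le> 2 * V x"
    "\<And>x. x \<in> ball x0 r \<Longrightarrow> V x = 0 \<Longrightarrow> trace (psd_sqrt (hessian V x)) \<le> trace (M ** hessian V x) + (real CARD('n) + 1) * \<eta>"
proof -
  let ?A = "hessian V x0"
  have A: "pos_semidef ?A" by (rule hessian_psd_at_zero[OF U C2 x0(1) nn x0(2)])
  obtain M where tM: "transpose M = M"
    and M1: "\<And>v. (M ** M *v v) \<bullet> (?A *v (M ** M *v v)) + \<eta>\<^sup>2 * (norm (M ** M *v v))\<^sup>2 \<le> (norm (M *v v))\<^sup>2"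
    and M2: "\<And>X. pos_semidef X \<Longrightarrow> 2 * trace X \<le> trace (M ** (X ** X)) + trace (M ** ?A) + 2 * \<eta> * real CARD('n)"
    using regularized_inverse_sqrt[OF A \<eta>] by blast
  have "\<eta>\<^sup>2 > 0" using \<eta> by simp
  from Taylor2[OF U C2 x0(1) this] obtain r0 where r0: "r0 > 0" "ball x0 r0 \<subseteq> U"
    and T: "\<And>x h. x \<in> ball x0 r0 \<Longrightarrow> x + h \<in> ball x0 r0 \<Longrightarrow>
       \<bar>V (x + h) - V x - grad V x \<bullet> h - (h \<bullet> (?A *v h)) / 2\<bar> \<le> \<eta>\<^sup>2 * (norm h)\<^sup>2 / 2"
    by blast
  have gc: "continuous (at x0) (grad V)" and hc: "continuous (at x0) (hessian V)"
    using Ck_on_2D(3,4)[OF C2] U x0(1) by (simp_all add: continuous_on_eq_continuous_at)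
  \<comment> \<open>The shifted point must stay in the ball of the Taylor expansion, which holds
    near \<open>x0\<close> because the gradient vanishes there.\<close>
  have "((\<lambda>x. x - M ** M *v grad V x) \<longlongrightarrow> x0 - M ** M *v grad V x0) (at x0)"
    using gc by (intro tendsto_intros bounded_linear.tendsto[OF matrix_vector_mul_bounded_linear]) (simp add: continuous_at)
  then have "((\<lambda>x. x - M ** M *v grad V x) \<longlongrightarrow> x0) (at x0)"
    using grad_zero_at_zero[OF U C2 x0(1) nn x0(2)] by simp
  then obtain r1 where r1: "r1 > 0" "\<And>x. x \<noteq> x0 \<Longrightarrow> dist x x0 < r1 \<Longrightarrow> dist (x - M ** M *v grad V x) x0 < r0"
    using r0(1) unfolding Lim_at zero_less_dist_iff by metis
  have "((\<lambda>x. trace (M ** hessian V x)) \<longlongrightarrow> trace (M ** ?A)) (at x0)"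
    using hc unfolding trace_def matrix_matrix_mult_def vec_lambda_beta
    by (intro tendsto_intros) (simp add: continuous_at)
  then obtain r2 where r2: "r2 > 0" "\<And>x. x \<noteq> x0 \<Longrightarrow> dist x x0 < r2 \<Longrightarrow> dist (trace (M ** hessian V x)) (trace (M ** ?A)) < \<eta>"
    using \<eta> unfolding Lim_at zero_less_dist_iff by metis
  define r where "r = Min {r0, r1, r2}"
  have r: "r > 0" "r \<le> r0" "r \<le> r1" "r \<le> r2" using r0 r1 r2 by (auto simp: r_def)
  show thesis
  proof (rule that)
    show "r > 0" "ball x0 r \<subseteq> U" using r r0 by (auto simp: subset_eq)
    fix x assume x: "x \<in> ball x0 r"
    define h where "h = - (M ** M *v grad V x)"
    \<comment> \<open>The limit gives \<open>r1\<close> only for \<open>x\<close> different from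
      \<open>x0\<close>; at \<open>x0\<close> itself the step \<open>h\<close> is 0.\<close>
    have "x + h \<in> ball x0 r0"
      using x r r1(2)[of x] r0(1) grad_zero_at_zero[OF U C2 x0(1) nn x0(2)]
      by (cases "x = x0") (auto simp: h_def dist_commute)
    moreover have "x \<in> ball x0 r0" using x r by auto
    ultimately have "\<bar>V (x + h) - V x - grad V x \<bullet> h - (h \<bullet> (?A *v h)) / 2\<bar> \<le> \<eta>\<^sup>2 * (norm h)\<^sup>2 / 2"
      by (rule T[rotated])
    moreover have "0 \<le> V (x + h)" by (rule nn)
    moreover have "grad V x \<bullet> h = - (norm (M *v grad V x))\<^sup>2"
    proof -
      have "grad V x \<bullet> (M *v (M *v grad V x)) = (M *v grad V x) \<bullet> (M *v grad V x)"
        by (metis tM dot_lmul_matrix transpose_matrix_vector vector_transpose_matrix)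
      then show ?thesis by (simp add: h_def matrix_vector_mul_assoc[symmetric] power2_norm_eq_inner)
    qed
    moreover have "h \<bullet> (?A *v h) + \<eta>\<^sup>2 * (norm h)\<^sup>2 \<le> (norm (M *v grad V x))\<^sup>2"
    proof -
      have "?A *v (- k) = - (?A *v k)" for k using linear_neg[OF matrix_vector_mul_linear] by blast
      then show ?thesis using M1[of "grad V x"] by (simp add: h_def)
    qed
    \<comment> \<open>0 \<le> V(x + h) \<le> V(x) - |M grad V|^2 + (h . A h + \<eta>^2 |h|^2) / 2
      with A the Hessian at \<open>x0\<close>, and the last term is at most |M grad V|^2 /
      2.\<close>
    ultimately show "(norm (M *v grad V x))\<^sup>2 \<le> 2 * V x" by (simp add: abs_le_iff field_simps)
    assume Vx: "V x = 0"
    have xU: "x \<in> U" using x r r0 by auto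
    have H: "pos_semidef (hessian V x)" by (rule hessian_psd_at_zero[OF U C2 xU nn Vx])
    have "trace (M ** ?A) \<le> trace (M ** hessian V x) + \<eta>"
      using r2(2)[of x] x r \<eta> by (cases "x = x0") (auto simp: dist_real_def dist_commute)
    \<comment> \<open>Taking X to be the square root of the Hessian at \<open>x\<close> compares it
      with the one at \<open>x0\<close> through \<open>trace (M ** hessian V x)\<close>, which is
      continuous in \<open>x\<close>.\<close>
    with M2[OF psd_sqrt(1)[OF H]]
    show "trace (psd_sqrt (hessian V x)) \<le> trace (M ** hessian V x) + (real CARD('n) + 1) * \<eta>"
      using \<eta> by (simp add: psd_sqrt(2)[OF H] algebra_simps)
  qed
qed

section \<open>Cutting off and gluing the fields\<close>

text \<open>An exponent of at least 2 makes the positive part differentiable at its kink. These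
  powers provide both the cutoffs and the compactly supported trial functions.\<close>

lemma has_derivative_truncated_power:
  "((\<lambda>t. max 0 t ^ Suc (Suc k)) has_real_derivative real (Suc (Suc k)) * max 0 t ^ Suc k) (at t)"
proof -
  consider "t > 0" | "t < 0" | "t = 0" by linarith
  then show ?thesis
  proof cases
    case 1
    have "((\<lambda>t. t ^ Suc (Suc k)) has_real_derivative real (Suc (Suc k)) * t ^ Suc k) (at t)"
      using DERIV_pow[of "Suc (Suc k)" t UNIV] by simp
    then have "((\<lambda>t. max 0 t ^ Suc (Suc k)) has_real_derivative real (Suc (Suc k)) * t ^ Suc k) (at t)"
      by (rule has_field_derivative_transform_within_open[where S = "{0<..}"]) (use 1 in auto)
    then show ?thesis using 1 by (simp add: max_def)
  next
    case 2
    have "((\<lambda>t. 0) has_real_derivative 0) (at t)" by simp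
    then have "((\<lambda>t. max 0 t ^ Suc (Suc k)) has_real_derivative 0) (at t)"
      by (rule has_field_derivative_transform_within_open[where S = "{..<0}"]) (use 2 in auto)
    then show ?thesis using 2 by (simp add: max_def)
  next
    case 3
    have "((\<lambda>h::real. max 0 h ^ Suc (Suc k) / h) \<longlongrightarrow> 0) (at 0)"
    proof (rule Lim_null_comparison)
      show "\<forall>\<^sub>F h::real in at 0. norm (max 0 h ^ Suc (Suc k) / h) \<le> \<bar>h\<bar> ^ Suc k"
      proof (intro always_eventually allI)
        show "norm (max 0 h ^ Suc (Suc k) / h) \<le> \<bar>h\<bar> ^ Suc k" for h :: real
        proof (cases "h > 0")
          case False
          then have "max 0 h = 0" by simp
          then have "norm (max 0 h ^ Suc (Suc k) / h) = 0" by simp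
          also have "0 \<le> \<bar>h\<bar> ^ Suc k" by (rule zero_le_power) simp
          finally show ?thesis .
        qed simp
      qed
      show "((\<lambda>h::real. \<bar>h\<bar> ^ Suc k) \<longlongrightarrow> 0) (at 0)"
        by (rule tendsto_eq_intros tendsto_rabs_zero tendsto_ident_at refl)+ simp
    qed
    then show ?thesis using 3 by (simp add: DERIV_def)
  qed
qed

text \<open>The square of the positive part of r^2 - |x - x0|^2: a cutoff of class C^1 suffices,
  since the energy bound asks only for a C^1 field.\<close>

lemma ball_cutoff:
  fixes x0 :: "real^'n::finite"
  assumes "r > 0"
  obtains \<beta> g where "\<And>x. (\<beta> has_derivative (\<lambda>h. g x \<bullet> h)) (at x)" "continuous_on UNIV g"
    "\<And>x. \<beta> x \<ge> 0" "\<And>x. \<beta> x > 0 \<longleftrightarrow> x \<in> ball x0 r" "\<And>x. x \<notin> ball x0 r \<Longrightarrow> g x = 0"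
proof -
  define q where "q = (\<lambda>x. r\<^sup>2 - (x - x0) \<bullet> (x - x0))"
  define \<beta> where "\<beta> = (\<lambda>x. max 0 (q x) ^ Suc (Suc 0))"
  define g where "g = (\<lambda>x. (- 4 * max 0 (q x)) *\<^sub>R (x - x0))"
  have q: "q x > 0 \<longleftrightarrow> x \<in> ball x0 r" for x
    using assms power_mono_iff[of r "norm (x - x0)" 2]
    by (simp add: q_def power2_norm_eq_inner[symmetric] dist_norm norm_minus_commute not_le[symmetric] del: power_mono_iff)
  show thesis
  proof (rule that)
    fix x
    have "(q has_derivative (\<lambda>h. - 2 * ((x - x0) \<bullet> h))) (at x)"
      unfolding q_def by (auto intro!: derivative_eq_intros simp: inner_commute)
    from has_derivative_compose[OF this has_derivative_truncated_power[unfolded has_field_derivative_def, of 0 "q x"]]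
    show "(\<beta> has_derivative (\<lambda>h. g x \<bullet> h)) (at x)"
      by (simp add: \<beta>_def g_def mult_ac)
    show "continuous_on UNIV g" unfolding g_def q_def by (intro continuous_intros)
    show "\<beta> x \<ge> 0" by (simp add: \<beta>_def)
    show "\<beta> x > 0 \<longleftrightarrow> x \<in> ball x0 r" using q[of x] by (auto simp: \<beta>_def max_def)
    show "x \<notin> ball x0 r \<Longrightarrow> g x = 0" using q[of x] by (auto simp: g_def max_def)
  qed
qed

text \<open>The matrix on the left is the rank-one part of the Jacobian of a scalar function times a
  vector field.\<close>

lemma outer_product_vector:
  "(\<chi> k l. u $ k * g $ l) *v h = (g \<bullet> h) *\<^sub>R (u :: real^'n::finite)"
  by (simp add: vec_eq_iff matrix_vector_mult_def inner_vec_def sum_distrib_left sum_distrib_right mult_ac)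

lemma continuous_on_matrix_mult [continuous_intros]:
  fixes A :: "'a::topological_space \<Rightarrow> real^'n::finite^'m::finite" and B :: "'a \<Rightarrow> real^'p::finite^'n"
  assumes "continuous_on S A" "continuous_on S B"
  shows "continuous_on S (\<lambda>x. A x ** B x)"
  unfolding matrix_matrix_mult_def using assms by (intro continuous_intros)

lemma continuous_on_matrix_vector_mult [continuous_intros]:
  fixes A :: "'a::topological_space \<Rightarrow> real^'n::finite^'m::finite" and v :: "'a \<Rightarrow> real^'n"
  assumes "continuous_on S A" "continuous_on S v"
  shows "continuous_on S (\<lambda>x. A x *v v x)"
  unfolding matrix_vector_mult_def using assms by (intro continuous_intros)

text \<open>The product rule adds to the Jacobian the outer product of \<open>M *v grad V x\<close>
  with the gradient of the cutoff. It vanishes at the zeros of \<open>V\<close>, so there the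
  divergence is merely multiplied by the cutoff.\<close>

lemma cutoff_vector_field:
  fixes V :: "real^'n::finite \<Rightarrow> real"
  assumes U: "open U" and C2: "Ck_on 2 U V" and nn: "\<And>y. 0 \<le> V y"
    and x0: "x0 \<in> U" "V x0 = 0" and \<eta>: "\<eta> > 0"
  obtains \<beta> g F J where "\<And>x. (\<beta> has_derivative (\<lambda>h. g x \<bullet> h)) (at x)" "continuous_on UNIV g"
    "\<And>x. \<beta> x \<ge> 0" "\<beta> x0 > 0"
    "\<And>x. (F has_derivative (\<lambda>h. J x *v h)) (at x)" "continuous_on UNIV J"
    "compact (closure {x. F x \<noteq> 0})" "\<And>x. norm (F x) \<le> \<beta> x * sqrt (2 * V x)"
    "\<And>x. V x = 0 \<Longrightarrow> \<beta> x * (trace (psd_sqrt (hessian V x)) - \<eta>) \<le> trace (J x)"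
proof -
  define d where "d = \<eta> / (real CARD('n) + 1)"
  have d: "d > 0" "(real CARD('n) + 1) * d = \<eta>" using \<eta> by (simp_all add: d_def add_nonneg_pos)
  obtain R M where R: "R > 0" "ball x0 R \<subseteq> U"
    and M1: "\<And>x. x \<in> ball x0 R \<Longrightarrow> (norm (M *v grad V x))\<^sup>2 \<le> 2 * V x"
    and M2: "\<And>x. x \<in> ball x0 R \<Longrightarrow> V x = 0 \<Longrightarrow> trace (psd_sqrt (hessian V x)) \<le> trace (M ** hessian V x) + (real CARD('n) + 1) * d"
    using local_vector_field[OF U C2 nn x0 d(1)] by blast
  \<comment> \<open>The cutoff lives on a strictly smaller ball, so that the larger open ball and
    the exterior of the smaller closed ball cover the space and the pasted field is C^1.\<close>
  define r where "r = R / 2"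
  have r: "r > 0" "r < R" using R by (auto simp: r_def)
  obtain \<beta> g where \<beta>: "\<And>x. (\<beta> has_derivative (\<lambda>h. g x \<bullet> h)) (at x)" "continuous_on UNIV g"
    "\<And>x. \<beta> x \<ge> 0" "\<And>x. \<beta> x > 0 \<longleftrightarrow> x \<in> ball x0 r" "\<And>x. x \<notin> ball x0 r \<Longrightarrow> g x = 0"
    using ball_cutoff[OF r(1), of x0] by blast
  have \<beta>0: "\<beta> x = 0" if "x \<notin> ball x0 r" for x using \<beta>(3,4)[of x] that by auto
  have \<beta>c: "continuous_on S \<beta>" for S
    using \<beta>(1) by (meson continuous_at_imp_continuous_on has_derivative_continuous)
  define F where "F = (\<lambda>x. \<beta> x *\<^sub>R (M *v grad V x))"
  define J where "J = (\<lambda>x. \<beta> x *\<^sub>R (M ** transpose (hessian V x)) + (\<chi> k l. (M *v grad V x) $ k * g x $ l))"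
  have J0: "J x = 0" if "x \<notin> ball x0 r" for x
    using \<beta>0[OF that] \<beta>(5)[OF that] by (simp add: J_def vec_eq_iff)
  have cl: "closed (cball x0 r)" by simp
  show thesis
  proof (rule that[OF \<beta>(1-3)])
    show "\<beta> x0 > 0" using \<beta>(4) r by simp
    show "(F has_derivative (\<lambda>h. J x *v h)) (at x)" for x
    proof (cases "x \<in> ball x0 R")
      case True
      then have "x \<in> U" using R by auto
      have "((\<lambda>x. M *v grad V x) has_derivative (\<lambda>h. M *v (transpose (hessian V x) *v h))) (at x)"
        by (rule bounded_linear.has_derivative[OF matrix_vector_mul_bounded_linear has_derivative_grad_hessian[OF C2 \<open>x \<in> U\<close>]])
      from has_derivative_scaleR[OF \<beta>(1)[of x] this]
      show ?thesis
        unfolding F_def J_def matrix_vector_mult_add_rdistrib outer_product_vector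
        by (simp add: matrix_vector_mul_assoc scaleR_matrix_vector_assoc del: transpose_matrix_vector)
    next
      case False
      have "(F has_derivative (\<lambda>h. 0)) (at x)"
      proof (rule has_derivative_transform_within_open[OF has_derivative_const[of 0]])
        show "open (- cball x0 r)" by auto
        show "x \<in> - cball x0 r" using False r by auto
        show "0 = F y" if "y \<in> - cball x0 r" for y using \<beta>0[of y] that by (simp add: F_def)
      qed
      then show ?thesis using J0[of x] False r by simp
    qed
    show "continuous_on UNIV J"
    proof -
      have gh: "continuous_on (ball x0 R) (hessian V)" "continuous_on (ball x0 R) (grad V)" "continuous_on (ball x0 R) g"
        using Ck_on_2D(3,4)[OF C2] R(2) \<beta>(2) continuous_on_subset by blast+
      have "continuous_on (ball x0 R) J"
        unfolding J_def transpose_def by (intro continuous_intros gh \<beta>c)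
      moreover have "continuous_on (- cball x0 r) J"
        using continuous_on_const[of "- cball x0 r" 0] by (rule continuous_on_eq) (use J0 in auto)
      ultimately have "continuous_on (ball x0 R \<union> - cball x0 r) J"
        by (intro continuous_on_open_Un) auto
      moreover have "ball x0 R \<union> - cball x0 r = UNIV" using r by auto
      ultimately show ?thesis by simp
    qed
    have "closure {x. F x \<noteq> 0} \<subseteq> cball x0 r"
      using \<beta>0 ball_subset_cball[of x0 r] by (intro closure_minimal) (force simp: F_def, simp)
    then show "compact (closure {x. F x \<noteq> 0})"
      by (meson bounded_cball bounded_subset closed_closure compact_eq_bounded_closed)
    show "norm (F x) \<le> \<beta> x * sqrt (2 * V x)" for x
    proof (cases "x \<in> ball x0 r")
      case True
      then have "(norm (M *v grad V x))\<^sup>2 \<le> 2 * V x" using M1 r by auto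
      then have "norm (M *v grad V x) \<le> sqrt (2 * V x)" by (rule real_le_rsqrt)
      then show ?thesis using \<beta>(3)[of x] by (simp add: F_def mult_left_mono)
    qed (use \<beta>0 in \<open>simp add: F_def\<close>)
    show "\<beta> x * (trace (psd_sqrt (hessian V x)) - \<eta>) \<le> trace (J x)" if Vx: "V x = 0" for x
    proof (cases "x \<in> ball x0 r")
      case True
      then have xR: "x \<in> ball x0 R" and xU: "x \<in> U" using r R by auto
      have "grad V x = 0" by (rule grad_zero_at_zero[OF U C2 xU nn Vx])
      then have "trace (J x) = \<beta> x * trace (M ** hessian V x)"
        by (simp add: J_def hessian_symmetric[OF U C2 xU] trace_add trace_scaleR) (simp add: trace_def)
      then show ?thesis using M2[OF xR Vx] d(2) \<beta>(3)[of x] by (simp add: mult_left_mono)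
    qed (use \<beta>0 J0 in \<open>simp add: trace_def\<close>)
  qed
qed

lemma has_derivative_continuous_on_UNIV:
  "(\<And>x. (f has_derivative D x) (at x)) \<Longrightarrow> continuous_on UNIV f"
  by (intro continuous_at_imp_continuous_on ballI has_derivative_continuous)

text \<open>The index \<open>m\<close> plays two roles: it truncates a countable family, which keeps
  the support compact, and it multiplies the sum of cutoffs, which drives the total weight
  \<open>P m\<close> to 1 at every zero. Monotonicity in \<open>m\<close> is recorded for monotone
  convergence under the limit measure.\<close>

lemma lower_bound_fields:
  fixes V :: "real^'n::finite \<Rightarrow> real"
  assumes U: "open U" "{x. V x = 0} \<subseteq> U" and C2: "Ck_on 2 U V" and nn: "\<And>y. 0 \<le> V y"
    and \<eta>: "\<eta> > 0" and ne: "{x. V x = 0} \<noteq> {}"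
  obtains w J P where
    "\<And>m x. (w m has_derivative (\<lambda>h. J m x *v h)) (at x)" "\<And>m::nat. continuous_on UNIV (J m)"
    "\<And>m. compact (closure {x. w m x \<noteq> 0})" "\<And>m x. (norm (w m x))\<^sup>2 \<le> 2 * V x"
    "\<And>m x. V x = 0 \<Longrightarrow> P m x * (trace (psd_sqrt (hessian V x)) - \<eta>) \<le> trace (J m x)"
    "\<And>m x. 0 \<le> P m x" "\<And>m x. P m x \<le> 1" "\<And>m. continuous_on UNIV (P m)"
    "\<And>x. incseq (\<lambda>m. P m x)" "\<And>x. V x = 0 \<Longrightarrow> (\<lambda>m. P m x) \<longlonglongrightarrow> 1"
proof -
  let ?Z = "{x. V x = 0}"
  define Q where "Q = (\<lambda>z \<beta> g F J. (\<forall>x. (\<beta> has_derivative (\<lambda>h. g x \<bullet> h)) (at x)) \<and> continuous_on UNIV g \<and>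
    (\<forall>x. 0 \<le> \<beta> x) \<and> \<beta> z > 0 \<and>
    (\<forall>x. (F has_derivative (\<lambda>h. J x *v h)) (at x)) \<and> continuous_on UNIV J \<and>
    compact (closure {x. F x \<noteq> 0}) \<and> (\<forall>x. norm (F x) \<le> \<beta> x * sqrt (2 * V x)) \<and>
    (\<forall>x. V x = 0 \<longrightarrow> \<beta> x * (trace (psd_sqrt (hessian V x)) - \<eta>) \<le> trace (J x)))"
  have "\<exists>\<beta> g F J. Q z \<beta> g F J" if "z \<in> ?Z" for z
  proof -
    have z: "z \<in> U" "V z = 0" using that U by auto
    show ?thesis
      unfolding Q_def by (rule cutoff_vector_field[OF U(1) C2 nn z \<eta>]) blast
  qed
  then obtain \<beta> g F J where Q: "\<And>z. z \<in> ?Z \<Longrightarrow> Q z (\<beta> z) (g z) (F z) (J z)"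
    by metis
  have \<beta>: "\<And>z x. z \<in> ?Z \<Longrightarrow> (\<beta> z has_derivative (\<lambda>h. g z x \<bullet> h)) (at x)"
    and g: "\<And>z. z \<in> ?Z \<Longrightarrow> continuous_on UNIV (g z)"
    and \<beta>0: "\<And>z x. z \<in> ?Z \<Longrightarrow> \<beta> z x \<ge> 0" and \<beta>z: "\<And>z. z \<in> ?Z \<Longrightarrow> \<beta> z z > 0"
    and F: "\<And>z x. z \<in> ?Z \<Longrightarrow> (F z has_derivative (\<lambda>h. J z x *v h)) (at x)"
    and J: "\<And>z. z \<in> ?Z \<Longrightarrow> continuous_on UNIV (J z)"
    and Fc: "\<And>z. z \<in> ?Z \<Longrightarrow> compact (closure {x. F z x \<noteq> 0})"
    and FV: "\<And>z x. z \<in> ?Z \<Longrightarrow> norm (F z x) \<le> \<beta> z x * sqrt (2 * V x)"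
    and JT: "\<And>z x. z \<in> ?Z \<Longrightarrow> V x = 0 \<Longrightarrow> \<beta> z x * (trace (psd_sqrt (hessian V x)) - \<eta>) \<le> trace (J z x)"
    using Q unfolding Q_def by blast+
  have \<beta>c: "continuous_on UNIV (\<beta> z)" if "z \<in> ?Z" for z
    by (rule has_derivative_continuous_on_UNIV[OF \<beta>[OF that]])
  let ?O = "\<lambda>z. {x. 0 < \<beta> z x}"
  have "open S" if "S \<in> ?O ` ?Z" for S
    using that \<beta>c by (auto intro!: open_Collect_less continuous_intros)
  \<comment> \<open>The zero set need not be compact; a countable subcover is enough for partial
    sums.\<close>
  from Lindelof[OF this] obtain F' where F': "F' \<subseteq> ?O ` ?Z" "countable F'" "\<Union>F' = \<Union>(?O ` ?Z)" by blast
  then obtain C where C: "countable C" "C \<subseteq> ?Z" "F' = ?O ` C" by (meson countable_subset_image)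
  have cov: "?Z \<subseteq> (\<Union>z\<in>C. ?O z)" using F'(3) \<beta>z C(3) by blast
  then have "C \<noteq> {}" using ne by auto
  define c where "c = from_nat_into C"
  have cZ: "c j \<in> ?Z" for j using from_nat_into[OF \<open>C \<noteq> {}\<close>] C(2) by (auto simp: c_def)
  have ccov: "\<exists>j. 0 < \<beta> (c j) x" if "V x = 0" for x
  proof -
    obtain z where "z \<in> C" and z: "0 < \<beta> z x" using cov \<open>V x = 0\<close> by blast
    then obtain j where "z = c j" using range_from_nat_into[OF \<open>C \<noteq> {}\<close> C(1)] unfolding c_def by (metis rangeE)
    then show ?thesis using z by auto
  qed
  define S where "S = (\<lambda>(m::nat) x. \<Sum>j<m. \<beta> (c j) x)"
  define gS where "gS = (\<lambda>(m::nat) x. \<Sum>j<m. g (c j) x)"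
  define FS where "FS = (\<lambda>(m::nat) x. \<Sum>j<m. F (c j) x)"
  define JS where "JS = (\<lambda>(m::nat) x. \<Sum>j<m. J (c j) x)"
  \<comment> \<open>\<open>q m x * S m x\<close> stays below 1, which preserves the bound on the
    field; the 1 in the denominator avoids dividing by \<open>S\<close>, which may vanish.\<close>
  define q where "q = (\<lambda>(m::nat) x. real m / (1 + real m * S m x))"
  define P where "P = (\<lambda>m x. q m x * S m x)"
  have S0: "0 \<le> S m x" for m x unfolding S_def using \<beta>0[OF cZ] by (intro sum_nonneg) auto
  have den: "1 + real m * S m x > 0" for m x using S0[of m x] by (simp add: add_pos_nonneg)
  have q0: "0 \<le> q m x" for m x using den[of m x] by (simp add: q_def)
  have Sd: "(S m has_derivative (\<lambda>h. gS m x \<bullet> h)) (at x)" for m x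
    unfolding S_def gS_def inner_sum_left using \<beta>[OF cZ] by (intro has_derivative_sum) auto
  have FSd: "(FS m has_derivative (\<lambda>h. JS m x *v h)) (at x)" for m x
  proof -
    have "(FS m has_derivative (\<lambda>h. \<Sum>j<m. J (c j) x *v h)) (at x)"
      unfolding FS_def using F[OF cZ] by (intro has_derivative_sum) auto
    moreover have "(\<Sum>j<m. J (c j) x *v h) = JS m x *v h" for h
      unfolding JS_def by (induction m) (simp_all add: matrix_vector_mult_add_rdistrib)
    ultimately show ?thesis by simp
  qed
  have FSV: "norm (FS m x) \<le> S m x * sqrt (2 * V x)" for m x
    unfolding FS_def S_def sum_distrib_right using FV[OF cZ] by (intro sum_norm_le) auto
  have qd: "(q m has_derivative (\<lambda>h. (- (real m)\<^sup>2 / (1 + real m * S m x)\<^sup>2 * (gS m x \<bullet> h)))) (at x)" for m x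
    unfolding q_def using den[of m x]
    by (auto intro!: derivative_eq_intros Sd simp: power2_eq_square field_simps)
  define w where "w = (\<lambda>m x. q m x *\<^sub>R FS m x)"
  define K where "K = (\<lambda>m x. q m x *\<^sub>R JS m x + (\<chi> k l. FS m x $ k * ((- (real m)\<^sup>2 / (1 + real m * S m x)\<^sup>2) *\<^sub>R gS m x) $ l))"
  have Sc: "continuous_on UNIV (S m)" for m
    by (rule has_derivative_continuous_on_UNIV[OF Sd])
  have FSc: "continuous_on UNIV (FS m)" for m
    by (rule has_derivative_continuous_on_UNIV[OF FSd])
  have JSc: "continuous_on UNIV (JS m)" for m unfolding JS_def using J[OF cZ] by (intro continuous_intros)
  have gSc: "continuous_on UNIV (gS m)" for m unfolding gS_def using g[OF cZ] by (intro continuous_intros)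
  have qc: "continuous_on UNIV (q m)" for m
    unfolding q_def using den by (intro continuous_intros Sc) (metis less_irrefl)
  have P1: "P m x \<le> 1" for m x using den[of m x] S0[of m x] by (simp add: P_def q_def)
  show thesis
  proof (rule that[of w K P])
    fix m x
    show "(w m has_derivative (\<lambda>h. K m x *v h)) (at x)"
    proof -
      have "(w m has_derivative (\<lambda>h. q m x *\<^sub>R (JS m x *v h) + (- (real m)\<^sup>2 / (1 + real m * S m x)\<^sup>2 * (gS m x \<bullet> h)) *\<^sub>R FS m x)) (at x)"
        unfolding w_def by (rule has_derivative_scaleR[OF qd FSd])
      then show ?thesis
        unfolding K_def matrix_vector_mult_add_rdistrib outer_product_vector by (simp add: scaleR_matrix_vector_assoc)
    qed
    show "continuous_on UNIV (K m)"
      unfolding K_def using den by (intro continuous_intros qc JSc FSc gSc Sc) (metis less_irrefl zero_eq_power2)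
    have "closure {x. w m x \<noteq> 0} \<subseteq> (\<Union>j<m. closure {x. F (c j) x \<noteq> 0})"
    proof (rule closure_minimal)
      show "{x. w m x \<noteq> 0} \<subseteq> (\<Union>j<m. closure {x. F (c j) x \<noteq> 0})"
      proof
        fix x assume "x \<in> {x. w m x \<noteq> 0}"
        then have "FS m x \<noteq> 0" by (auto simp: w_def)
        then obtain j where "j < m" "F (c j) x \<noteq> 0" unfolding FS_def by (meson lessThan_iff sum.neutral)
        then show "x \<in> (\<Union>j<m. closure {x. F (c j) x \<noteq> 0})" using closure_subset[of "{x. F (c j) x \<noteq> 0}"] by auto
      qed
    qed auto
    moreover have "compact (\<Union>j<m. closure {x. F (c j) x \<noteq> 0})" using Fc[OF cZ] by (intro compact_UN) auto
    ultimately show "compact (closure {x. w m x \<noteq> 0})"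
      by (meson bounded_subset closed_closure compact_eq_bounded_closed)
    have "norm (w m x) \<le> q m x * (S m x * sqrt (2 * V x))"
      unfolding w_def using q0[of m x] FSV[of m x] by (simp add: mult_left_mono)
    also have "\<dots> = P m x * sqrt (2 * V x)" by (simp add: P_def)
    also have "\<dots> \<le> 1 * sqrt (2 * V x)" using P1 nn by (intro mult_right_mono) auto
    finally have "(norm (w m x))\<^sup>2 \<le> (sqrt (2 * V x))\<^sup>2" by (intro power_mono) auto
    then show "(norm (w m x))\<^sup>2 \<le> 2 * V x" using nn[of x] by simp
    show "0 \<le> P m x" using q0 S0 by (simp add: P_def)
    show "P m x \<le> 1" by (rule P1)
    show "continuous_on UNIV (P m)" unfolding P_def by (intro continuous_intros qc Sc)
    have Pm: "P m x = 1 - 1 / (1 + real m * S m x)" for m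
      using den[of m x] by (simp add: P_def q_def field_simps)
    have Smono: "S m x \<le> S m' x" if "m \<le> m'" for m m'
      unfolding S_def using that \<beta>0[OF cZ] by (intro sum_mono2) auto
    show "incseq (\<lambda>m. P m x)"
    proof (intro monoI)
      fix m m' :: nat assume "m \<le> m'"
      then have "real m * S m x \<le> real m' * S m' x" using S0 Smono by (intro mult_mono) auto
      then show "P m x \<le> P m' x" unfolding Pm using den[of m x] den[of m' x] by (intro diff_mono frac_le) auto
    qed
    assume Vx: "V x = 0"
    \<comment> \<open>All local fields vanish at a zero of \<open>V\<close>, so the gradient of
      \<open>q\<close> drops out of the divergence there.\<close>
    have "F (c j) x = 0" for j using FV[OF cZ, of j x] Vx by simp
    then have "FS m x = 0" by (simp add: FS_def)
    then have "trace (K m x) = q m x * trace (JS m x)"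
      by (simp add: K_def trace_add trace_scaleR) (simp add: trace_def)
    also have "trace (JS m x) = (\<Sum>j<m. trace (J (c j) x))"
      unfolding JS_def by (induction m) (simp_all add: trace_add, simp add: trace_def)
    also have "q m x * (\<Sum>j<m. trace (J (c j) x)) \<ge> q m x * (\<Sum>j<m. \<beta> (c j) x * (trace (psd_sqrt (hessian V x)) - \<eta>))"
      using JT[OF cZ Vx] q0 by (intro mult_left_mono sum_mono) auto
    finally show "P m x * (trace (psd_sqrt (hessian V x)) - \<eta>) \<le> trace (K m x)"
      by (simp add: P_def S_def sum_distrib_right mult.assoc)
    obtain j where j: "0 < \<beta> (c j) x" using ccov[OF Vx] by blast
    have lower: "real m * \<beta> (c j) x \<le> 1 + real m * S m x" if "m > j" for m
    proof -
      have "\<beta> (c j) x \<le> S m x" unfolding S_def using that \<beta>0[OF cZ] by (intro member_le_sum) auto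
      then show ?thesis by (simp add: mult_left_mono add_increasing)
    qed
    have "filterlim (\<lambda>m. real m * \<beta> (c j) x) at_top sequentially"
      using j by (intro filterlim_at_top_mult_tendsto_pos[OF tendsto_const _ filterlim_real_sequentially, of "\<beta> (c j) x", simplified mult.commute]) auto
    then have "filterlim (\<lambda>m. 1 + real m * S m x) at_top sequentially"
      by (rule filterlim_at_top_mono) (use lower in \<open>auto intro: eventually_mono[OF eventually_gt_at_top[of j]]\<close>)
    from tendsto_divide_0[OF tendsto_const filterlim_at_top_imp_at_infinity[OF this], of 1]
    have "(\<lambda>m. 1 - 1 / (1 + real m * S m x)) \<longlonglongrightarrow> 1 - 0" by (intro tendsto_intros)
    then show "(\<lambda>m. P m x) \<longlonglongrightarrow> 1" by (simp add: Pm)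
  qed
qed

section \<open>Mass measures and concentration on the zero set\<close>

lemma
  fixes \<psi> :: "real^'n::finite \<Rightarrow> 'k::{real_normed_field,euclidean_space}"
  assumes \<psi>: "\<psi> \<in> H1"
  shows sets_mass_measure: "sets (mass_measure \<psi>) = sets borel"
    and integral_mass_measure: "\<And>f :: real^'n \<Rightarrow> real. f \<in> borel_measurable borel \<Longrightarrow> (LINT x|mass_measure \<psi>. f x) = (LINT x|lborel. f x * (norm (\<psi> x))\<^sup>2)"
    and prob_space_mass_measure: "(LINT x|lborel. (norm (\<psi> x))\<^sup>2) = 1 \<Longrightarrow> prob_space (mass_measure \<psi>)"
proof -
  have m[measurable]: "\<psi> \<in> borel_measurable borel" and i: "integrable lborel (\<lambda>x. (norm (\<psi> x))\<^sup>2)" using \<psi> by (auto simp: H1_def)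
  show "sets (mass_measure \<psi>) = sets borel" by (simp add: mass_measure_def)
  show "(LINT x|mass_measure \<psi>. f x) = (LINT x|lborel. f x * (norm (\<psi> x))\<^sup>2)" if "f \<in> borel_measurable borel" for f :: "real^'n \<Rightarrow> real"
    unfolding mass_measure_def using that by (subst integral_density) (auto simp: mult.commute)
  assume "(LINT x|lborel. (norm (\<psi> x))\<^sup>2) = 1"
  then have "emeasure (mass_measure \<psi>) (space (mass_measure \<psi>)) = 1"
    using nn_integral_eq_integral[OF i] by (simp add: mass_measure_def emeasure_density)
  then show "prob_space (mass_measure \<psi>)" by (rule prob_spaceI)
qed

text \<open>The energy bound forces the integral of V |\<psi>|^2 to be O(\<epsilon>^(1/2)).
  Multiplying \<open>V\<close> by the tent function of radius \<open>R\<close> makes it admissible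
  for weak convergence, and countably many radii exhaust the space.\<close>

lemma limit_not_in_positive_set:
  fixes V :: "real^'n::finite \<Rightarrow> real" and \<psi> :: "nat \<Rightarrow> real^'n \<Rightarrow> 'k::{real_normed_field,euclidean_space}"
  assumes V: "continuous_on UNIV V" and nn: "\<And>x. 0 \<le> V x"
    and \<epsilon>: "\<And>n. 0 < \<epsilon> n" "\<epsilon> \<longlonglongrightarrow> 0" and \<psi>: "\<And>n. \<psi> n \<in> H1"
    and bd: "\<forall>\<^sub>F n in sequentially. energy V (\<epsilon> n) (\<psi> n) \<le> ennreal C"
    and \<gamma>: "sets \<gamma> = sets borel" "emeasure \<gamma> UNIV \<le> 1" and conv: "weakly_converges (\<lambda>n. mass_measure (\<psi> n)) \<gamma> sequentially"
  shows "AE x in \<gamma>. V x = 0"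
proof -
  have fin: "finite_measure \<gamma>"
    using \<gamma> sets_eq_imp_space_eq[OF \<gamma>(1)] by (intro finite_measureI) (auto simp: top_unique)
  have Vm[measurable]: "V \<in> borel_measurable borel" using V by (rule borel_measurable_continuous_onI)
  have main: "AE x in \<gamma>. max 0 (R - norm x) * V x = 0" if R: "R > 0" for R
  proof -
    define f where "f = (\<lambda>x. max 0 (R - norm x) * V x)"
    have f0: "0 \<le> f x" for x using nn by (simp add: f_def)
    have fR: "f x \<le> R * V x" for x unfolding f_def using nn R by (intro mult_right_mono) auto
    have fc: "continuous_on UNIV f" unfolding f_def by (intro continuous_intros V)
    have "closure {x. f x \<noteq> 0} \<subseteq> cball 0 R"
      by (intro closure_minimal) (auto simp: f_def max_def split: if_splits)
    then have fcs: "compactly_supported f" unfolding compactly_supported_def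
      by (meson bounded_cball bounded_subset closed_closure compact_eq_bounded_closed)
    have fm[measurable]: "f \<in> borel_measurable borel" using fc by (rule borel_measurable_continuous_onI)
    obtain B where B: "\<And>x. \<bar>f x\<bar> \<le> B" using compactly_supported_bounded[OF fc fcs] by blast
    have bound: "(LINT x|mass_measure (\<psi> n). f x) \<le> R * (\<epsilon> n powr (1/2) * max 0 C)" if en: "energy V (\<epsilon> n) (\<psi> n) \<le> ennreal C" for n
    proof -
      have [measurable]: "\<psi> n \<in> borel_measurable borel" using \<psi>[of n] by (auto simp: H1_def)
      define a where "a = \<epsilon> n powr (1/2)"
      have a: "a > 0" "\<epsilon> n powr (-1/2) = 1 / a" using \<epsilon>(1)[of n] by (auto simp: a_def powr_minus_divide)
      have "(\<integral>\<^sup>+x. ennreal (f x * (norm (\<psi> n x))\<^sup>2) \<partial>lborel) \<le> (\<integral>\<^sup>+x. ennreal (R * a) * ennreal (1 / a * V x * (norm (\<psi> n x))\<^sup>2) \<partial>lborel)"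
      proof (intro nn_integral_mono)
        fix x
        have "f x * (norm (\<psi> n x))\<^sup>2 \<le> (R * a) * (1 / a * V x * (norm (\<psi> n x))\<^sup>2)"
          using a(1) mult_right_mono[OF fR[of x], of "(norm (\<psi> n x))\<^sup>2"] by simp
        then show "ennreal (f x * (norm (\<psi> n x))\<^sup>2) \<le> ennreal (R * a) * ennreal (1 / a * V x * (norm (\<psi> n x))\<^sup>2)"
          using a(1) R nn[of x] by (simp add: ennreal_mult[symmetric] ennreal_leI)
      qed
      also have "\<dots> = ennreal (R * a) * (\<integral>\<^sup>+x. ennreal (1 / a * V x * (norm (\<psi> n x))\<^sup>2) \<partial>lborel)"
        by (rule nn_integral_cmult) simp
      also have "\<dots> \<le> ennreal (R * a) * energy V (\<epsilon> n) (\<psi> n)"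
        unfolding energy_def a(2) using a(1) nn by (intro mult_left_mono nn_integral_mono ennreal_leI) auto
      also have "\<dots> \<le> ennreal (R * a) * ennreal C"
        using en by (intro mult_left_mono) auto
      \<comment> \<open>\<open>ennreal C\<close> is 0 for negative \<open>C\<close>, hence the
        maximum.\<close>
      also have "\<dots> \<le> ennreal (R * a * max 0 C)" using R a(1) by (cases "C \<ge> 0") (auto simp: ennreal_mult ennreal_neg max_def)
      finally have le: "(\<integral>\<^sup>+x. ennreal (f x * (norm (\<psi> n x))\<^sup>2) \<partial>lborel) \<le> ennreal (R * a * max 0 C)" .
      have "(LINT x|lborel. f x * (norm (\<psi> n x))\<^sup>2) = enn2real (\<integral>\<^sup>+x. ennreal (f x * (norm (\<psi> n x))\<^sup>2) \<partial>lborel)"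
        using f0 by (intro integral_eq_nn_integral) auto
      also have "\<dots> \<le> R * a * max 0 C"
        using le R a(1) by (intro enn2real_leI) auto
      finally show ?thesis by (simp add: integral_mass_measure[OF \<psi>] a_def mult.assoc)
    qed
    have "(\<lambda>n. \<epsilon> n powr (1/2)) \<longlonglongrightarrow> 0"
      using tendsto_powr'[OF \<epsilon>(2) tendsto_const[of "1/2"]] \<epsilon>(1) by (auto simp: less_imp_le)
    then have "(\<lambda>n. R * (\<epsilon> n powr (1/2) * max 0 C)) \<longlonglongrightarrow> R * (0 * max 0 C)" by (intro tendsto_intros)
    moreover have "(\<lambda>n. LINT x|mass_measure (\<psi> n). f x) \<longlonglongrightarrow> (LINT x|\<gamma>. f x)"
      using conv fc fcs by (auto simp: weakly_converges_def)
    ultimately have "(LINT x|\<gamma>. f x) \<le> R * (0 * max 0 C)"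
      by (intro tendsto_le[OF _ _ _ eventually_mono[OF bd bound]]) auto
    moreover have "0 \<le> (LINT x|\<gamma>. f x)" using f0 by (intro integral_nonneg_AE) auto
    ultimately have z: "(LINT x|\<gamma>. f x) = 0" by simp
    have "f \<in> borel_measurable \<gamma>" unfolding measurable_cong_sets[OF \<gamma>(1) refl] by (rule fm)
    then have "integrable \<gamma> f"
      using B by (intro finite_measure.integrable_const_bound[OF fin, of f B] AE_I2) auto
    from integral_nonneg_eq_0_iff_AE[OF this AE_I2[OF f0]] z have "AE x in \<gamma>. f x = 0" by simp
    then show ?thesis unfolding f_def .
  qed
  have "AE x in \<gamma>. \<forall>k::nat. max 0 (real (Suc k) - norm x) * V x = 0"
    by (subst AE_all_countable) (use main[of "real (Suc _)"] in auto)
  then show ?thesis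
  proof eventually_elim
    case (elim x)
    have "norm x < real (Suc (nat \<lceil>norm x\<rceil>))" by linarith
    then show ?case using elim[rule_format, of "nat \<lceil>norm x\<rceil>"] by auto
  qed
qed

subsection \<open>The lower bound\<close>

lemma psd_sqrt_trace_nonneg_at_zero:
  fixes V :: "real^'n::finite \<Rightarrow> real"
  assumes "open U" "Ck_on 2 U V" "x \<in> U" "\<And>y. 0 \<le> V y" "V x = 0"
  shows "0 \<le> trace (psd_sqrt (hessian V x))"
  using assms by (intro trace_pos_semidef_nonneg psd_sqrt(1) hessian_psd_at_zero) auto

text \<open>For each glued field the divergence is continuous with compact support, so
  \<open>energy_lower_bound\<close> passes to the weak limit even if mass is lost. Only afterwards
  do \<open>m\<close> tend to infinity and \<eta> to 0, both under the fixed measure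
  \<gamma>.\<close>

lemma energy_liminf_inequality:
  fixes V :: "real^'n::finite \<Rightarrow> real" and \<psi> :: "nat \<Rightarrow> real^'n \<Rightarrow> 'k::{real_normed_field,euclidean_space}"
  assumes V: "continuous_on UNIV V" and nn: "\<And>x. 0 \<le> V x"
    and U: "open U" "{x. V x = 0} \<subseteq> U" and C2: "Ck_on 2 U V"
    and \<epsilon>: "\<And>n. 0 < \<epsilon> n" and \<psi>: "\<And>n. \<psi> n \<in> H1"
    and lim: "(\<lambda>n. energy V (\<epsilon> n) (\<psi> n)) \<longlonglongrightarrow> ennreal l" and l: "0 \<le> l"
    and \<gamma>: "sets \<gamma> = sets borel" "emeasure \<gamma> UNIV \<le> 1" and conv: "weakly_converges (\<lambda>n. mass_measure (\<psi> n)) \<gamma> sequentially"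
    and Z: "AE x in \<gamma>. V x = 0"
  shows "limit_energy V \<gamma> \<le> ennreal l"
proof -
  let ?T = "\<lambda>x. trace (psd_sqrt (hessian V x))"
  have sp: "space \<gamma> = UNIV" using sets_eq_imp_space_eq[OF \<gamma>(1)] by simp
  have fin: "finite_measure \<gamma>" using \<gamma> sp by (intro finite_measureI) (auto simp: top_unique)
  interpret finite_measure \<gamma> by (rule fin)
  have meas1: "measure \<gamma> UNIV \<le> 1" using \<gamma>(2) by (simp add: measure_def enn2real_leI)
  have meas_\<gamma>: "f \<in> borel_measurable \<gamma>" if "f \<in> borel_measurable borel" for f :: "real^'n \<Rightarrow> real"
    unfolding measurable_cong_sets[OF \<gamma>(1) refl] by (rule that)
  have T0: "0 \<le> ?T x" if "V x = 0" for x
    using psd_sqrt_trace_nonneg_at_zero[OF U(1) C2 _ nn that] U(2) that by blast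
  have key: "(\<integral>\<^sup>+x. ennreal (?T x) \<partial>\<gamma>) \<le> ennreal (2 * l) + ennreal \<eta>" if \<eta>: "\<eta> > 0" for \<eta>
  proof (cases "{x. V x = 0} = {}")
    case True
    then have "(\<integral>\<^sup>+x. ennreal (?T x) \<partial>\<gamma>) = (\<integral>\<^sup>+x. 0 \<partial>\<gamma>)"
      using Z by (intro nn_integral_cong_AE) auto
    then show ?thesis by simp
  next
    case False
    from lower_bound_fields[OF U C2 nn \<eta> False] obtain w J P where
      w: "\<And>m x. (w m has_derivative (\<lambda>h. J m x *v h)) (at x)" and J: "\<And>m::nat. continuous_on UNIV (J m)"
      and wc: "\<And>m. compact (closure {x. w m x \<noteq> 0})" and wV: "\<And>m x. (norm (w m x))\<^sup>2 \<le> 2 * V x"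
      and JT: "\<And>m x. V x = 0 \<Longrightarrow> P m x * (?T x - \<eta>) \<le> trace (J m x)"
      and P: "\<And>m x. 0 \<le> P m x" "\<And>m x. P m x \<le> 1" "\<And>m. continuous_on UNIV (P m)"
      and Pinc: "\<And>x. incseq (\<lambda>m. P m x)" and Plim: "\<And>x. V x = 0 \<Longrightarrow> (\<lambda>m. P m x) \<longlonglongrightarrow> 1"
      by blast
    define f where "f = (\<lambda>m x. trace (J m x))"
    have fc: "continuous_on UNIV (f m)" for m
      unfolding f_def trace_def using J by (intro continuous_intros)
    have fcs: "compactly_supported (f m)" for m
    proof -
      have "J m x = 0" if "x \<notin> closure {x. w m x \<noteq> 0}" for x
        using has_derivative_zero_outside_support[OF w that] by (simp add: fun_eq_iff matrix_eq)
      then have "f m x = 0" if "x \<notin> closure {x. w m x \<noteq> 0}" for x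
        using that by (simp add: f_def trace_def)
      then have "closure {x. f m x \<noteq> 0} \<subseteq> closure {x. w m x \<noteq> 0}"
        by (intro closure_minimal) blast+
      then show ?thesis unfolding compactly_supported_def using wc
        by (meson bounded_subset closed_closure compact_eq_bounded_closed)
    qed
    have fm: "f m \<in> borel_measurable borel" for m using fc by (rule borel_measurable_continuous_onI)
    have fi: "integrable \<gamma> (f m)" for m
    proof -
      obtain B where "\<And>x. \<bar>f m x\<bar> \<le> B" using compactly_supported_bounded[OF fc fcs] by blast
      then show ?thesis by (intro integrable_const_bound[of _ B] AE_I2 meas_\<gamma> fm) auto
    qed
    have fl: "(LINT x|\<gamma>. f m x) \<le> 2 * l" for m
    proof -
      have "(\<lambda>n. LINT x|mass_measure (\<psi> n). f m x) \<longlonglongrightarrow> (LINT x|\<gamma>. f m x)"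
        using conv fc fcs by (auto simp: weakly_converges_def)
      then have "(\<lambda>n. ennreal ((LINT x|mass_measure (\<psi> n). f m x) / 2)) \<longlonglongrightarrow> ennreal ((LINT x|\<gamma>. f m x) / 2)"
        by (intro tendsto_ennrealI tendsto_intros) auto
      moreover have "ennreal ((LINT x|mass_measure (\<psi> n). f m x) / 2) \<le> energy V (\<epsilon> n) (\<psi> n)" for n
        using energy_lower_bound[OF \<psi> \<epsilon> w J wc wV] by (simp add: integral_mass_measure[OF \<psi> fm]) (simp add: f_def)
      ultimately have "ennreal ((LINT x|\<gamma>. f m x) / 2) \<le> ennreal l"
        using LIMSEQ_le[OF _ lim] by blast
      then show ?thesis using l by (simp add: ennreal_le_iff)
    qed
    \<comment> \<open>The error \<eta> is moved to the right, where P \<le> 1 bounds it; this also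
      makes f + \<eta> nonnegative on the zero set.\<close>
    have PT: "P m x * ?T x \<le> f m x + \<eta>" if "V x = 0" for m x
    proof -
      have "P m x * \<eta> \<le> 1 * \<eta>" using P(2) \<eta> by (intro mult_right_mono) auto
      then show ?thesis using JT[OF that, of m] by (simp add: f_def algebra_simps)
    qed
    have fn: "(\<integral>\<^sup>+x. ennreal (f m x + \<eta>) \<partial>\<gamma>) \<le> ennreal (2 * l) + ennreal \<eta>" for m
    proof -
      have "AE x in \<gamma>. 0 \<le> f m x + \<eta>"
        using Z
      proof eventually_elim
        case (elim x)
        then show ?case using PT[OF elim, of m] mult_nonneg_nonneg[OF P(1)[of m x] T0[OF elim]] by linarith
      qed
      then have "(\<integral>\<^sup>+x. ennreal (f m x + \<eta>) \<partial>\<gamma>) = ennreal (LINT x|\<gamma>. f m x + \<eta>)"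
        using fi by (intro nn_integral_eq_integral) auto
      also have "(LINT x|\<gamma>. f m x + \<eta>) = (LINT x|\<gamma>. f m x) + measure \<gamma> UNIV * \<eta>"
        using fi by (simp add: sp)
      also have "\<dots> \<le> 2 * l + 1 * \<eta>" using fl meas1 \<eta> by (intro add_mono mult_right_mono) auto
      finally show ?thesis using l \<eta> by (simp add: ennreal_leI ennreal_plus[symmetric] del: ennreal_plus)
    qed
    \<comment> \<open>The integral is unfolded to its supremum over simple functions
      \<open>s\<close> below the trace. These are measurable, so monotone convergence applies to
      \<open>P m\<close> times \<open>s\<close>, whereas the trace itself is known only as a
      function.\<close>
    show ?thesis
      unfolding nn_integral_def[of \<gamma> "\<lambda>x. ennreal (?T x)"]
    proof (rule SUP_least)
      fix s assume "s \<in> {g. simple_function \<gamma> g \<and> g \<le> (\<lambda>x. ennreal (?T x))}"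
      then have s: "simple_function \<gamma> s" and sT: "\<And>x. s x \<le> ennreal (?T x)" by (auto simp: le_fun_def)
      have sm[measurable]: "s \<in> borel_measurable \<gamma>" using s by (rule borel_measurable_simple_function)
      have Pm[measurable]: "P m \<in> borel_measurable \<gamma>" for m
        by (intro meas_\<gamma> borel_measurable_continuous_onI P(3))
      have "(SUP m. ennreal (P m x) * s x) = s x" if "V x = 0" for x
      proof -
        have "incseq (\<lambda>m. ennreal (P m x))" using Pinc[of x] by (auto simp: incseq_def intro!: ennreal_leI)
        then have "(\<lambda>m. ennreal (P m x)) \<longlonglongrightarrow> (SUP m. ennreal (P m x))" by (rule LIMSEQ_SUP)
        moreover have "(\<lambda>m. ennreal (P m x)) \<longlonglongrightarrow> ennreal 1" using Plim[OF that] by (rule tendsto_ennrealI)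
        ultimately have "(SUP m. ennreal (P m x)) = 1" using LIMSEQ_unique by fastforce
        then show ?thesis by (simp add: SUP_mult_right_ennreal[symmetric])
      qed
      then have "(\<integral>\<^sup>+x. s x \<partial>\<gamma>) = (\<integral>\<^sup>+x. (SUP m. ennreal (P m x) * s x) \<partial>\<gamma>)"
        using Z by (intro nn_integral_cong_AE) auto
      also have "\<dots> = (SUP m. \<integral>\<^sup>+x. ennreal (P m x) * s x \<partial>\<gamma>)"
      proof (rule nn_integral_monotone_convergence_SUP)
        show "incseq (\<lambda>m x. ennreal (P m x) * s x)"
          using Pinc by (auto simp: incseq_def le_fun_def intro!: mult_right_mono ennreal_leI)
      qed measurable
      also have "\<dots> \<le> ennreal (2 * l) + ennreal \<eta>"
      proof (rule SUP_least)
        fix m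
        have "(\<integral>\<^sup>+x. ennreal (P m x) * s x \<partial>\<gamma>) \<le> (\<integral>\<^sup>+x. ennreal (f m x + \<eta>) \<partial>\<gamma>)"
        proof (intro nn_integral_mono_AE)
          show "AE x in \<gamma>. ennreal (P m x) * s x \<le> ennreal (f m x + \<eta>)"
            using Z
          proof eventually_elim
            case (elim x)
            have "ennreal (P m x) * s x \<le> ennreal (P m x) * ennreal (?T x)" using sT by (intro mult_left_mono) auto
            also have "\<dots> = ennreal (P m x * ?T x)" using P(1) T0[OF elim] by (simp add: ennreal_mult)
            also have "\<dots> \<le> ennreal (f m x + \<eta>)" using PT[OF elim] by (rule ennreal_leI)
            finally show ?case .
          qed
        qed
        then show "(\<integral>\<^sup>+x. ennreal (P m x) * s x \<partial>\<gamma>) \<le> ennreal (2 * l) + ennreal \<eta>" using fn order_trans by blast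
      qed
      finally show "integral\<^sup>S \<gamma> s \<le> ennreal (2 * l) + ennreal \<eta>"
        by (simp add: nn_integral_eq_simple_integral[OF s])
    qed
  qed
  have "(\<integral>\<^sup>+x. ennreal (?T x) \<partial>\<gamma>) \<le> ennreal (2 * l)"
    by (rule ennreal_le_epsilon) (use key in auto)
  then have "limit_energy V \<gamma> \<le> ennreal (1/2) * ennreal (2 * l)"
    unfolding limit_energy_def by (intro mult_left_mono) auto
  also have "\<dots> = ennreal l" using l by (simp add: ennreal_mult[symmetric] del: ennreal_half)
  finally show ?thesis .
qed

text \<open>Two extractions: the first makes the energies converge to their lower limit, the second
  makes the measures converge. The inequality for the subsequence is then one for the full lower
  limit.\<close>

lemma compactness_and_liminf:
  fixes V :: "real^'n::finite \<Rightarrow> real" and \<psi> :: "nat \<Rightarrow> real^'n \<Rightarrow> 'k::{real_normed_field,euclidean_space}"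
  assumes V: "continuous_on UNIV V" and nn: "\<And>x. 0 \<le> V x"
    and U: "open U" "{x. V x = 0} \<subseteq> U" and C2: "Ck_on 2 U V"
    and \<epsilon>: "\<And>n. 0 < \<epsilon> n" "\<epsilon> \<longlonglongrightarrow> 0" and \<psi>: "\<And>n. \<psi> n \<in> H1"
    and \<psi>1: "\<And>n. (LINT x|lborel. (norm (\<psi> n x))\<^sup>2) = 1"
    and fin: "liminf (\<lambda>n. energy V (\<epsilon> n) (\<psi> n)) < \<infinity>"
  shows "\<exists>\<gamma> :: (real^'n) measure.
           sets \<gamma> = sets borel \<and> emeasure \<gamma> {x. V x > 0} = 0 \<and> emeasure \<gamma> UNIV \<le> 1 \<and>
           (\<exists>r :: nat \<Rightarrow> nat. strict_mono r \<and>
              weakly_converges (\<lambda>k. mass_measure (\<psi> (r k))) \<gamma> sequentially) \<and>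
           liminf (\<lambda>n. energy V (\<epsilon> n) (\<psi> n)) \<ge> limit_energy V \<gamma>"
proof -
  let ?E = "\<lambda>n. energy V (\<epsilon> n) (\<psi> n)"
  define l where "l = enn2real (liminf ?E)"
  have l: "liminf ?E = ennreal l" "0 \<le> l" using fin by (auto simp: l_def less_top)
  obtain r1 :: "nat \<Rightarrow> nat" where r1: "strict_mono r1" "(?E \<circ> r1) \<longlonglongrightarrow> liminf ?E"
    using liminf_subseq_lim by blast
  obtain r2 \<gamma> where r2: "strict_mono (r2 :: nat \<Rightarrow> nat)" and \<gamma>: "sets \<gamma> = sets borel" "emeasure \<gamma> UNIV \<le> 1"
    and conv: "weakly_converges (\<lambda>k. mass_measure (\<psi> (r1 (r2 k)))) \<gamma> sequentially"
    using vague_compactness[of "\<lambda>n. mass_measure (\<psi> (r1 n))"] prob_space_mass_measure[OF \<psi> \<psi>1] sets_mass_measure[OF \<psi>]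
    by blast
  define r where "r = r1 \<circ> r2"
  have r: "strict_mono r" unfolding r_def using r1(1) r2 by (rule strict_mono_o)
  have lim: "(\<lambda>k. ?E (r k)) \<longlonglongrightarrow> ennreal l"
    using LIMSEQ_subseq_LIMSEQ[OF r1(2) r2] by (simp add: l(1) r_def comp_def)
  have "\<forall>\<^sub>F k in sequentially. ?E (r k) < ennreal (l + 1)"
    by (rule order_tendstoD(2)[OF lim]) (use l(2) in \<open>simp add: ennreal_less_iff\<close>)
  then have bd: "\<forall>\<^sub>F k in sequentially. ?E (r k) \<le> ennreal (l + 1)" by eventually_elim simp
  have \<epsilon>r: "(\<lambda>k. \<epsilon> (r k)) \<longlonglongrightarrow> 0" using LIMSEQ_subseq_LIMSEQ[OF \<epsilon>(2) r] by (simp add: comp_def)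
  have conv': "weakly_converges (\<lambda>k. mass_measure (\<psi> (r k))) \<gamma> sequentially" using conv by (simp add: r_def)
  have Z: "AE x in \<gamma>. V x = 0"
    by (rule limit_not_in_positive_set[OF V nn \<epsilon>(1) \<epsilon>r \<psi> bd \<gamma> conv'])
  have "emeasure \<gamma> {x. V x > 0} = 0"
  proof (rule AE_iff_measurable[THEN iffD1, OF _ _ Z])
    have "open {x. V x > 0}" using V by (intro open_Collect_less continuous_intros)
    then show "{x. V x > 0} \<in> sets \<gamma>" by (simp add: \<gamma>(1))
    show "{x \<in> space \<gamma>. V x \<noteq> 0} = {x. V x > 0}"
      using nn sets_eq_imp_space_eq[OF \<gamma>(1)] by (auto simp: less_le)
  qed
  moreover have "limit_energy V \<gamma> \<le> ennreal l"
    by (rule energy_liminf_inequality[OF V nn U C2 \<epsilon>(1) \<psi> lim l(2) \<gamma> conv' Z])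
  ultimately show ?thesis
    using \<gamma> r conv' unfolding l(1) by (intro exI[of _ \<gamma>] conjI exI[of _ r]) simp_all
qed

subsection \<open>Compactly supported trial functions\<close>

text \<open>The gradient is a parameter, so energies of trial functions become explicit integrals
  instead of involving the chosen weak gradient.\<close>

definition C1_compact :: "(real^'n::finite \<Rightarrow> real) \<Rightarrow> (real^'n \<Rightarrow> real^'n) \<Rightarrow> bool" where
  "C1_compact f g \<longleftrightarrow> (\<forall>x. (f has_derivative (\<lambda>h. g x \<bullet> h)) (at x)) \<and> continuous_on UNIV g \<and> compactly_supported f"

lemma C1_compactD:
  assumes "C1_compact f g"
  shows "\<And>x. (f has_derivative (\<lambda>h. g x \<bullet> h)) (at x)" "continuous_on UNIV g" "compactly_supported f"
    "continuous_on UNIV f" "\<And>x. x \<notin> closure {x. f x \<noteq> 0} \<Longrightarrow> g x = 0"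
proof -
  show d: "\<And>x. (f has_derivative (\<lambda>h. g x \<bullet> h)) (at x)" and "continuous_on UNIV g" "compactly_supported f"
    using assms by (auto simp: C1_compact_def)
  show "continuous_on UNIV f" by (rule has_derivative_continuous_on_UNIV[OF d])
  show "g x = 0" if "x \<notin> closure {x. f x \<noteq> 0}" for x
    using has_derivative_zero_outside_support[OF d that] by (metis inner_eq_zero_iff)
qed

text \<open>By translation invariance every difference quotient of \<open>f\<close> has integral 0;
  dominated convergence passes to the derivative.\<close>

lemma integral_partial_derivative_zero:
  fixes f :: "real^'n::finite \<Rightarrow> real"
  assumes f: "C1_compact f g"
  shows "(LINT x|lborel. g x $ i) = 0"
proof -
  define e where "e = (axis i 1 :: real^'n)"
  note D = C1_compactD[OF f]
  have ge: "g x $ i = g x \<bullet> e" for x by (simp add: e_def inner_axis)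
  have gic: "continuous_on UNIV (\<lambda>x. g x $ i)" using D(2) by (intro continuous_intros)
  have gics: "compactly_supported (\<lambda>x. g x $ i)"
    by (rule compactly_supported_mono[OF D(3)]) (simp add: D(5))
  obtain B where B: "0 \<le> B" "\<And>x. \<bar>g x $ i\<bar> \<le> B" using compactly_supported_bounded[OF gic gics] by blast
  have "bounded (closure {x. f x \<noteq> 0})" using D(3) by (simp add: compactly_supported_def compact_imp_bounded)
  then obtain R where R: "\<And>x. x \<in> closure {x. f x \<noteq> 0} \<Longrightarrow> norm x \<le> R" by (auto simp: bounded_iff)
  have fR: "f x = 0" if "norm x > R" for x using compactly_supported_zero[of x f] R[of x] that by force
  have fi: "integrable lborel f" by (rule integrable_compactly_supported_real[OF D(4) D(3)])
  note [measurable] = borel_measurable_continuous_onI[OF D(4)] borel_measurable_continuous_onI[OF gic]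
  have der: "((\<lambda>t. f (x + t *\<^sub>R e)) has_real_derivative g (x + t *\<^sub>R e) $ i) (at t)" for x t
  proof -
    have "((\<lambda>t. f (x + t *\<^sub>R e)) has_derivative (\<lambda>s. g (x + t *\<^sub>R e) \<bullet> (s *\<^sub>R e))) (at t)"
      by (rule has_derivative_compose[OF _ D(1)]) (auto intro!: derivative_eq_intros)
    then show ?thesis by (simp add: has_field_derivative_def ge mult_commute_abs)
  qed
  define hn where "hn = (\<lambda>n. inverse (real (Suc n)))"
  have hn: "hn n > 0" "hn n \<le> 1" for n by (auto simp: hn_def inverse_le_1_iff)
  have hn0: "hn \<longlonglongrightarrow> 0" unfolding hn_def by (rule LIMSEQ_inverse_real_of_nat)
  define q where "q = (\<lambda>n x. (f (x + hn n *\<^sub>R e) - f x) / hn n)"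
  have q0: "(LINT x|lborel. q n x) = 0" for n
    unfolding q_def using fi integrable_translate_iff[of f "hn n *\<^sub>R e"] by (simp add: integral_translate)
  have "(\<lambda>n. LINT x|lborel. q n x) \<longlonglongrightarrow> (LINT x|lborel. g x $ i)"
  \<comment> \<open>Steps are at most 1, so the quotients vanish off the ball of radius R + 1;
    inside it the mean value theorem bounds them by \<open>B\<close>.\<close>
  proof (rule integral_dominated_convergence[where w = "\<lambda>x. B * indicator (cball 0 (R + 1)) x"])
    show "integrable lborel (\<lambda>x. B * indicator (cball 0 (R + 1)) x :: real)"
      by (intro integrable_mult_right integrable_real_indicator) (use emeasure_bounded_finite[OF bounded_cball, of 0 "R + 1"] in auto)
    show "AE x in lborel. (\<lambda>n. q n x) \<longlonglongrightarrow> g x $ i"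
    proof (intro AE_I2)
      fix x
      have "((\<lambda>h. (f (x + (0 + h) *\<^sub>R e) - f (x + 0 *\<^sub>R e)) / h) \<longlongrightarrow> g (x + 0 *\<^sub>R e) $ i) (at 0)"
        using der[of x 0] unfolding DERIV_def .
      moreover have "filterlim hn (at 0) sequentially"
        using hn hn0 by (intro filterlim_atI) (auto simp: less_imp_neq[symmetric])
      ultimately have "(\<lambda>n. (f (x + (0 + hn n) *\<^sub>R e) - f (x + 0 *\<^sub>R e)) / hn n) \<longlonglongrightarrow> g (x + 0 *\<^sub>R e) $ i"
        by (rule filterlim_compose)
      then show "(\<lambda>n. q n x) \<longlonglongrightarrow> g x $ i" by (simp add: q_def)
    qed
    show "AE x in lborel. norm (q n x) \<le> B * indicator (cball 0 (R + 1)) x" for n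
    proof (intro AE_I2)
      fix x
      show "norm (q n x) \<le> B * indicator (cball 0 (R + 1)) x"
      proof (cases "x \<in> cball 0 (R + 1)")
        case True
        obtain t where "f (x + hn n *\<^sub>R e) - f (x + 0 *\<^sub>R e) = (hn n - 0) * g (x + t *\<^sub>R e) $ i"
          using MVT2[of 0 "hn n" "\<lambda>t. f (x + t *\<^sub>R e)" "\<lambda>t. g (x + t *\<^sub>R e) $ i"] der hn(1)[of n] by auto
        then have "q n x = g (x + t *\<^sub>R e) $ i" using hn(1)[of n] by (simp add: q_def)
        then show ?thesis using B True by simp
      next
        case False
        then have "norm x > R + 1" by simp
        moreover have "norm (hn n *\<^sub>R e) \<le> 1" using hn[of n] by (simp add: e_def norm_axis_1)
        ultimately have "norm (x + hn n *\<^sub>R e) > R" "norm x > R"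
          using norm_triangle_ineq4[of "x + hn n *\<^sub>R e" "hn n *\<^sub>R e"] by auto
        then show ?thesis using False by (simp add: q_def fR)
      qed
    qed
  qed (auto simp: q_def)
  then show ?thesis by (simp add: q0 LIMSEQ_const_iff)
qed

lemma C1_compact_mult:
  assumes "C1_compact f g" and "\<And>x. (f' has_derivative (\<lambda>h. g' x \<bullet> h)) (at x)" "continuous_on UNIV g'"
  shows "C1_compact (\<lambda>x. f x * f' x) (\<lambda>x. f x *\<^sub>R g' x + f' x *\<^sub>R g x)"
  unfolding C1_compact_def
proof (intro conjI allI)
  note D = C1_compactD[OF assms(1)]
  show "((\<lambda>x. f x * f' x) has_derivative (\<lambda>h. (f x *\<^sub>R g' x + f' x *\<^sub>R g x) \<bullet> h)) (at x)" for x
    using has_derivative_mult[OF D(1) assms(2), of x] by (simp add: inner_add_left mult.commute)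
  show "continuous_on UNIV (\<lambda>x. f x *\<^sub>R g' x + f' x *\<^sub>R g x)"
    by (intro continuous_intros D assms(3) has_derivative_continuous_on_UNIV[OF assms(2)])
  show "compactly_supported (\<lambda>x. f x * f' x)"
    by (rule compactly_supported_mono[OF D(3)]) (drule compactly_supported_zero, simp)
qed

text \<open>The product of \<open>f\<close> with a test function is again C^1 with compact support,
  so the integral of its partial derivative is 0.\<close>

lemma C1_compact_weak_gradient:
  fixes f :: "real^'n::finite \<Rightarrow> real"
  assumes f: "C1_compact f g"
  shows "is_weak_gradient (\<lambda>x. of_real (f x) :: 'k::{real_normed_field,euclidean_space}) (\<lambda>x. \<chi> i. of_real (g x $ i))"
  unfolding is_weak_gradient_def
proof (intro conjI allI impI)
  note D = C1_compactD[OF f]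
  have of_real_c: "continuous_on UNIV (\<lambda>x. of_real (h x) :: 'k)" if "continuous_on UNIV h" for h :: "real^'n \<Rightarrow> real"
    using that by (intro continuous_intros)
  show "locally_integrable (\<lambda>x. of_real (f x) :: 'k)"
    using borel_integrable_compact[OF _ continuous_on_subset[OF of_real_c[OF D(4)]]]
    by (simp add: locally_integrable_def set_integrable_def)
  have "continuous_on UNIV (\<lambda>x. (\<chi> i. of_real (g x $ i)) :: 'k^'n)"
    using D(2) by (intro continuous_on_vec_lambda continuous_intros)
  from borel_integrable_compact[OF _ continuous_on_subset[OF this]]
  show "locally_integrable (\<lambda>x. (\<chi> i. of_real (g x $ i)) :: 'k^'n)"
    by (simp add: locally_integrable_def set_integrable_def)
  fix \<phi> :: "real^'n \<Rightarrow> real" and i assume \<phi>: "test_function \<phi>"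
  have \<phi>d: "\<phi> differentiable (at x)" for x using test_functionD(7)[OF \<phi>] by (auto simp: differentiable_def)
  have \<phi>c: "continuous_on UNIV (grad \<phi>)"
    unfolding grad_def by (intro continuous_on_vec_lambda test_functionD(4)[OF \<phi>])
  have "C1_compact (\<lambda>x. f x * \<phi> x) (\<lambda>x. f x *\<^sub>R grad \<phi> x + \<phi> x *\<^sub>R g x)"
    by (rule C1_compact_mult[OF f has_derivative_grad[OF \<phi>d] \<phi>c])
  from integral_partial_derivative_zero[OF this, of i]
  have z: "(LINT x|lborel. f x * partial_deriv i \<phi> x + \<phi> x * g x $ i) = 0" by (simp add: grad_def)
  have i1: "integrable lborel (\<lambda>x. f x * partial_deriv i \<phi> x)"
    by (intro integrable_compactly_supported_real continuous_intros D(4) test_functionD(4)[OF \<phi>] compactly_supported_mono[OF D(3)])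
      (drule compactly_supported_zero, simp)
  have i2: "integrable lborel (\<lambda>x. \<phi> x * g x $ i)"
    by (intro integrable_compactly_supported_real continuous_intros D(2) test_functionD(3)[OF \<phi>] compactly_supported_mono[OF D(3)])
      (simp add: D(5))
  have "(LINT x|lborel. partial_deriv i \<phi> x *\<^sub>R (of_real (f x) :: 'k)) = of_real (LINT x|lborel. f x * partial_deriv i \<phi> x)"
    by (subst integral_of_real[OF i1, symmetric]) (simp add: scaleR_conv_of_real mult.commute)
  also have "(LINT x|lborel. f x * partial_deriv i \<phi> x) = - (LINT x|lborel. \<phi> x * g x $ i)"
    using z i1 i2 by simp
  also have "of_real (- (LINT x|lborel. \<phi> x * g x $ i)) = - (LINT x|lborel. \<phi> x *\<^sub>R (of_real (g x $ i) :: 'k))"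
    using integral_of_real[OF i2, where 'a = 'k] by (simp add: scaleR_conv_of_real)
  finally show "(LINT x|lborel. partial_deriv i \<phi> x *\<^sub>R (of_real (f x) :: 'k)) = - (LINT x|lborel. \<phi> x *\<^sub>R (((\<chi> i. of_real (g x $ i)) :: 'k^'n) $ i))"
    by simp
qed

lemma norm_of_real_vec: "norm ((\<chi> i. of_real (v $ i)) :: 'k::{real_normed_field,euclidean_space}^'n::finite) = norm (v :: real^'n)"
  by (simp add: norm_vec_def)

lemma C1_compact_integrable:
  assumes f: "C1_compact f g" and a: "continuous_on UNIV a"
  shows "integrable lborel (\<lambda>x. a x * (f x)\<^sup>2)" "integrable lborel (\<lambda>x. a x * (norm (g x))\<^sup>2)"
proof -
  note D = C1_compactD[OF f]
  show "integrable lborel (\<lambda>x. a x * (f x)\<^sup>2)"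
    by (intro integrable_compactly_supported_real continuous_intros D(4) a compactly_supported_mono[OF D(3)])
      (drule compactly_supported_zero, simp)
  show "integrable lborel (\<lambda>x. a x * (norm (g x))\<^sup>2)"
    by (intro integrable_compactly_supported_real continuous_intros D(2) a compactly_supported_mono[OF D(3)])
      (simp add: D(5))
qed

lemma C1_compact_H1:
  fixes f :: "real^'n::finite \<Rightarrow> real"
  assumes f: "C1_compact f g"
  shows "(\<lambda>x. of_real (f x) :: 'k::{real_normed_field,euclidean_space}) \<in> H1"
  unfolding H1_def
proof (intro CollectI conjI exI)
  note D = C1_compactD[OF f]
  have "f \<in> borel_measurable borel" using D(4) by (rule borel_measurable_continuous_onI)
  then show "(\<lambda>x. of_real (f x) :: 'k) \<in> borel_measurable lborel" by simp
  show "integrable lborel (\<lambda>x. (norm (of_real (f x) :: 'k))\<^sup>2)"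
    using C1_compact_integrable(1)[OF f, of "\<lambda>x. 1"] by simp
  show "is_weak_gradient (\<lambda>x. of_real (f x) :: 'k) (\<lambda>x. \<chi> i. of_real (g x $ i))"
    by (rule C1_compact_weak_gradient[OF f])
  show "integrable lborel (\<lambda>x. (norm ((\<chi> i. of_real (g x $ i)) :: 'k^'n))\<^sup>2)"
    using C1_compact_integrable(2)[OF f, of "\<lambda>x. 1"] by (simp add: norm_of_real_vec)
qed

lemma C1_compact_energy:
  fixes f :: "real^'n::finite \<Rightarrow> real"
  assumes f: "C1_compact f g" and V: "continuous_on UNIV V" and nn: "\<And>x. 0 \<le> V x" and \<epsilon>: "\<epsilon> > 0"
  shows "energy V \<epsilon> (\<lambda>x. of_real (f x) :: 'k::{real_normed_field,euclidean_space})
    = ennreal (LINT x|lborel. \<epsilon> powr (1/2) * ((norm (g x))\<^sup>2 / 2) + \<epsilon> powr (-1/2) * V x * (f x)\<^sup>2)"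
proof -
  let ?\<psi> = "\<lambda>x. of_real (f x) :: 'k"
  note G = C1_compact_weak_gradient[OF f, where 'k = 'k]
  have "is_weak_gradient ?\<psi> (weak_gradient ?\<psi>)"
    unfolding weak_gradient_def using someI[of "is_weak_gradient ?\<psi>", OF G] .
  from weak_gradient_unique[OF this G]
  have "energy V \<epsilon> ?\<psi> = (\<integral>\<^sup>+x. ennreal (\<epsilon> powr (1/2) * ((norm (g x))\<^sup>2 / 2) + \<epsilon> powr (-1/2) * V x * (f x)\<^sup>2) \<partial>lborel)"
    unfolding energy_def by (intro nn_integral_cong_AE) (auto simp: norm_of_real_vec)
  also have "\<dots> = ennreal (LINT x|lborel. \<epsilon> powr (1/2) * ((norm (g x))\<^sup>2 / 2) + \<epsilon> powr (-1/2) * V x * (f x)\<^sup>2)"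
  proof (rule nn_integral_eq_integral)
    have "integrable lborel (\<lambda>x. (\<epsilon> powr (1/2) / 2) * (norm (g x))\<^sup>2)" "integrable lborel (\<lambda>x. (\<epsilon> powr (-1/2) * V x) * (f x)\<^sup>2)"
      by (intro C1_compact_integrable[OF f] continuous_intros V)+
    then show "integrable lborel (\<lambda>x. \<epsilon> powr (1/2) * ((norm (g x))\<^sup>2 / 2) + \<epsilon> powr (-1/2) * V x * (f x)\<^sup>2)" by simp
    show "AE x in lborel. 0 \<le> \<epsilon> powr (1/2) * ((norm (g x))\<^sup>2 / 2) + \<epsilon> powr (-1/2) * V x * (f x)\<^sup>2"
      using nn by (intro AE_I2) auto
  qed
  finally show ?thesis .
qed

section \<open>Approximate ground states of the harmonic oscillator\<close>

lemma truncated_power_has_derivative: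
  assumes "2 \<le> M"
  shows "((\<lambda>t. max 0 t ^ M) has_real_derivative real M * max 0 t ^ (M - 1)) (at t)"
proof -
  obtain k where "M = Suc (Suc k)" using assms by (metis add_2_eq_Suc le_Suc_ex)
  then show ?thesis using has_derivative_truncated_power[of k t] by simp
qed

text \<open>The trial functions \<open>(1 - z \<bullet> B z / (2 N))\<^sub>+ ^ N\<close> converge to the Gaussian \<open>exp (- z \<bullet> B z / 2)\<close>
  but have compact support; integration by parts along \<open>B z\<close> and along \<open>z\<close> gives all integrals needed.\<close>

lemma trial_function_bound:
  fixes A :: "real^'n::finite^'n"
  assumes A: "pos_semidef A" and \<eta>: "\<eta> > 0" and N: "2 \<le> N"
  obtains u g where "C1_compact u g" "0 < (LINT x|lborel. (u x)\<^sup>2)"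
    "(LINT x|lborel. (norm (g x))\<^sup>2 + (x \<bullet> (A *v x)) * (u x)\<^sup>2)
      \<le> 2 * real N / (2 * real N - 1) * (1 + real CARD('n) / (4 * real N)) * (trace (psd_sqrt A) + \<eta> * real CARD('n)) * (LINT x|lborel. (u x)\<^sup>2)"
proof -
  define S where "S = psd_sqrt A"
  have S: "pos_semidef S" "S ** S = A" using psd_sqrt[OF A] by (auto simp: S_def)
  define B where "B = S + \<eta> *\<^sub>R mat 1"
  have Bv: "B *v v = S *v v + \<eta> *\<^sub>R v" for v
    by (simp add: B_def matrix_vector_mult_add_rdistrib scaleR_matrix_vector_assoc[symmetric])
  have tB: "transpose B = B" using S(1) by (simp add: B_def pos_semidef_def transpose_def vec_eq_iff mat_def)
  have Bsym: "u \<bullet> (B *v v) = (B *v u) \<bullet> v" for u v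
    by (metis tB dot_lmul_matrix transpose_matrix_vector vector_transpose_matrix)
  have form: "v \<bullet> (B *v v) \<ge> \<eta> * (v \<bullet> v)" for v
    using S(1) by (simp add: Bv inner_add_right pos_semidef_def)
  have trB: "trace B = trace S + \<eta> * real CARD('n)"
    by (simp add: B_def trace_add trace_scaleR trace_mat_1)
  \<comment> \<open>The cross terms in (S + \<eta>)^2 are nonnegative, so the potential energy is
    controlled by |B x|^2, which integration by parts can evaluate.\<close>
  have AB: "v \<bullet> (A *v v) \<le> (norm (B *v v))\<^sup>2" for v
  proof -
    have "(norm (B *v v))\<^sup>2 = (S *v v) \<bullet> (S *v v) + 2 * \<eta> * (v \<bullet> (S *v v)) + \<eta>\<^sup>2 * (v \<bullet> v)"
      unfolding power2_norm_eq_inner Bv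
      by (simp add: inner_add_left inner_add_right inner_commute[of "S *v v" v] power2_eq_square algebra_simps)
    moreover have "(S *v v) \<bullet> (S *v v) = v \<bullet> (A *v v)"
      using pos_semidef_sym[OF S(1), of v "S *v v"] by (simp add: matrix_vector_mul_assoc S(2))
    moreover have "0 \<le> v \<bullet> (S *v v)" using S(1) by (simp add: pos_semidef_def)
    ultimately show ?thesis using \<eta> by simp
  qed
  have A0: "0 \<le> v \<bullet> (A *v v)" for v using A by (simp add: pos_semidef_def)
  let ?N = "real N"
  have N0: "?N > 0" using N by simp
  define t where "t = (\<lambda>x. 1 - (x \<bullet> (B *v x)) / (2 * ?N))"
  define p where "p = (\<lambda>x. max 0 (t x))"
  have p0: "0 \<le> p x" for x by (simp add: p_def)
  have t1: "t x \<le> 1" for x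
  proof -
    have "0 \<le> \<eta> * (x \<bullet> x)" using \<eta> by simp
    then have "0 \<le> x \<bullet> (B *v x)" using form[of x] by linarith
    then show ?thesis using N0 by (simp add: t_def)
  qed
  have p1: "p x \<le> 1" for x using t1[of x] by (simp add: p_def)
  have td: "(t has_derivative (\<lambda>h. (- (1 / ?N) *\<^sub>R (B *v x)) \<bullet> h)) (at x)" for x
  proof -
    have "((\<lambda>x. x \<bullet> (B *v x)) has_derivative (\<lambda>h. x \<bullet> (B *v h) + h \<bullet> (B *v x))) (at x)"
      by (intro has_derivative_inner has_derivative_ident bounded_linear_imp_has_derivative matrix_vector_mul_bounded_linear)
    from has_derivative_diff[OF has_derivative_const[of 1] has_derivative_mult_right[OF this, of "1 / (2 * ?N)"]]
    have "(t has_derivative (\<lambda>h. - ((x \<bullet> (B *v h) + h \<bullet> (B *v x)) / (2 * ?N)))) (at x)"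
      by (simp add: t_def)
    moreover have "- ((x \<bullet> (B *v h) + h \<bullet> (B *v x)) / (2 * ?N)) = (- (1 / ?N) *\<^sub>R (B *v x)) \<bullet> h" for h
      using N0 by (simp add: Bsym[of x h] inner_commute[of h] field_simps)
    ultimately show ?thesis by simp
  qed
  have tc: "continuous_on UNIV t" by (rule has_derivative_continuous_on_UNIV[OF td])
  have pc: "continuous_on UNIV p" unfolding p_def by (intro continuous_intros tc)
  have pd: "((\<lambda>x. p x ^ M) has_derivative (\<lambda>h. (- (real M / ?N * p x ^ (M - 1)) *\<^sub>R (B *v x)) \<bullet> h)) (at x)" if "2 \<le> M" for M x
    using has_derivative_compose[OF td truncated_power_has_derivative[OF that, unfolded has_field_derivative_def]]
    by (simp add: p_def mult_ac)
  have supp: "closure {x. p x ^ M \<noteq> 0} \<subseteq> cball 0 (sqrt (2 * ?N / \<eta>))" if "M > 0" for M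
  proof (rule closure_minimal)
    show "{x. p x ^ M \<noteq> 0} \<subseteq> cball 0 (sqrt (2 * ?N / \<eta>))"
    proof
      fix x assume "x \<in> {x. p x ^ M \<noteq> 0}"
      then have "t x > 0" using that by (auto simp: p_def max_def split: if_splits)
      then have "x \<bullet> (B *v x) \<le> 2 * ?N" using N0 by (simp add: t_def)
      then have "\<eta> * (norm x)\<^sup>2 \<le> 2 * ?N" using form[of x] by (simp add: power2_norm_eq_inner)
      then have "(norm x)\<^sup>2 \<le> 2 * ?N / \<eta>" using \<eta> by (simp add: field_simps)
      then show "x \<in> cball 0 (sqrt (2 * ?N / \<eta>))" by (simp add: real_le_rsqrt)
    qed
  qed auto
  have C1: "C1_compact (\<lambda>x. p x ^ M) (\<lambda>x. - (real M / ?N * p x ^ (M - 1)) *\<^sub>R (B *v x))" if "2 \<le> M" for M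
    unfolding C1_compact_def
  proof (intro conjI allI pd[OF that])
    show "continuous_on UNIV (\<lambda>x. - (real M / ?N * p x ^ (M - 1)) *\<^sub>R (B *v x))"
      by (intro continuous_intros pc)
    show "compactly_supported (\<lambda>x. p x ^ M)"
      unfolding compactly_supported_def using supp[of M] that
      by (meson bounded_cball bounded_subset closed_closure compact_eq_bounded_closed less_le_trans pos2)
  qed
  have int: "integrable lborel (\<lambda>x. p x ^ M * a x)" if "M > 0" "continuous_on UNIV a" for M and a :: "real^'n \<Rightarrow> real"
  proof (intro integrable_compactly_supported_real continuous_intros pc that(2))
    have "compactly_supported (\<lambda>x. p x ^ M)"
      unfolding compactly_supported_def using supp[OF that(1)]
      by (meson bounded_cball bounded_subset closed_closure compact_eq_bounded_closed)
    then show "compactly_supported (\<lambda>x. p x ^ M * a x)"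
      by (rule compactly_supported_mono) (drule compactly_supported_zero, simp)
  qed
  \<comment> \<open>The divergence of the field p^M L x integrates to 0, and the gradient of p^M is
    -(M / N) p^(M-1) B x.\<close>
  have ibp: "trace L * (LINT x|lborel. p x ^ M) = real M / ?N * (LINT x|lborel. p x ^ (M - 1) * ((B *v x) \<bullet> (L *v x)))"
    if M: "2 \<le> M" for M and L :: "real^'n^'n"
  proof -
    have "(LINT x|lborel. p x ^ M * L $ i $ i - real M / ?N * (p x ^ (M - 1) * ((B *v x) $ i * (L *v x) $ i))) = 0" for i
    proof -
      have Ld: "((\<lambda>x. (L *v x) $ i) has_derivative (\<lambda>h. (L $ i) \<bullet> h)) (at x)" for x
      proof -
        have "((\<lambda>x. (L *v x) $ i) has_derivative (\<lambda>h. (L *v h) $ i)) (at x)"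
          by (intro bounded_linear_imp_has_derivative bounded_linear_compose[OF bounded_linear_vec_nth matrix_vector_mul_bounded_linear])
        then show ?thesis by (simp add: matrix_vector_mult_def inner_vec_def)
      qed
      from integral_partial_derivative_zero[OF C1_compact_mult[OF C1[OF M] Ld continuous_on_const], of i]
      show ?thesis by (simp add: algebra_simps)
    qed
    then have "0 = (\<Sum>i\<in>UNIV. LINT x|lborel. p x ^ M * L $ i $ i - real M / ?N * (p x ^ (M - 1) * ((B *v x) $ i * (L *v x) $ i)))"
      by simp
    also have "\<dots> = (LINT x|lborel. (\<Sum>i\<in>UNIV. p x ^ M * L $ i $ i - real M / ?N * (p x ^ (M - 1) * ((B *v x) $ i * (L *v x) $ i))))"
    proof (rule Bochner_Integration.integral_sum[symmetric])
      fix i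
      have "integrable lborel (\<lambda>x. p x ^ M * L $ i $ i)" using M by (intro int continuous_intros) auto
      moreover have "integrable lborel (\<lambda>x. p x ^ (M - 1) * ((B *v x) $ i * (L *v x) $ i))" using M by (intro int continuous_intros) auto
      ultimately show "integrable lborel (\<lambda>x. p x ^ M * L $ i $ i - real M / ?N * (p x ^ (M - 1) * ((B *v x) $ i * (L *v x) $ i)))" by simp
    qed
    also have "\<dots> = (LINT x|lborel. p x ^ M * trace L - real M / ?N * (p x ^ (M - 1) * ((B *v x) \<bullet> (L *v x))))"
      by (simp only: sum_subtractf sum_distrib_left[symmetric] trace_def inner_vec_def inner_real_def)
    also have "\<dots> = (LINT x|lborel. p x ^ M * trace L) - real M / ?N * (LINT x|lborel. p x ^ (M - 1) * ((B *v x) \<bullet> (L *v x)))"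
    proof -
      have "integrable lborel (\<lambda>x. p x ^ M * trace L)" using M by (intro int continuous_intros) auto
      moreover have "integrable lborel (\<lambda>x. p x ^ (M - 1) * ((B *v x) \<bullet> (L *v x)))" using M by (intro int continuous_intros) auto
      ultimately show ?thesis by simp
    qed
    finally show ?thesis by (simp add: mult.commute)
  qed
  define a where "a = (LINT x|lborel. p x ^ (2 * N))"
  define b where "b = (LINT x|lborel. p x ^ (2 * N - 1))"
  define c where "c = (LINT x|lborel. p x ^ (2 * N - 2) * (norm (B *v x))\<^sup>2)"
  have ib: "integrable lborel (\<lambda>x. p x ^ M)" if "M > 0" for M using int[OF that, of "\<lambda>x. 1"] by simp
  \<comment> \<open>The choice L = B with exponent 2 N - 1 expresses the Dirichlet integral
    \<open>c\<close> through \<open>b\<close>.\<close>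
  have bc: "trace B * b = real (2 * N - 1) / ?N * c"
  proof -
    have e: "2 * N - 1 - 1 = 2 * N - 2" by simp
    have "2 \<le> 2 * N - 1" using N by linarith
    from ibp[OF this, of B] show ?thesis unfolding b_def c_def e power2_norm_eq_inner .
  qed
  \<comment> \<open>The choice of the identity for L with exponent 2 N, together with x . B x = 2 N
    (1 - p) where p > 0, expresses \<open>b\<close> through the mass \<open>a\<close> and closes the
    system.\<close>
  have ab: "real CARD('n) * a = 4 * ?N * (b - a)"
  proof -
    have "real CARD('n) * a = 2 * (LINT x|lborel. p x ^ (2 * N - 1) * ((B *v x) \<bullet> x))"
      using ibp[of "2 * N" "mat 1"] N N0 by (simp add: a_def trace_mat_1)
    also have "(\<lambda>x. p x ^ (2 * N - 1) * ((B *v x) \<bullet> x)) = (\<lambda>x. 2 * ?N * (p x ^ (2 * N - 1) - p x ^ (2 * N)))"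
    proof
      fix x
      have e: "p x ^ (2 * N) = p x * p x ^ (2 * N - 1)" using N by (metis Suc_diff_1 mult_pos_pos pos2 less_le_trans power_Suc)
      show "p x ^ (2 * N - 1) * ((B *v x) \<bullet> x) = 2 * ?N * (p x ^ (2 * N - 1) - p x ^ (2 * N))"
      proof (cases "t x > 0")
        case True
        then have "(B *v x) \<bullet> x = 2 * ?N * (1 - p x)" using N0 by (simp add: p_def t_def inner_commute field_simps)
        show ?thesis
          unfolding \<open>(B *v x) \<bullet> x = 2 * ?N * (1 - p x)\<close> e by (simp add: algebra_simps)
      next
        case False
        then have "p x = 0" by (simp add: p_def)
        moreover have "0 < 2 * N - 1" using N by linarith
        ultimately have "p x ^ (2 * N - 1) = 0" by (simp only: zero_power)
        then show ?thesis unfolding e by simp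
      qed
    qed
    finally show ?thesis using ib[of "2 * N - 1"] ib[of "2 * N"] N by (simp add: a_def b_def)
  qed
  have apos: "a > 0"
  proof -
    obtain r where r: "r > 0" "\<And>x. dist x 0 < r \<Longrightarrow> dist (p x) (p 0) < 1/2"
      using pc unfolding continuous_on_iff by (metis UNIV_I half_gt_zero zero_less_one)
    have p00: "p 0 = 1" by (simp add: p_def t_def)
    have "0 < (1/2) ^ (2 * N) * measure lborel (ball (0::real^'n) r)"
      using content_ball_pos[OF r(1), of "0::real^'n"] by simp
    also have "\<dots> = (LINT x|lborel. (1/2) ^ (2 * N) * indicator (ball (0::real^'n) r) x)"
      using emeasure_lborel_ball_finite[of "0::real^'n" r] by simp
    also have "\<dots> \<le> a"
      unfolding a_def
    proof (rule integral_mono)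
      show "integrable lborel (\<lambda>x. (1/2) ^ (2 * N) * indicator (ball (0::real^'n) r) x :: real)"
        using emeasure_lborel_ball_finite[of "0::real^'n" r] by (intro integrable_mult_right integrable_real_indicator) auto
      show "integrable lborel (\<lambda>x. p x ^ (2 * N))" using N by (intro ib) simp
      fix x :: "real^'n"
      show "(1/2) ^ (2 * N) * indicator (ball 0 r) x \<le> p x ^ (2 * N)"
      proof (cases "x \<in> ball 0 r")
        case True
        then have "\<bar>p x - 1\<bar> < 1/2" using r(2)[of x] p00 by (simp add: dist_real_def dist_commute)
        then have "1/2 \<le> p x" by linarith
        then have "(1/2) ^ (2 * N) \<le> p x ^ (2 * N)" by (intro power_mono) auto
        then show ?thesis using True by simp
      qed (use p0 in simp)
    qed
    finally show ?thesis .
  qed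
  define u where "u = (\<lambda>x. p x ^ N)"
  define g where "g = (\<lambda>x. - (?N / ?N * p x ^ (N - 1)) *\<^sub>R (B *v x))"
  have u2: "(u x)\<^sup>2 = p x ^ (2 * N)" for x by (simp add: u_def power_mult[symmetric] mult.commute)
  have g2: "(norm (g x))\<^sup>2 = p x ^ (2 * N - 2) * (norm (B *v x))\<^sup>2" for x
  proof -
    have e: "2 * N - 2 = (N - 1) * 2" by simp
    have "norm (g x) = p x ^ (N - 1) * norm (B *v x)" using N0 p0[of x] by (simp add: g_def)
    then show ?thesis unfolding e power_mult by (simp add: power_mult_distrib)
  qed
  show thesis
  proof (rule that[of u g])
    show "C1_compact u g" unfolding u_def g_def by (rule C1[OF N])
    show "0 < (LINT x|lborel. (u x)\<^sup>2)" using apos by (simp add: u2 a_def)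
    have "(LINT x|lborel. (norm (g x))\<^sup>2 + (x \<bullet> (A *v x)) * (u x)\<^sup>2) \<le> (LINT x|lborel. 2 * (p x ^ (2 * N - 2) * (norm (B *v x))\<^sup>2))"
    proof (rule integral_mono)
      have i1: "integrable lborel (\<lambda>x. p x ^ (2 * N - 2) * (norm (B *v x))\<^sup>2)" using N by (intro int continuous_intros) auto
      have i2: "integrable lborel (\<lambda>x. p x ^ (2 * N) * (x \<bullet> (A *v x)))" using N by (intro int continuous_intros) auto
      show "integrable lborel (\<lambda>x. (norm (g x))\<^sup>2 + (x \<bullet> (A *v x)) * (u x)\<^sup>2)"
        unfolding u2 g2 using i1 i2 by (simp add: mult.commute)
      show "integrable lborel (\<lambda>x. 2 * (p x ^ (2 * N - 2) * (norm (B *v x))\<^sup>2))" using i1 by simp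
      fix x
      \<comment> \<open>As p lies in [0, 1], lowering the exponent bounds the potential density by
        the gradient density, so the total is at most 2 \<open>c\<close>.\<close>
      have "p x ^ (2 * N) \<le> p x ^ (2 * N - 2)" using p0 p1 by (intro power_decreasing) auto
      then have "(x \<bullet> (A *v x)) * (u x)\<^sup>2 \<le> (norm (B *v x))\<^sup>2 * p x ^ (2 * N - 2)"
        unfolding u2 using AB A0 p0 by (intro mult_mono) auto
      then show "(norm (g x))\<^sup>2 + (x \<bullet> (A *v x)) * (u x)\<^sup>2 \<le> 2 * (p x ^ (2 * N - 2) * (norm (B *v x))\<^sup>2)"
        by (simp add: g2 mult.commute)
    qed
    also have "\<dots> = 2 * c" by (simp add: c_def)
    also have "\<dots> = 2 * ?N / (2 * ?N - 1) * (trace B * b)"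
      unfolding bc using N by (simp add: of_nat_diff)
    also have "b = (1 + real CARD('n) / (4 * ?N)) * a"
      using ab N0 by (simp add: field_simps)
    finally show "(LINT x|lborel. (norm (g x))\<^sup>2 + (x \<bullet> (A *v x)) * (u x)\<^sup>2)
      \<le> 2 * real N / (2 * real N - 1) * (1 + real CARD('n) / (4 * real N)) * (trace (psd_sqrt A) + \<eta> * real CARD('n)) * (LINT x|lborel. (u x)\<^sup>2)"
      by (simp add: u2 a_def trB S_def mult_ac)
  qed
qed

lemma C1_compact_cmult:
  assumes "C1_compact f g"
  shows "C1_compact (\<lambda>x. c * f x) (\<lambda>x. c *\<^sub>R g x)"
  unfolding C1_compact_def
proof (intro conjI allI)
  note D = C1_compactD[OF assms]
  show "((\<lambda>x. c * f x) has_derivative (\<lambda>h. (c *\<^sub>R g x) \<bullet> h)) (at x)" for x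
    using has_derivative_mult_right[OF D(1), of c x] by simp
  show "continuous_on UNIV (\<lambda>x. c *\<^sub>R g x)" by (intro continuous_intros D)
  show "compactly_supported (\<lambda>x. c * f x)"
    by (rule compactly_supported_mono[OF D(3)]) (drule compactly_supported_zero, simp)
qed

lemma compactly_supportedI:
  assumes "\<And>x. f x \<noteq> 0 \<Longrightarrow> x \<in> cball y r"
  shows "compactly_supported f"
proof -
  have "closure {x. f x \<noteq> 0} \<subseteq> cball y r" using assms by (intro closure_minimal) auto
  then show ?thesis unfolding compactly_supported_def
    by (meson bounded_cball bounded_subset closed_closure compact_eq_bounded_closed)
qed

lemma C1_compact_sum:
  assumes "finite I" "\<And>i. i \<in> I \<Longrightarrow> C1_compact (f i) (g i)"
  shows "C1_compact (\<lambda>x. \<Sum>i\<in>I. f i x) (\<lambda>x. \<Sum>i\<in>I. g i x)"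
  unfolding C1_compact_def
proof (intro conjI allI)
  note D = C1_compactD[OF assms(2)]
  show "((\<lambda>x. \<Sum>i\<in>I. f i x) has_derivative (\<lambda>h. (\<Sum>i\<in>I. g i x) \<bullet> h)) (at x)" for x
    unfolding inner_sum_left by (intro has_derivative_sum D(1))
  show "continuous_on UNIV (\<lambda>x. \<Sum>i\<in>I. g i x)" by (intro continuous_intros D(2))
  have "closure {x. (\<Sum>i\<in>I. f i x) \<noteq> 0} \<subseteq> (\<Union>i\<in>I. closure {x. f i x \<noteq> 0})"
  proof (rule closure_minimal)
    show "{x. (\<Sum>i\<in>I. f i x) \<noteq> 0} \<subseteq> (\<Union>i\<in>I. closure {x. f i x \<noteq> 0})"
    proof
      fix x assume "x \<in> {x. (\<Sum>i\<in>I. f i x) \<noteq> 0}"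
      then obtain i where "i \<in> I" "f i x \<noteq> 0" by (metis (mono_tags, lifting) mem_Collect_eq sum.neutral)
      then show "x \<in> (\<Union>i\<in>I. closure {x. f i x \<noteq> 0})" using closure_subset[of "{x. f i x \<noteq> 0}"] by auto
    qed
    show "closed (\<Union>i\<in>I. closure {x. f i x \<noteq> 0})" using assms(1) by auto
  qed
  moreover have "compact (\<Union>i\<in>I. closure {x. f i x \<noteq> 0})"
    using assms(1) D(3) by (intro compact_UN) (auto simp: compactly_supported_def)
  ultimately show "compactly_supported (\<lambda>x. \<Sum>i\<in>I. f i x)" unfolding compactly_supported_def
    by (meson bounded_subset closed_closure compact_eq_bounded_closed)
qed

text \<open>In \<open>trial_function_bound\<close> the prefactors tend to 1 as N grows and the shift
  \<eta> is free; both errors are tuned to \<delta> / 2 and the mass is normalized.\<close>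

lemma optimal_profile:
  fixes A :: "real^'n::finite^'n"
  assumes A: "pos_semidef A" and \<delta>: "\<delta> > 0"
  obtains u g where "C1_compact u g" "(LINT x|lborel. (u x)\<^sup>2) = 1"
    "(LINT x|lborel. (norm (g x))\<^sup>2 + (x \<bullet> (A *v x)) * (u x)\<^sup>2) \<le> trace (psd_sqrt A) + \<delta>"
proof -
  define d where "d = real CARD('n)"
  define t where "t = trace (psd_sqrt A)"
  define \<eta> where "\<eta> = \<delta> / (2 * d)"
  have d: "d > 0" by (simp add: d_def)
  have t: "t \<ge> 0" unfolding t_def by (rule trace_pos_semidef_nonneg[OF psd_sqrt(1)[OF A]])
  have \<eta>: "\<eta> > 0" "\<eta> * d = \<delta> / 2" using d \<delta> by (simp_all add: \<eta>_def)
  define b where "b = t + \<delta> / 2"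
  have b: "b > 0" using t \<delta> by (simp add: b_def)
  \<comment> \<open>The prefactor is at most 1 + (1 + d) / N, and this \<open>N\<close> makes (1 +
    d) b / N at most \<delta> / 2. The summand 2 meets the requirement 2 \<le> N.\<close>
  define N where "N = nat \<lceil>2 * (1 + d) * b / \<delta>\<rceil> + 2"
  have N: "2 \<le> N" by (simp add: N_def)
  have "2 * (1 + d) * b / \<delta> \<le> real N" unfolding N_def by linarith
  then have Nb: "(1 + d) * b / real N \<le> \<delta> / 2" using \<delta> N by (simp add: field_simps)
  obtain u g where u: "C1_compact u g" "0 < (LINT x|lborel. (u x)\<^sup>2)"
    and le: "(LINT x|lborel. (norm (g x))\<^sup>2 + (x \<bullet> (A *v x)) * (u x)\<^sup>2)
      \<le> 2 * real N / (2 * real N - 1) * (1 + d / (4 * real N)) * (t + \<eta> * d) * (LINT x|lborel. (u x)\<^sup>2)"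
    using trial_function_bound[OF A \<eta>(1) N] unfolding t_def d_def by blast
  define a where "a = (LINT x|lborel. (u x)\<^sup>2)"
  have a: "a > 0" using u(2) by (simp add: a_def)
  have n2: "real N \<ge> 2" using N by simp
  have "2 * real N / (2 * real N - 1) \<le> 1 + 1 / real N"
    using n2 by (simp add: field_simps)
  then have "2 * real N / (2 * real N - 1) * (1 + d / (4 * real N)) \<le> (1 + 1 / real N) * (1 + d / (4 * real N))"
    using d n2 by (intro mult_right_mono) auto
  also have "\<dots> \<le> 1 + (1 + d) / real N"
  proof -
    have "1 / real N \<le> 1" using n2 by simp
    then have "(1 / real N) * (d / (4 * real N)) \<le> 1 * (d / (4 * real N))" using d n2 by (intro mult_right_mono) auto
    moreover have "(1 + 1 / real N) * (1 + d / (4 * real N)) = 1 + 1 / real N + d / (4 * real N) + (1 / real N) * (d / (4 * real N))"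
    proof -
      have "(1 + X) * (1 + Y) = 1 + X + Y + X * Y" for X Y :: real by (simp add: algebra_simps)
      then show ?thesis .
    qed
    moreover have "1 + (1 + d) / real N = 1 + 1 / real N + 4 * (d / (4 * real N))" using n2 by (simp add: add_divide_distrib)
    moreover have "0 \<le> d / (4 * real N)" using d by simp
    ultimately show ?thesis by linarith
  qed
  finally have fac: "2 * real N / (2 * real N - 1) * (1 + d / (4 * real N)) \<le> 1 + (1 + d) / real N" .
  have "2 * real N / (2 * real N - 1) * (1 + d / (4 * real N)) * b \<le> (1 + (1 + d) / real N) * b"
    using fac b by (intro mult_right_mono) auto
  also have "\<dots> = b + (1 + d) * b / real N" by (simp add: distrib_right)
  also have "\<dots> \<le> t + \<delta>" using Nb b_def by linarith
  finally have fb: "2 * real N / (2 * real N - 1) * (1 + d / (4 * real N)) * b \<le> t + \<delta>" .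
  have tb: "t + \<eta> * d = b" by (simp add: b_def \<eta>(2))
  define k where "k = 1 / sqrt a"
  have k: "k\<^sup>2 = 1 / a" using a by (simp add: k_def power_divide)
  show thesis
  proof (rule that[OF C1_compact_cmult[OF u(1), of k]])
    show "(LINT x|lborel. (k * u x)\<^sup>2) = 1" using a by (simp add: power_mult_distrib k a_def)
    have "(LINT x|lborel. (norm (k *\<^sub>R g x))\<^sup>2 + x \<bullet> (A *v x) * (k * u x)\<^sup>2) = k\<^sup>2 * (LINT x|lborel. (norm (g x))\<^sup>2 + (x \<bullet> (A *v x)) * (u x)\<^sup>2)"
      by (subst integral_mult_right_zero[symmetric]) (simp add: power_mult_distrib distrib_left mult_ac)
    also have "\<dots> \<le> k\<^sup>2 * ((t + \<delta>) * a)"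
    proof (rule mult_left_mono)
      have "2 * real N / (2 * real N - 1) * (1 + d / (4 * real N)) * b * a \<le> (t + \<delta>) * a"
        using fb a by (intro mult_right_mono) auto
      then show "(LINT x|lborel. (norm (g x))\<^sup>2 + (x \<bullet> (A *v x)) * (u x)\<^sup>2) \<le> (t + \<delta>) * a"
        using le unfolding tb a_def[symmetric] by linarith
    qed simp
    also have "\<dots> = t + \<delta>" using a by (simp add: k)
    finally show "(LINT x|lborel. (norm (k *\<^sub>R g x))\<^sup>2 + x \<bullet> (A *v x) * (k * u x)\<^sup>2) \<le> trace (psd_sqrt A) + \<delta>"
      by (simp add: t_def)
  qed
qed

section \<open>Concentration at finitely many zeros\<close>

lemma integral_affine:
  fixes F :: "real^'n::finite \<Rightarrow> real"
  assumes [measurable]: "F \<in> borel_measurable borel" and s: "s > 0"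
  shows "(LINT x|lborel. F x) = s ^ CARD('n) * (LINT z|lborel. F (y + s *\<^sub>R z))"
proof -
  have "(LINT x|lborel. F x) = (LINT x|density (distr lborel borel (\<lambda>x. y + s *\<^sub>R x)) (\<lambda>_. ennreal (\<bar>s\<bar> ^ DIM(real^'n))). F x)"
    using lborel_affine[of s y] s by simp
  also have "\<dots> = (LINT x|distr lborel borel (\<lambda>x. y + s *\<^sub>R x). \<bar>s\<bar> ^ DIM(real^'n) *\<^sub>R F x)"
    using s by (intro integral_density) auto
  also have "\<dots> = (LINT z|lborel. \<bar>s\<bar> ^ DIM(real^'n) *\<^sub>R F (y + s *\<^sub>R z))"
    by (rule integral_distr) auto
  finally show ?thesis using s by simp
qed

text \<open>The rescaled profile is supported within distance s R, where s = \<epsilon>^(1/4), so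
  for small \<epsilon> it fits into any given ball and sees \<open>V\<close> only through its
  second-order expansion. The profile's defect and the Taylor error cost \<delta> / 2 each.\<close>

lemma concentrating_block:
  fixes V :: "real^'n::finite \<Rightarrow> real"
  assumes V: "continuous_on UNIV V" and nn: "\<And>x. 0 \<le> V x"
    and U: "open U" and C2: "Ck_on 2 U V" and y: "y \<in> U" "V y = 0" and \<delta>: "\<delta> > 0" and \<rho>: "\<rho> > 0"
  shows "\<forall>\<^sub>F \<epsilon> in at_right 0. \<exists>f g. C1_compact f g \<and> (\<forall>x. x \<notin> ball y \<rho> \<longrightarrow> f x = 0 \<and> g x = 0) \<and>
     (LINT x|lborel. (f x)\<^sup>2) = 1 \<and>
     (LINT x|lborel. \<epsilon> powr (1/2) * ((norm (g x))\<^sup>2 / 2) + \<epsilon> powr (-1/2) * V x * (f x)\<^sup>2) \<le> trace (psd_sqrt (hessian V y)) / 2 + \<delta>"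
proof -
  let ?A = "hessian V y"
  have A: "pos_semidef ?A" by (rule hessian_psd_at_zero[OF U C2 y(1) nn y(2)])
  obtain u g where u: "C1_compact u g" and u1: "(LINT x|lborel. (u x)\<^sup>2) = 1"
    and le: "(LINT x|lborel. (norm (g x))\<^sup>2 + (x \<bullet> (?A *v x)) * (u x)\<^sup>2) \<le> trace (psd_sqrt ?A) + \<delta>"
    using optimal_profile[OF A \<delta>] by blast
  note D = C1_compactD[OF u]
  have "bounded (closure {x. u x \<noteq> 0})" using D(3) by (simp add: compactly_supported_def compact_imp_bounded)
  then obtain R where R0: "R > 0" and R: "\<And>x. x \<in> closure {x. u x \<noteq> 0} \<Longrightarrow> norm x \<le> R" by (auto simp: bounded_pos)
  have uR: "u x = 0 \<and> g x = 0" if "norm x > R" for x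
    using that R[of x] compactly_supported_zero[of x u] D(5)[of x] by (auto simp: not_le[symmetric])
  \<comment> \<open>On |z| \<le> R the Taylor error d |s z|^2 / 2 is then at most s^2 \<delta> /
    2.\<close>
  define d where "d = \<delta> / R\<^sup>2"
  have d: "d > 0" using \<delta> R0 by (simp add: d_def)
  obtain r where r: "r > 0" and T: "\<And>x h. x \<in> ball y r \<Longrightarrow> x + h \<in> ball y r \<Longrightarrow>
       \<bar>V (x + h) - V x - grad V x \<bullet> h - (h \<bullet> (?A *v h)) / 2\<bar> \<le> d * (norm h)\<^sup>2 / 2"
    using Taylor2[OF U C2 y(1) d] by metis
  \<comment> \<open>\<epsilon> < m^4 means s < m, which keeps s R below both radii.\<close>
  define m where "m = min r \<rho> / (R + 1)"
  have m: "m > 0" using r \<rho> R0 by (simp add: m_def)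
  have "\<forall>\<^sub>F \<epsilon> in at_right 0. \<epsilon> > 0 \<and> \<epsilon> < m ^ 4"
    using m eventually_at_right_real[of 0 "m ^ 4"] by (simp add: eventually_mono)
  then show ?thesis
  proof eventually_elim
    case (elim \<epsilon>)
    define s where "s = \<epsilon> powr (1/4)"
    have s: "s > 0" using elim by (simp add: s_def)
    have "s < (m ^ 4) powr (1/4)" unfolding s_def using elim by (intro powr_less_mono2) auto
    also have "(m ^ 4) powr (1/4) = m"
    proof -
      have "m ^ 4 = m powr 4" using powr_realpow[OF m, of 4] by simp
      then show ?thesis unfolding \<open>m ^ 4 = m powr 4\<close> powr_powr using m by simp
    qed
    finally have "s * (R + 1) < min r \<rho>" using R0 by (simp add: m_def field_simps)
    then have sR: "s * R < r" "s * R < \<rho>" using s by (auto simp: algebra_simps)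
    have e1: "\<epsilon> powr (1/2) = s\<^sup>2" by (simp add: s_def power2_eq_square flip: powr_add)
    have e2: "\<epsilon> powr (-1/2) = 1 / s\<^sup>2" using elim by (simp add: e1[symmetric] powr_minus_divide)
    \<comment> \<open>Compensates the Jacobian s^n of the rescaling, so that the mass remains
      1.\<close>
    define k where "k = 1 / sqrt (s ^ CARD('n))"
    have k: "s ^ CARD('n) * k\<^sup>2 = 1" using s by (simp add: k_def power_divide)
    define f where "f = (\<lambda>x. k * u ((1 / s) *\<^sub>R (x - y)))"
    define G where "G = (\<lambda>x. (k / s) *\<^sub>R g ((1 / s) *\<^sub>R (x - y)))"
    have out: "f x = 0 \<and> G x = 0" if "dist y x > s * R" for x
    proof -
      have "norm ((1 / s) *\<^sub>R (x - y)) = norm (x - y) / s" unfolding norm_scaleR using s by simp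
      also have "\<dots> > R" using that s by (simp add: dist_norm norm_minus_commute pos_less_divide_eq mult.commute)
      finally have "norm ((1 / s) *\<^sub>R (x - y)) > R" .
      then show ?thesis using uR by (simp add: f_def G_def)
    qed
    have C1: "C1_compact f G"
      unfolding C1_compact_def
    proof (intro conjI allI)
      fix x
      have "((\<lambda>x. u ((1 / s) *\<^sub>R (x - y))) has_derivative (\<lambda>h. g ((1 / s) *\<^sub>R (x - y)) \<bullet> ((1 / s) *\<^sub>R h))) (at x)"
        by (rule has_derivative_compose[OF _ D(1)]) (auto intro!: derivative_eq_intros)
      from has_derivative_mult_right[OF this, of k]
      show "(f has_derivative (\<lambda>h. G x \<bullet> h)) (at x)" by (simp add: f_def G_def)
      show "continuous_on UNIV G" unfolding G_def
        by (intro continuous_intros continuous_on_compose2[OF D(2)]) auto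
      show "compactly_supported f"
        by (rule compactly_supportedI[of f y "s * R"]) (use out in force)
    qed
    note DF = C1_compactD[OF C1]
    have fm[measurable]: "f \<in> borel_measurable borel" using DF(4) by (rule borel_measurable_continuous_onI)
    have Gm[measurable]: "G \<in> borel_measurable borel" using DF(2) by (rule borel_measurable_continuous_onI)
    have Vm[measurable]: "V \<in> borel_measurable borel" using V by (rule borel_measurable_continuous_onI)
    have fz: "f (y + s *\<^sub>R z) = k * u z" "G (y + s *\<^sub>R z) = (k / s) *\<^sub>R g z" for z
      using s by (simp_all add: f_def G_def)
    have VT: "V (y + s *\<^sub>R z) / s\<^sup>2 * (u z)\<^sup>2 \<le> ((z \<bullet> (?A *v z)) / 2 + \<delta> / 2) * (u z)\<^sup>2" for z
    proof (cases "norm z \<le> R")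
      case True
      have "s * norm z \<le> s * R" using True s by simp
      then have "s * norm z < r" using sR(1) by linarith
      then have "y + s *\<^sub>R z \<in> ball y r" using s by (simp add: dist_norm)
      moreover have "y \<in> ball y r" using r by simp
      ultimately have "V (y + s *\<^sub>R z) \<le> ((s *\<^sub>R z) \<bullet> (?A *v (s *\<^sub>R z))) / 2 + d * (norm (s *\<^sub>R z))\<^sup>2 / 2"
        using abs_le_D1[OF T[of y "s *\<^sub>R z"]]
        unfolding y(2) grad_zero_at_zero[OF U C2 y(1) nn y(2)] inner_zero_left by linarith
      also have "\<dots> = s\<^sup>2 * ((z \<bullet> (?A *v z)) / 2 + d * (norm z)\<^sup>2 / 2)"
        by (simp add: matrix_vector_mult_scaleR power2_eq_square algebra_simps)
      also have "\<dots> \<le> s\<^sup>2 * ((z \<bullet> (?A *v z)) / 2 + \<delta> / 2)"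
      proof -
        have "d * (norm z)\<^sup>2 \<le> d * R\<^sup>2" using True d by (intro mult_left_mono power_mono) auto
        then have "d * (norm z)\<^sup>2 \<le> \<delta>" using R0 by (simp add: d_def)
        then show ?thesis by (intro mult_left_mono add_left_mono) auto
      qed
      finally have "V (y + s *\<^sub>R z) / s\<^sup>2 \<le> (z \<bullet> (?A *v z)) / 2 + \<delta> / 2" using s by (simp add: field_simps)
      then show ?thesis by (intro mult_right_mono) auto
    qed (use uR in simp)
    have "(LINT x|lborel. (f x)\<^sup>2) = s ^ CARD('n) * (LINT z|lborel. (k * u z)\<^sup>2)"
      using integral_affine[of "\<lambda>x. (f x)\<^sup>2" s y] s by (simp add: fz)
    also have "\<dots> = 1" using k by (simp add: power_mult_distrib u1)
    finally have f1: "(LINT x|lborel. (f x)\<^sup>2) = 1" .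
    have "(LINT x|lborel. \<epsilon> powr (1/2) * ((norm (G x))\<^sup>2 / 2) + \<epsilon> powr (-1/2) * V x * (f x)\<^sup>2)
      = s ^ CARD('n) * (LINT z|lborel. s\<^sup>2 * ((norm ((k / s) *\<^sub>R g z))\<^sup>2 / 2) + 1 / s\<^sup>2 * V (y + s *\<^sub>R z) * (k * u z)\<^sup>2)"
      using integral_affine[of "\<lambda>x. \<epsilon> powr (1/2) * ((norm (G x))\<^sup>2 / 2) + \<epsilon> powr (-1/2) * V x * (f x)\<^sup>2" s y] s
      by (simp only: fz e1 e2) simp
    also have "\<dots> = s ^ CARD('n) * (LINT z|lborel. k\<^sup>2 * ((norm (g z))\<^sup>2 / 2 + V (y + s *\<^sub>R z) / s\<^sup>2 * (u z)\<^sup>2))"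
      using s by (simp add: power_mult_distrib power_divide distrib_left mult_ac)
    also have "\<dots> = (s ^ CARD('n) * k\<^sup>2) * (LINT z|lborel. (norm (g z))\<^sup>2 / 2 + V (y + s *\<^sub>R z) / s\<^sup>2 * (u z)\<^sup>2)"
      by simp
    also have "\<dots> = (LINT z|lborel. (norm (g z))\<^sup>2 / 2 + V (y + s *\<^sub>R z) / s\<^sup>2 * (u z)\<^sup>2)" by (simp add: k)
    also have "\<dots> \<le> (LINT z|lborel. 1/2 * ((norm (g z))\<^sup>2 + (z \<bullet> (?A *v z)) * (u z)\<^sup>2) + \<delta> / 2 * (u z)\<^sup>2)"
    proof (rule integral_mono)
      have i1: "integrable lborel (\<lambda>z. (1/2) * (norm (g z))\<^sup>2)"
        by (rule C1_compact_integrable(2)[OF u]) (intro continuous_intros)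
      have Vs: "continuous_on UNIV (\<lambda>z. V (y + s *\<^sub>R z) / s\<^sup>2)"
        using s by (intro continuous_intros continuous_on_compose2[OF V]) auto
      have i2: "integrable lborel (\<lambda>z. V (y + s *\<^sub>R z) / s\<^sup>2 * (u z)\<^sup>2)"
        by (rule C1_compact_integrable(1)[OF u Vs])
      have i3: "integrable lborel (\<lambda>z. (z \<bullet> (?A *v z)) * (u z)\<^sup>2)"
        by (rule C1_compact_integrable(1)[OF u]) (intro continuous_intros)
      have i4: "integrable lborel (\<lambda>z. (\<delta> / 2) * (u z)\<^sup>2)"
        by (rule C1_compact_integrable(1)[OF u]) (intro continuous_intros)
      show "integrable lborel (\<lambda>z. (norm (g z))\<^sup>2 / 2 + V (y + s *\<^sub>R z) / s\<^sup>2 * (u z)\<^sup>2)"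
        using i1 i2 by simp
      show "integrable lborel (\<lambda>z. 1/2 * ((norm (g z))\<^sup>2 + (z \<bullet> (?A *v z)) * (u z)\<^sup>2) + \<delta> / 2 * (u z)\<^sup>2)"
        using i1 i3 i4 by (simp add: distrib_left add_divide_distrib)
      show "(norm (g z))\<^sup>2 / 2 + V (y + s *\<^sub>R z) / s\<^sup>2 * (u z)\<^sup>2 \<le> 1/2 * ((norm (g z))\<^sup>2 + (z \<bullet> (?A *v z)) * (u z)\<^sup>2) + \<delta> / 2 * (u z)\<^sup>2" for z
        using VT[of z] by (simp add: algebra_simps)
    qed
    also have "\<dots> = 1/2 * (LINT z|lborel. (norm (g z))\<^sup>2 + (z \<bullet> (?A *v z)) * (u z)\<^sup>2) + \<delta> / 2"
    proof -
      have i0: "integrable lborel (\<lambda>z. 1 * (norm (g z))\<^sup>2)" by (rule C1_compact_integrable(2)[OF u]) (intro continuous_intros)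
      have i3: "integrable lborel (\<lambda>z. (z \<bullet> (?A *v z)) * (u z)\<^sup>2)"
        by (rule C1_compact_integrable(1)[OF u]) (intro continuous_intros)
      have i4: "integrable lborel (\<lambda>z. 1 * (u z)\<^sup>2)" by (rule C1_compact_integrable(1)[OF u]) (intro continuous_intros)
      have "integrable lborel (\<lambda>z. (norm (g z))\<^sup>2 + (z \<bullet> (?A *v z)) * (u z)\<^sup>2)" using i0 i3 by simp
      then have "(LINT z|lborel. 1/2 * ((norm (g z))\<^sup>2 + (z \<bullet> (?A *v z)) * (u z)\<^sup>2) + \<delta> / 2 * (u z)\<^sup>2)
        = (LINT z|lborel. 1/2 * ((norm (g z))\<^sup>2 + (z \<bullet> (?A *v z)) * (u z)\<^sup>2)) + (LINT z|lborel. \<delta> / 2 * (u z)\<^sup>2)"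
        using i4 by (intro Bochner_Integration.integral_add integrable_mult_right) auto
      then show ?thesis by (simp add: u1)
    qed
    also have "\<dots> \<le> trace (psd_sqrt ?A) / 2 + \<delta>" using le by simp
    finally have en: "(LINT x|lborel. \<epsilon> powr (1/2) * ((norm (G x))\<^sup>2 / 2) + \<epsilon> powr (-1/2) * V x * (f x)\<^sup>2) \<le> trace (psd_sqrt ?A) / 2 + \<delta>" .
    have "\<forall>x. x \<notin> ball y \<rho> \<longrightarrow> f x = 0 \<and> G x = 0" using out sR(2) by auto
    then show ?case using C1 f1 en by blast
  qed
qed

lemma norm_sum_disjoint:
  fixes v :: "'i \<Rightarrow> 'b::real_inner"
  assumes "finite I" "\<And>i j. i \<in> I \<Longrightarrow> j \<in> I \<Longrightarrow> i \<noteq> j \<Longrightarrow> v i = 0 \<or> v j = 0"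
  shows "(norm (\<Sum>i\<in>I. v i))\<^sup>2 = (\<Sum>i\<in>I. (norm (v i))\<^sup>2)"
  using assms
proof (induction I rule: finite_induct)
  case (insert i I)
  have IH: "(norm (\<Sum>i\<in>I. v i))\<^sup>2 = (\<Sum>i\<in>I. (norm (v i))\<^sup>2)" using insert by auto
  show ?case
  proof (cases "v i = 0")
    case False
    then have "v j = 0" if "j \<in> I" for j using insert.prems[of i j] insert.hyps that by auto
    then show ?thesis using insert.hyps by simp
  qed (use IH insert.hyps in simp)
qed simp

lemma finite_separation:
  fixes y :: "'i \<Rightarrow> 'a::metric_space"
  assumes "finite I" "inj_on y I"
  obtains d where "d > 0" "\<And>i j. i \<in> I \<Longrightarrow> j \<in> I \<Longrightarrow> i \<noteq> j \<Longrightarrow> d \<le> dist (y i) (y j)"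
proof -
  define S where "S = insert 1 ((\<lambda>(i, j). dist (y i) (y j)) ` {(i, j) \<in> I \<times> I. i \<noteq> j})"
  have fin: "finite S" using assms(1) by (auto simp: S_def intro: finite_subset[of _ "I \<times> I"])
  show thesis
  proof (rule that)
    have "0 < s" if "s \<in> S" for s using that assms(2) by (auto simp: S_def inj_on_def)
    then show "Min S > 0" using fin by (simp add: S_def)
    show "Min S \<le> dist (y i) (y j)" if "i \<in> I" "j \<in> I" "i \<noteq> j" for i j
      using that by (intro Min_le fin) (force simp: S_def)
  qed
qed

text \<open>Disjoint supports remove all cross terms from f^2 and |grad f|^2, so coefficients sqrt(p
  i) turn masses and energies into convex combinations. The blocks \<open>h i\<close> are exported
  in order to locate the mass of \<open>f\<close>.\<close>

lemma concentrating_combination: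
  fixes V :: "real^'n::finite \<Rightarrow> real"
  assumes V: "continuous_on UNIV V" and nn: "\<And>x. 0 \<le> V x"
    and U: "open U" and C2: "Ck_on 2 U V"
    and I: "finite (I :: nat set)" "inj_on y I" and y: "\<And>i. i \<in> I \<Longrightarrow> y i \<in> U" "\<And>i. i \<in> I \<Longrightarrow> V (y i) = 0"
    and p: "\<And>i. i \<in> I \<Longrightarrow> 0 \<le> p i" "(\<Sum>i\<in>I. p i) = 1" and \<delta>: "\<delta> > 0" and \<rho>: "\<rho> > 0"
  shows "\<forall>\<^sub>F \<epsilon> in at_right 0. \<exists>f g h. C1_compact f g \<and> (LINT x|lborel. (f x)\<^sup>2) = 1 \<and>
     (LINT x|lborel. \<epsilon> powr (1/2) * ((norm (g x))\<^sup>2 / 2) + \<epsilon> powr (-1/2) * V x * (f x)\<^sup>2) \<le> (\<Sum>i\<in>I. p i * (trace (psd_sqrt (hessian V (y i))) / 2)) + \<delta> \<and>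
     (\<forall>x. (f x)\<^sup>2 = (\<Sum>i\<in>I. p i * (h i x)\<^sup>2)) \<and>
     (\<forall>i\<in>I. continuous_on UNIV (h i) \<and> compactly_supported (h i) \<and> (LINT x|lborel. (h i x)\<^sup>2) = 1 \<and> (\<forall>x. x \<notin> ball (y i) \<rho> \<longrightarrow> h i x = 0))"
proof -
  obtain d where d: "d > 0" "\<And>i j. i \<in> I \<Longrightarrow> j \<in> I \<Longrightarrow> i \<noteq> j \<Longrightarrow> d \<le> dist (y i) (y j)"
    using finite_separation[OF I] by blast
  \<comment> \<open>Half the least distance between the centres makes the balls disjoint.\<close>
  define \<rho>' where "\<rho>' = min \<rho> (d / 2)"
  have \<rho>': "\<rho>' > 0" "\<rho>' \<le> \<rho>" "2 * \<rho>' \<le> d" using d \<rho> by (auto simp: \<rho>'_def)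
  have disj: "x \<notin> ball (y i) \<rho>' \<or> x \<notin> ball (y j) \<rho>'" if "i \<in> I" "j \<in> I" "i \<noteq> j" for i j x
  proof (rule ccontr)
    assume "\<not> ?thesis"
    then have "dist (y i) x < \<rho>'" "dist (y j) x < \<rho>'" by auto
    then have "dist (y i) (y j) < 2 * \<rho>'" using dist_triangle2[of "y i" "y j" x] by linarith
    then show False using d(2)[OF that] \<rho>' by linarith
  qed
  have "\<forall>\<^sub>F \<epsilon> in at_right 0. \<forall>i\<in>I. \<exists>f g. C1_compact f g \<and> (\<forall>x. x \<notin> ball (y i) \<rho>' \<longrightarrow> f x = 0 \<and> g x = 0) \<and>
     (LINT x|lborel. (f x)\<^sup>2) = 1 \<and>
     (LINT x|lborel. \<epsilon> powr (1/2) * ((norm (g x))\<^sup>2 / 2) + \<epsilon> powr (-1/2) * V x * (f x)\<^sup>2) \<le> trace (psd_sqrt (hessian V (y i))) / 2 + \<delta>"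
    using I(1) concentrating_block[OF V nn U C2 y \<delta> \<rho>'(1)] by (intro eventually_ball_finite) auto
  then show ?thesis
  proof eventually_elim
    case (elim \<epsilon>)
    then obtain h g where C1: "\<And>i. i \<in> I \<Longrightarrow> C1_compact (h i) (g i)"
      and z: "\<And>i x. i \<in> I \<Longrightarrow> x \<notin> ball (y i) \<rho>' \<Longrightarrow> h i x = 0 \<and> g i x = 0"
      and h1: "\<And>i. i \<in> I \<Longrightarrow> (LINT x|lborel. (h i x)\<^sup>2) = 1"
      and en: "\<And>i. i \<in> I \<Longrightarrow> (LINT x|lborel. \<epsilon> powr (1/2) * ((norm (g i x))\<^sup>2 / 2) + \<epsilon> powr (-1/2) * V x * (h i x)\<^sup>2) \<le> trace (psd_sqrt (hessian V (y i))) / 2 + \<delta>"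
      unfolding bchoice_iff by blast
    define f where "f = (\<lambda>x. \<Sum>i\<in>I. sqrt (p i) * h i x)"
    define G where "G = (\<lambda>x. \<Sum>i\<in>I. sqrt (p i) *\<^sub>R g i x)"
    have fG: "C1_compact f G"
      unfolding f_def G_def by (intro C1_compact_sum I(1) C1_compact_cmult C1)
    have f2: "(f x)\<^sup>2 = (\<Sum>i\<in>I. p i * (h i x)\<^sup>2)" for x
    proof -
      have "(norm (f x))\<^sup>2 = (\<Sum>i\<in>I. (norm (sqrt (p i) * h i x))\<^sup>2)"
        unfolding f_def
      proof (rule norm_sum_disjoint[OF I(1)])
        show "sqrt (p i) * h i x = 0 \<or> sqrt (p j) * h j x = 0" if "i \<in> I" "j \<in> I" "i \<noteq> j" for i j
          using disj[OF that, of x] z that by auto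
      qed
      then show ?thesis using p(1) by (simp add: power_mult_distrib)
    qed
    have G2: "(norm (G x))\<^sup>2 = (\<Sum>i\<in>I. p i * (norm (g i x))\<^sup>2)" for x
    proof -
      have "(norm (G x))\<^sup>2 = (\<Sum>i\<in>I. (norm (sqrt (p i) *\<^sub>R g i x))\<^sup>2)"
        unfolding G_def
      proof (rule norm_sum_disjoint[OF I(1)])
        show "sqrt (p i) *\<^sub>R g i x = 0 \<or> sqrt (p j) *\<^sub>R g j x = 0" if "i \<in> I" "j \<in> I" "i \<noteq> j" for i j
          using disj[OF that, of x] z that by auto
      qed
      then show ?thesis using p(1) by (simp add: power_mult_distrib)
    qed
    have ih: "integrable lborel (\<lambda>x. (h i x)\<^sup>2)" if "i \<in> I" for i
      using C1_compact_integrable(1)[OF C1[OF that], of "\<lambda>x. 1"] by simp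
    have "(LINT x|lborel. (f x)\<^sup>2) = (\<Sum>i\<in>I. p i * (LINT x|lborel. (h i x)\<^sup>2))"
      unfolding f2 using ih by simp
    also have "\<dots> = 1" using h1 p(2) by simp
    finally have f1: "(LINT x|lborel. (f x)\<^sup>2) = 1" .
    have ie: "integrable lborel (\<lambda>x. \<epsilon> powr (1/2) * ((norm (g i x))\<^sup>2 / 2) + \<epsilon> powr (-1/2) * V x * (h i x)\<^sup>2)" if "i \<in> I" for i
    proof -
      have "integrable lborel (\<lambda>x. (\<epsilon> powr (1/2) / 2) * (norm (g i x))\<^sup>2)" "integrable lborel (\<lambda>x. (\<epsilon> powr (-1/2) * V x) * (h i x)\<^sup>2)"
        by (intro C1_compact_integrable[OF C1[OF that]] continuous_intros V)+
      then show ?thesis by simp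
    qed
    have "(LINT x|lborel. \<epsilon> powr (1/2) * ((norm (G x))\<^sup>2 / 2) + \<epsilon> powr (-1/2) * V x * (f x)\<^sup>2)
      = (LINT x|lborel. (\<Sum>i\<in>I. p i * (\<epsilon> powr (1/2) * ((norm (g i x))\<^sup>2 / 2) + \<epsilon> powr (-1/2) * V x * (h i x)\<^sup>2)))"
      unfolding f2 G2 by (simp add: sum.distrib distrib_left sum_distrib_left sum_divide_distrib mult_ac)
    also have "\<dots> = (\<Sum>i\<in>I. p i * (LINT x|lborel. \<epsilon> powr (1/2) * ((norm (g i x))\<^sup>2 / 2) + \<epsilon> powr (-1/2) * V x * (h i x)\<^sup>2))"
      using ie by (subst Bochner_Integration.integral_sum) auto
    also have "\<dots> \<le> (\<Sum>i\<in>I. p i * (trace (psd_sqrt (hessian V (y i))) / 2 + \<delta>))"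
      using en p(1) by (intro sum_mono mult_left_mono) auto
    also have "\<dots> = (\<Sum>i\<in>I. p i * (trace (psd_sqrt (hessian V (y i))) / 2)) + \<delta>"
      using p(2) by (simp add: distrib_left sum.distrib flip: sum_distrib_right)
    finally have E: "(LINT x|lborel. \<epsilon> powr (1/2) * ((norm (G x))\<^sup>2 / 2) + \<epsilon> powr (-1/2) * V x * (f x)\<^sup>2)
      \<le> (\<Sum>i\<in>I. p i * (trace (psd_sqrt (hessian V (y i))) / 2)) + \<delta>" .
    have "\<forall>i\<in>I. continuous_on UNIV (h i) \<and> compactly_supported (h i) \<and> (LINT x|lborel. (h i x)\<^sup>2) = 1 \<and> (\<forall>x. x \<notin> ball (y i) \<rho> \<longrightarrow> h i x = 0)"
      using C1_compactD(3,4)[OF C1] h1 z \<rho>'(2) by auto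
    then show ?case using fG f1 E f2 by blast
  qed
qed

subsection \<open>Recovery sequences\<close>

lemma exists_near_infimum:
  fixes T :: "'a \<Rightarrow> real"
  assumes "S \<noteq> {}" "\<And>x. x \<in> S \<Longrightarrow> 0 \<le> T x" "e > 0"
  obtains y where "y \<in> S" "\<And>x. x \<in> S \<Longrightarrow> T y \<le> T x + e"
proof -
  have bdd: "bdd_below (T ` S)" using assms(2) by (auto simp: bdd_below_def)
  have "Inf (T ` S) < Inf (T ` S) + e" using assms(3) by simp
  from cInf_lessD[OF _ this] assms(1) obtain y where "y \<in> S" "T y < Inf (T ` S) + e" by auto
  moreover have "Inf (T ` S) \<le> T x" if "x \<in> S" for x using bdd that by (intro cInf_lower) auto
  ultimately show thesis by (intro that[of y]) force+
qed

text \<open>Finitely many balls of radius e / 2 cover the given ball; the whole space is appended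
  and the sequence made disjoint, so the last cell is the unbounded remainder.\<close>

lemma small_partition:
  fixes e R :: real
  assumes e: "e > 0"
  obtains D :: "nat \<Rightarrow> (real^'n::finite) set" and N where "\<And>i. D i \<in> sets borel" "disjoint_family D"
    "(\<Union>i\<le>N. D i) = UNIV" "\<And>i x y. i < N \<Longrightarrow> x \<in> D i \<Longrightarrow> y \<in> D i \<Longrightarrow> dist x y < e" "D N \<inter> cball 0 R = {}"
proof -
  have "cball 0 R \<subseteq> (\<Union>x\<in>cball 0 R. ball (x::real^'n) (e/2))" using e by force
  from compactE_image[OF compact_cball _ this] obtain C where C: "finite C" "cball 0 R \<subseteq> (\<Union>x\<in>C. ball (x::real^'n) (e/2))"
    by (metis open_ball)
  obtain c and N :: nat where c: "C = c ` {i. i < N}" using finite_imp_nat_seg_image_inj_on[OF C(1)] by blast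
  define A where "A = (\<lambda>i. if i < N then ball (c i) (e/2) else UNIV)"
  define D where "D = disjointed A"
  have sub: "D i \<subseteq> A i" for i unfolding D_def by (rule disjointed_subset)
  show thesis
  proof (rule that[of D N])
    have "range A \<subseteq> sets borel" by (auto simp: A_def)
    then show "D i \<in> sets borel" for i using sets.range_disjointed_sets[of A borel] by (auto simp: D_def)
    show "disjoint_family D" unfolding D_def by (rule disjoint_family_disjointed)
    have "(\<Union>i\<le>N. D i) = (\<Union>i\<in>{0..<Suc N}. A i)"
      unfolding D_def atLeast0LessThan[symmetric] lessThan_Suc_atMost[symmetric] by (rule finite_UN_disjointed_eq)
    then show "(\<Union>i\<le>N. D i) = UNIV" by (auto simp: A_def)
    show "dist x y < e" if "i < N" "x \<in> D i" "y \<in> D i" for i x y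
    proof -
      have "dist (c i) x < e / 2" "dist (c i) y < e / 2" using sub[of i] that by (auto simp: A_def)
      then show ?thesis using dist_triangle3[of x y "c i"] by linarith
    qed
    have "D N = A N - (\<Union>i\<in>{0..<N}. A i)" by (simp add: D_def disjointed_def)
    moreover have "(\<Union>x\<in>C. ball x (e/2)) = (\<Union>i\<in>{0..<N}. A i)" by (auto simp: c A_def)
    then have "cball 0 R \<subseteq> (\<Union>i\<in>{0..<N}. A i)" using C(2) by simp
    ultimately show "D N \<inter> cball 0 R = {}" by auto
  qed
qed

text \<open>Because each atom nearly minimizes \<open>T\<close> over its cell, the step function of
  the values at the atoms, lowered by \<open>e\<close>, lies below \<open>T\<close>. In the last
  estimate \<omega> accounts for the small cells and 2 B for the remainder; \<phi> is quantified
  after the atoms are chosen, so one discretization serves all test functions.\<close>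

lemma discretization:
  fixes \<gamma> :: "(real^'n::finite) measure" and T :: "real^'n \<Rightarrow> real"
  assumes \<gamma>: "prob_space \<gamma>" "sets \<gamma> = sets borel" and Z: "AE x in \<gamma>. x \<in> Z"
    and T: "\<And>x. x \<in> Z \<Longrightarrow> 0 \<le> T x" and e: "e > 0"
  obtains I y p where "finite (I :: nat set)" "inj_on y I" "\<And>i. i \<in> I \<Longrightarrow> y i \<in> Z" "\<And>i. i \<in> I \<Longrightarrow> 0 \<le> p i" "(\<Sum>i\<in>I. p i) = 1"
    "ennreal (\<Sum>i\<in>I. p i * T (y i)) \<le> (\<integral>\<^sup>+x. ennreal (T x) \<partial>\<gamma>) + ennreal e"
    "\<And>\<phi> B \<omega>. continuous_on UNIV \<phi> \<Longrightarrow> (\<And>x. \<bar>\<phi> x\<bar> \<le> B) \<Longrightarrow> (\<And>x x'. dist x x' < e \<Longrightarrow> \<bar>\<phi> x - \<phi> x'\<bar> \<le> \<omega>) \<Longrightarrow>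
       \<bar>(\<Sum>i\<in>I. p i * \<phi> (y i)) - (LINT x|\<gamma>. \<phi> x)\<bar> \<le> \<omega> + 2 * B * measure \<gamma> (- cball 0 R)"
proof -
  interpret prob_space \<gamma> by (rule \<gamma>(1))
  have sp: "space \<gamma> = UNIV" using sets_eq_imp_space_eq[OF \<gamma>(2)] by simp
  obtain D :: "nat \<Rightarrow> (real^'n) set" and N where D: "\<And>i. D i \<in> sets borel" "disjoint_family D"
    "(\<Union>i\<le>N. D i) = UNIV" "\<And>i x y. i < N \<Longrightarrow> x \<in> D i \<Longrightarrow> y \<in> D i \<Longrightarrow> dist x y < e" "D N \<inter> cball 0 R = {}"
    using small_partition[OF e, of R] by metis
  have Dm[measurable]: "D i \<in> sets \<gamma>" for i using D(1) \<gamma>(2) by simp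
  define p where "p = (\<lambda>i. measure \<gamma> (D i))"
  \<comment> \<open>A cell of positive mass must meet \<open>Z\<close>, so it has room for an
    atom.\<close>
  define I where "I = {i. i \<le> N \<and> p i \<noteq> 0}"
  have I: "finite I" by (simp add: I_def)
  have ne: "D i \<inter> Z \<noteq> {}" if "i \<in> I" for i
  proof
    assume "D i \<inter> Z = {}"
    then have "AE x in \<gamma>. x \<notin> D i" using Z by (auto elim: eventually_mono)
    then have "emeasure \<gamma> (D i) = 0" by (subst (asm) AE_iff_measurable[OF Dm[of i]]) (auto simp: sp)
    then show False using that by (simp add: I_def p_def measure_def)
  qed
  have "\<exists>y. y \<in> D i \<inter> Z \<and> (\<forall>x\<in>D i \<inter> Z. T y \<le> T x + e)" if "i \<in> I" for i
    using exists_near_infimum[OF ne[OF that], of T e] T e by (metis IntD2)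
  then obtain y where y: "\<And>i. i \<in> I \<Longrightarrow> y i \<in> D i \<inter> Z" "\<And>i x. i \<in> I \<Longrightarrow> x \<in> D i \<inter> Z \<Longrightarrow> T (y i) \<le> T x + e"
    by metis
  have uniq: "i = j" if "x \<in> D i" "x \<in> D j" for i j x
    using D(2) that by (auto simp: disjoint_family_on_def)
  have inD: "AE x in \<gamma>. \<exists>i\<in>I. x \<in> D i"
  proof -
    have "AE x in \<gamma>. x \<notin> D i" if "p i = 0" for i
      using that by (subst AE_iff_measurable[OF Dm[of i]]) (auto simp: sp p_def emeasure_eq_measure)
    then have "AE x in \<gamma>. \<forall>i\<in>{i. i \<le> N \<and> p i = 0}. x \<notin> D i"
      by (intro AE_finite_allI) auto
    then show ?thesis
    proof eventually_elim
      case (elim x)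
      obtain i where "i \<le> N" "x \<in> D i" using D(3) by blast
      then show ?case using elim by (auto simp: I_def)
    qed
  qed
  have ind: "(\<Sum>i\<in>I. a i * indicator (D i) x) = a j" if "j \<in> I" "x \<in> D j" for a :: "nat \<Rightarrow> real" and j x
  proof -
    have "(\<Sum>i\<in>I. a i * indicator (D i) x) = (\<Sum>i\<in>I. if i = j then a j else 0)"
    proof (rule sum.cong[OF refl])
      show "a i * indicator (D i) x = (if i = j then a j else 0)" for i
        using uniq[of x i j] that(2) by (cases "x \<in> D i") auto
    qed
    then show ?thesis using I that by simp
  qed
  have indi: "integrable \<gamma> (indicator (D i) :: _ \<Rightarrow> real)" for i
    by (intro integrable_real_indicator Dm) (simp add: emeasure_eq_measure)
  have int: "(LINT x|\<gamma>. (\<Sum>i\<in>I. a i * indicator (D i) x)) = (\<Sum>i\<in>I. p i * a i)" for a :: "nat \<Rightarrow> real"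
    by (subst Bochner_Integration.integral_sum) (use indi in \<open>auto simp: p_def mult.commute\<close>)
  have inti: "integrable \<gamma> (\<lambda>x. (\<Sum>i\<in>I. a i * indicator (D i) x))" for a :: "nat \<Rightarrow> real"
    using indi by (intro Bochner_Integration.integrable_sum integrable_mult_right) auto
  have p1: "(\<Sum>i\<in>I. p i) = 1"
  proof -
    have "(\<Sum>i\<in>I. p i) = (LINT x|\<gamma>. (\<Sum>i\<in>I. 1 * indicator (D i) x))" using int[of "\<lambda>_. 1"] by simp
    also have "\<dots> = (LINT x|\<gamma>. 1)"
    proof (rule integral_cong_AE)
      show "AE x in \<gamma>. (\<Sum>i\<in>I. 1 * indicator (D i) x) = (1::real)"
        using inD by eventually_elim (use ind[of _ _ "\<lambda>_. 1"] in auto)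
    qed auto
    also have "\<dots> = 1" by (simp add: prob_space)
    finally show ?thesis .
  qed
  show thesis
  proof (rule that[OF I])
    show "inj_on y I"
    proof (rule inj_onI)
      fix i j assume "i \<in> I" "j \<in> I" "y i = y j"
      then show "i = j" using y(1)[of i] y(1)[of j] by (intro uniq[of "y i"]) auto
    qed
    show "y i \<in> Z" if "i \<in> I" for i using y(1)[OF that] by simp
    show "0 \<le> p i" for i by (simp add: p_def)
    show "(\<Sum>i\<in>I. p i) = 1" by (rule p1)
    \<comment> \<open>Truncation at 0 makes the step function nonnegative; it remains below
      \<open>T\<close>, which is nonnegative on \<open>Z\<close>.\<close>
    define b where "b = (\<lambda>i. max 0 (T (y i) - e))"
    have "(\<Sum>i\<in>I. p i * T (y i)) \<le> (\<Sum>i\<in>I. p i * (b i + e))"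
      by (intro sum_mono mult_left_mono) (auto simp: b_def p_def)
    also have "\<dots> = (LINT x|\<gamma>. (\<Sum>i\<in>I. b i * indicator (D i) x)) + e"
      using p1 by (simp add: int distrib_left sum.distrib flip: sum_distrib_right)
    finally have "ennreal (\<Sum>i\<in>I. p i * T (y i)) \<le> ennreal ((LINT x|\<gamma>. (\<Sum>i\<in>I. b i * indicator (D i) x)) + e)"
      by (rule ennreal_leI)
    also have "\<dots> = ennreal (LINT x|\<gamma>. (\<Sum>i\<in>I. b i * indicator (D i) x)) + ennreal e"
      using e by (intro ennreal_plus integral_nonneg_AE AE_I2 sum_nonneg) (auto simp: b_def)
    also have "ennreal (LINT x|\<gamma>. (\<Sum>i\<in>I. b i * indicator (D i) x)) = (\<integral>\<^sup>+x. ennreal (\<Sum>i\<in>I. b i * indicator (D i) x) \<partial>\<gamma>)"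
      by (intro nn_integral_eq_integral[symmetric] inti AE_I2 sum_nonneg) (auto simp: b_def)
    also have "\<dots> \<le> (\<integral>\<^sup>+x. ennreal (T x) \<partial>\<gamma>)"
    proof (intro nn_integral_mono_AE)
      show "AE x in \<gamma>. ennreal (\<Sum>i\<in>I. b i * indicator (D i) x) \<le> ennreal (T x)"
        using inD Z
      proof eventually_elim
        case (elim x)
        then obtain j where j: "j \<in> I" "x \<in> D j" by blast
        then have "b j \<le> T x" using y(2)[OF j(1), of x] T elim(2) by (auto simp: b_def)
        then show ?case by (simp add: ind[OF j] ennreal_leI)
      qed
    qed
    finally show "ennreal (\<Sum>i\<in>I. p i * T (y i)) \<le> (\<integral>\<^sup>+x. ennreal (T x) \<partial>\<gamma>) + ennreal e"
      by (simp add: add_right_mono)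
    fix \<phi> :: "real^'n \<Rightarrow> real" and B \<omega>
    assume \<phi>: "continuous_on UNIV \<phi>" and B: "\<And>x. \<bar>\<phi> x\<bar> \<le> B" and \<omega>: "\<And>x x'. dist x x' < e \<Longrightarrow> \<bar>\<phi> x - \<phi> x'\<bar> \<le> \<omega>"
    have B0: "0 \<le> B" using B[of 0] by linarith
    have \<omega>0: "0 \<le> \<omega>" using \<omega>[of 0 0] e by simp
    have Cm[measurable]: "- cball 0 R \<in> sets \<gamma>" using \<gamma>(2) by simp
    have \<phi>m[measurable]: "\<phi> \<in> borel_measurable \<gamma>"
      unfolding measurable_cong_sets[OF \<gamma>(2) refl] using \<phi> by (rule borel_measurable_continuous_onI)
    have i\<phi>: "integrable \<gamma> \<phi>" using B by (intro integrable_const_bound[of _ B]) auto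
    have indC: "integrable \<gamma> (indicator (- cball 0 R) :: _ \<Rightarrow> real)"
      by (intro integrable_real_indicator Cm) (simp add: emeasure_eq_measure)
    then have intC: "integrable \<gamma> (\<lambda>x. \<omega> + 2 * B * indicator (- cball 0 R) x)"
      by (intro Bochner_Integration.integrable_add integrable_mult_right integrable_const)
    define s where "s = (\<lambda>x. \<Sum>i\<in>I. \<phi> (y i) * indicator (D i) x)"
    have ints: "integrable \<gamma> s" unfolding s_def by (rule inti)
    have "\<bar>(\<Sum>i\<in>I. p i * \<phi> (y i)) - (LINT x|\<gamma>. \<phi> x)\<bar> = \<bar>LINT x|\<gamma>. s x - \<phi> x\<bar>"
      using ints i\<phi> by (simp add: s_def int)
    also have "\<dots> \<le> (LINT x|\<gamma>. \<bar>s x - \<phi> x\<bar>)" by (rule integral_abs_bound)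
    also have "\<dots> \<le> (LINT x|\<gamma>. \<omega> + 2 * B * indicator (- cball 0 R) x)"
    proof (rule integral_mono_AE)
      show "integrable \<gamma> (\<lambda>x. \<bar>s x - \<phi> x\<bar>)" using ints i\<phi> by simp
      show "integrable \<gamma> (\<lambda>x. \<omega> + 2 * B * indicator (- cball 0 R) x)" by (rule intC)
      show "AE x in \<gamma>. \<bar>s x - \<phi> x\<bar> \<le> \<omega> + 2 * B * indicator (- cball 0 R) x"
        using inD
      proof eventually_elim
        case (elim x)
        then obtain j where j: "j \<in> I" "x \<in> D j" by blast
        have sx: "s x = \<phi> (y j)" unfolding s_def by (rule ind[OF j])
        show ?case
        proof (cases "j < N")
          case True
          then have "dist (y j) x < e" using D(4)[of j "y j" x] y(1)[OF j(1)] j(2) by auto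
          then have "\<bar>s x - \<phi> x\<bar> \<le> \<omega>" unfolding sx by (rule \<omega>)
          then show ?thesis using B0 by (simp add: add_increasing2)
        next
          case False
          then have "j = N" using j(1) by (simp add: I_def)
          then have "x \<notin> cball 0 R" using D(5) j(2) by auto
          moreover have "\<bar>s x - \<phi> x\<bar> \<le> 2 * B" using B[of "y j"] B[of x] unfolding sx by linarith
          ultimately show ?thesis using \<omega>0 by simp
        qed
      qed
    qed
    also have "\<dots> = \<omega> + 2 * B * measure \<gamma> (- cball 0 R)"
      using indC by (simp add: prob_space)
    finally show "\<bar>(\<Sum>i\<in>I. p i * \<phi> (y i)) - (LINT x|\<gamma>. \<phi> x)\<bar> \<le> \<omega> + 2 * B * measure \<gamma> (- cball 0 R)" .
  qed
qed

text \<open>The number \<open>e\<close> is at once mesh size, block radius and energy error. One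
  \<omega> comes from the discretization, the other from spreading each atom over a ball of radius
  \<open>e\<close>; likewise the energy error is e / 2 from the halved discretization cost plus e /
  2 from the blocks.\<close>

lemma approximate_recovery:
  fixes V :: "real^'n::finite \<Rightarrow> real" and R :: real
  assumes V: "continuous_on UNIV V" and nn: "\<And>x. 0 \<le> V x"
    and U: "open U" "{x. V x = 0} \<subseteq> U" and C2: "Ck_on 2 U V"
    and \<gamma>: "prob_space \<gamma>" "sets \<gamma> = sets borel" and Z: "AE x in \<gamma>. V x = 0" and e: "e > 0"
  shows "\<forall>\<^sub>F \<epsilon> in at_right 0. \<exists>f g. C1_compact f g \<and> (LINT x|lborel. (f x)\<^sup>2) = 1 \<and>
     ennreal (LINT x|lborel. \<epsilon> powr (1/2) * ((norm (g x))\<^sup>2 / 2) + \<epsilon> powr (-1/2) * V x * (f x)\<^sup>2) \<le> limit_energy V \<gamma> + ennreal e \<and>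
     (\<forall>\<phi> B \<omega>. continuous_on UNIV \<phi> \<longrightarrow> (\<forall>x. \<bar>\<phi> x\<bar> \<le> B) \<longrightarrow> (\<forall>x x'. dist x x' < e \<longrightarrow> \<bar>\<phi> x - \<phi> x'\<bar> \<le> \<omega>) \<longrightarrow>
       \<bar>(LINT x|lborel. \<phi> x * (f x)\<^sup>2) - (LINT x|\<gamma>. \<phi> x)\<bar> \<le> 2 * \<omega> + 2 * B * measure \<gamma> (- cball 0 R))"
proof -
  let ?T = "\<lambda>x. trace (psd_sqrt (hessian V x))"
  have T0: "0 \<le> ?T x" if "x \<in> {x. V x = 0}" for x
    using psd_sqrt_trace_nonneg_at_zero[OF U(1) C2 _ nn] U(2) that by blast
  have Z': "AE x in \<gamma>. x \<in> {x. V x = 0}" using Z by simp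
  show ?thesis
  proof (rule discretization[OF \<gamma> Z' T0 e, where R = R])
    fix I :: "nat set" and y p
    assume I: "finite I" "inj_on y I" and y: "\<And>i. i \<in> I \<Longrightarrow> y i \<in> {x. V x = 0}"
      and p: "\<And>i. i \<in> I \<Longrightarrow> 0 \<le> p i" "(\<Sum>i\<in>I. p i) = 1"
      and cost: "ennreal (\<Sum>i\<in>I. p i * ?T (y i)) \<le> (\<integral>\<^sup>+x. ennreal (?T x) \<partial>\<gamma>) + ennreal e"
      and close: "\<And>\<phi> B \<omega>. continuous_on UNIV \<phi> \<Longrightarrow> (\<And>x. \<bar>\<phi> x\<bar> \<le> B) \<Longrightarrow> (\<And>x x'. dist x x' < e \<Longrightarrow> \<bar>\<phi> x - \<phi> x'\<bar> \<le> \<omega>) \<Longrightarrow>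
         \<bar>(\<Sum>i\<in>I. p i * \<phi> (y i)) - (LINT x|\<gamma>. \<phi> x)\<bar> \<le> \<omega> + 2 * B * measure \<gamma> (- cball 0 R)"
    have yU: "y i \<in> U" "V (y i) = 0" if "i \<in> I" for i using y[OF that] U(2) by auto
    have e2: "e / 2 > 0" using e by simp
    have "\<forall>\<^sub>F \<epsilon> in at_right 0. \<exists>f g h. C1_compact f g \<and> (LINT x|lborel. (f x)\<^sup>2) = 1 \<and>
       (LINT x|lborel. \<epsilon> powr (1/2) * ((norm (g x))\<^sup>2 / 2) + \<epsilon> powr (-1/2) * V x * (f x)\<^sup>2) \<le> (\<Sum>i\<in>I. p i * (?T (y i) / 2)) + e / 2 \<and>
       (\<forall>x. (f x)\<^sup>2 = (\<Sum>i\<in>I. p i * (h i x)\<^sup>2)) \<and>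
       (\<forall>i\<in>I. continuous_on UNIV (h i) \<and> compactly_supported (h i) \<and> (LINT x|lborel. (h i x)\<^sup>2) = 1 \<and> (\<forall>x. x \<notin> ball (y i) e \<longrightarrow> h i x = 0))"
      by (rule concentrating_combination[OF V nn U(1) C2 I]) (fact yU p e2 e)+
    then show ?thesis
    proof eventually_elim
      case (elim \<epsilon>)
      then obtain f g h where f: "C1_compact f g" "(LINT x|lborel. (f x)\<^sup>2) = 1"
        and en: "(LINT x|lborel. \<epsilon> powr (1/2) * ((norm (g x))\<^sup>2 / 2) + \<epsilon> powr (-1/2) * V x * (f x)\<^sup>2) \<le> (\<Sum>i\<in>I. p i * (?T (y i) / 2)) + e / 2"
        and f2: "\<And>x. (f x)\<^sup>2 = (\<Sum>i\<in>I. p i * (h i x)\<^sup>2)"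
        and h: "\<And>i. i \<in> I \<Longrightarrow> continuous_on UNIV (h i) \<and> compactly_supported (h i) \<and> (LINT x|lborel. (h i x)\<^sup>2) = 1 \<and> (\<forall>x. x \<notin> ball (y i) e \<longrightarrow> h i x = 0)"
        by blast
      have "ennreal (LINT x|lborel. \<epsilon> powr (1/2) * ((norm (g x))\<^sup>2 / 2) + \<epsilon> powr (-1/2) * V x * (f x)\<^sup>2)
         \<le> ennreal (1/2 * (\<Sum>i\<in>I. p i * ?T (y i)) + e / 2)"
        using en by (intro ennreal_leI) (simp add: sum_divide_distrib)
      also have "\<dots> = ennreal (1/2 * (\<Sum>i\<in>I. p i * ?T (y i))) + ennreal (e / 2)"
        using e p(1) T0[OF y] by (intro ennreal_plus mult_nonneg_nonneg sum_nonneg) auto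
      also have "ennreal (1/2 * (\<Sum>i\<in>I. p i * ?T (y i))) = ennreal (1/2) * ennreal (\<Sum>i\<in>I. p i * ?T (y i))"
        using p(1) T0[OF y] by (intro ennreal_mult sum_nonneg mult_nonneg_nonneg) auto
      also have "ennreal (1/2) * ennreal (\<Sum>i\<in>I. p i * ?T (y i)) + ennreal (e / 2) \<le> ennreal (1/2) * ((\<integral>\<^sup>+x. ennreal (?T x) \<partial>\<gamma>) + ennreal e) + ennreal (e / 2)"
        using cost by (intro add_right_mono mult_left_mono) auto
      also have "\<dots> = limit_energy V \<gamma> + (ennreal (1/2) * ennreal e + ennreal (e / 2))"
        by (simp only: limit_energy_def distrib_left add.assoc)
      also have "ennreal (1/2) * ennreal e + ennreal (e / 2) = ennreal e"
      proof -
        have "ennreal (1/2) * ennreal e = ennreal (1/2 * e)" using e by (intro ennreal_mult[symmetric]) auto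
        then show ?thesis using e by (simp add: ennreal_plus[symmetric] del: ennreal_plus)
      qed
      finally have E: "ennreal (LINT x|lborel. \<epsilon> powr (1/2) * ((norm (g x))\<^sup>2 / 2) + \<epsilon> powr (-1/2) * V x * (f x)\<^sup>2) \<le> limit_energy V \<gamma> + ennreal e" .
      have W: "\<bar>(LINT x|lborel. \<phi> x * (f x)\<^sup>2) - (LINT x|\<gamma>. \<phi> x)\<bar> \<le> 2 * \<omega> + 2 * B * measure \<gamma> (- cball 0 R)"
        if \<phi>: "continuous_on UNIV \<phi>" and B: "\<And>x. \<bar>\<phi> x\<bar> \<le> B" and \<omega>: "\<And>x x'. dist x x' < e \<Longrightarrow> \<bar>\<phi> x - \<phi> x'\<bar> \<le> \<omega>" for \<phi> B \<omega>
      proof -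
        have ih: "integrable lborel (\<lambda>x. a x * (h i x)\<^sup>2)" if "i \<in> I" "continuous_on UNIV a" for i and a :: "real^'n \<Rightarrow> real"
        proof (rule integrable_compactly_supported_real)
          have hi: "continuous_on UNIV (h i)" "compactly_supported (h i)" using h[OF that(1)] by auto
          then show "continuous_on UNIV (\<lambda>x. a x * (h i x)\<^sup>2)" using that(2) by (intro continuous_intros)
          show "compactly_supported (\<lambda>x. a x * (h i x)\<^sup>2)"
            by (rule compactly_supported_mono[OF hi(2)]) (drule compactly_supported_zero, simp)
        qed
        have hi: "\<bar>(LINT x|lborel. \<phi> x * (h i x)\<^sup>2) - \<phi> (y i)\<bar> \<le> \<omega>" if i: "i \<in> I" for i
        proof -
          have i1: "integrable lborel (\<lambda>x. \<phi> x * (h i x)\<^sup>2)" "integrable lborel (\<lambda>x. \<phi> (y i) * (h i x)\<^sup>2)" "integrable lborel (\<lambda>x. \<omega> * (h i x)\<^sup>2)"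
            by (intro ih[OF i] \<phi> continuous_intros)+
          have "(LINT x|lborel. \<phi> x * (h i x)\<^sup>2) - \<phi> (y i) = (LINT x|lborel. \<phi> x * (h i x)\<^sup>2 - \<phi> (y i) * (h i x)\<^sup>2)"
            using i1 h[OF i] by simp
          also have "\<bar>\<dots>\<bar> \<le> (LINT x|lborel. \<bar>\<phi> x * (h i x)\<^sup>2 - \<phi> (y i) * (h i x)\<^sup>2\<bar>)" by (rule integral_abs_bound)
          also have "\<dots> \<le> (LINT x|lborel. \<omega> * (h i x)\<^sup>2)"
          proof (rule integral_mono)
            show "integrable lborel (\<lambda>x. \<bar>\<phi> x * (h i x)\<^sup>2 - \<phi> (y i) * (h i x)\<^sup>2\<bar>)" using i1 by (intro integrable_abs) simp
            show "\<bar>\<phi> x * (h i x)\<^sup>2 - \<phi> (y i) * (h i x)\<^sup>2\<bar> \<le> \<omega> * (h i x)\<^sup>2" for x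
            proof (cases "x \<in> ball (y i) e")
              case True
              then have "\<bar>\<phi> x - \<phi> (y i)\<bar> \<le> \<omega>" by (intro \<omega>) (simp add: dist_commute)
              then have "\<bar>\<phi> x - \<phi> (y i)\<bar> * (h i x)\<^sup>2 \<le> \<omega> * (h i x)\<^sup>2" by (intro mult_right_mono) auto
              then show ?thesis by (simp add: abs_mult flip: left_diff_distrib)
            qed (use h[OF i] in simp)
          qed (rule i1)
          also have "\<dots> = \<omega>" using h[OF i] by simp
          finally show ?thesis .
        qed
        have "(LINT x|lborel. \<phi> x * (f x)\<^sup>2) = (LINT x|lborel. (\<Sum>i\<in>I. p i * (\<phi> x * (h i x)\<^sup>2)))"
          by (simp add: f2 sum_distrib_left mult_ac)
        also have "\<dots> = (\<Sum>i\<in>I. p i * (LINT x|lborel. \<phi> x * (h i x)\<^sup>2))"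
          using ih[OF _ \<phi>] by (subst Bochner_Integration.integral_sum) auto
        finally have "(LINT x|lborel. \<phi> x * (f x)\<^sup>2) - (\<Sum>i\<in>I. p i * \<phi> (y i)) = (\<Sum>i\<in>I. p i * ((LINT x|lborel. \<phi> x * (h i x)\<^sup>2) - \<phi> (y i)))"
          by (simp add: right_diff_distrib sum_subtractf)
        also have "\<bar>\<dots>\<bar> \<le> (\<Sum>i\<in>I. \<bar>p i * ((LINT x|lborel. \<phi> x * (h i x)\<^sup>2) - \<phi> (y i))\<bar>)" by (rule sum_abs)
        also have "\<dots> \<le> (\<Sum>i\<in>I. p i * \<omega>)"
          using hi p(1) by (intro sum_mono) (simp add: abs_mult mult_left_mono)
        also have "\<dots> = \<omega>" using p(2) by (simp flip: sum_distrib_right)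
        finally have "\<bar>(LINT x|lborel. \<phi> x * (f x)\<^sup>2) - (\<Sum>i\<in>I. p i * \<phi> (y i))\<bar> \<le> \<omega>" .
        moreover have "\<bar>(\<Sum>i\<in>I. p i * \<phi> (y i)) - (LINT x|\<gamma>. \<phi> x)\<bar> \<le> \<omega> + 2 * B * measure \<gamma> (- cball 0 R)"
          by (rule close[OF \<phi> B \<omega>])
        ultimately show ?thesis by linarith
      qed
      show ?case using f E W by blast
    qed
  qed
qed

text \<open>Diagonal choice: follow the largest index \<open>n \<le> 1 / \<epsilon>\<close> whose property already holds at \<open>\<epsilon>\<close>.\<close>

lemma diagonal_index:
  fixes P :: "nat \<Rightarrow> real \<Rightarrow> bool"
  assumes ev: "\<And>n. \<forall>\<^sub>F \<epsilon> in at_right 0. P n \<epsilon>" and P0: "\<And>\<epsilon>. P 0 \<epsilon>"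
  obtains N where "\<And>\<epsilon>. P (N \<epsilon>) \<epsilon>" "\<And>m. \<forall>\<^sub>F \<epsilon> in at_right 0. m \<le> N \<epsilon>"
proof -
  define N where "N = (\<lambda>\<epsilon>. Max {n. n \<le> nat \<lceil>1 / \<epsilon>\<rceil> \<and> P n \<epsilon>})"
  have fin: "finite {n. n \<le> nat \<lceil>1 / \<epsilon>\<rceil> \<and> P n \<epsilon>}" for \<epsilon> by auto
  show thesis
  proof (rule that[of N])
    show "P (N \<epsilon>) \<epsilon>" for \<epsilon>
    proof -
      have "N \<epsilon> \<in> {n. n \<le> nat \<lceil>1 / \<epsilon>\<rceil> \<and> P n \<epsilon>}"
        unfolding N_def using P0 by (intro Max_in fin) auto
      then show ?thesis by simp
    qed
    show "\<forall>\<^sub>F \<epsilon> in at_right 0. m \<le> N \<epsilon>" for m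
    proof -
      have "\<forall>\<^sub>F \<epsilon> in at_right 0. \<epsilon> > 0 \<and> \<epsilon> < 1 / (real m + 1)"
        using eventually_at_right_real[of 0 "1 / (real m + 1)"] by (simp add: eventually_mono)
      with ev[of m] show ?thesis
      proof eventually_elim
        case (elim \<epsilon>)
        then have "real m + 1 < 1 / \<epsilon>" by (simp add: field_simps)
        then have "m \<le> nat \<lceil>1 / \<epsilon>\<rceil>" by linarith
        then show ?case unfolding N_def using elim(1) by (intro Max_ge fin) auto
      qed
    qed
  qed
qed

text \<open>The unit margin ensures that two points at distance less than 1 either both lie in the
  compact ball of radius R + 1 or both lie off the support.\<close>

lemma compactly_supported_uniformly_continuous:
  fixes \<phi> :: "real^'n::finite \<Rightarrow> real"
  assumes c: "continuous_on UNIV \<phi>" and s: "compactly_supported \<phi>" and \<omega>: "\<omega> > 0"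
  obtains \<delta> where "\<delta> > 0" "\<And>x x'. dist x x' < \<delta> \<Longrightarrow> \<bar>\<phi> x - \<phi> x'\<bar> \<le> \<omega>"
proof -
  have "bounded (closure {x. \<phi> x \<noteq> 0})" using s by (simp add: compactly_supported_def compact_imp_bounded)
  then obtain R where R: "\<And>x. x \<in> closure {x. \<phi> x \<noteq> 0} \<Longrightarrow> norm x \<le> R" by (auto simp: bounded_iff)
  have z: "\<phi> x = 0" if "norm x > R" for x
  proof -
    have "x \<notin> closure {x. \<phi> x \<noteq> 0}" using R[of x] that by auto
    then show ?thesis by (rule compactly_supported_zero)
  qed
  have "uniformly_continuous_on (cball 0 (R + 1)) \<phi>"
    by (intro compact_uniformly_continuous continuous_on_subset[OF c]) auto
  then obtain d where d: "d > 0" "\<And>x x'. x \<in> cball 0 (R + 1) \<Longrightarrow> x' \<in> cball 0 (R + 1) \<Longrightarrow> dist x' x < d \<Longrightarrow> dist (\<phi> x') (\<phi> x) < \<omega>"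
    using \<omega> unfolding uniformly_continuous_on_def by metis
  show thesis
  proof (rule that[of "min d 1"])
    show "min d 1 > 0" using d by simp
    fix x x' :: "real^'n" assume dist: "dist x x' < min d 1"
    show "\<bar>\<phi> x - \<phi> x'\<bar> \<le> \<omega>"
    proof (cases "norm x \<le> R + 1 \<and> norm x' \<le> R + 1")
      case True
      then show ?thesis using d(2)[of x' x] dist by (simp add: dist_real_def)
    next
      case False
      have "\<bar>norm x - norm x'\<bar> < 1" using dist norm_triangle_ineq3[of x x'] by (simp add: dist_norm)
      then have "norm x > R" "norm x' > R" using False by auto
      then show ?thesis using z \<omega> by simp
    qed
  qed
qed

text \<open>Accuracy 1 / n is reached only for \<epsilon> small depending on n, so the index must
  grow slowly as \<epsilon> tends to 0. Uniform continuity of the test function and the vanishing of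
  the tails of \<gamma> then turn the quantitative estimate \<open>Q\<close> into weak
  convergence.\<close>

lemma recovery_sequence:
  fixes V :: "real^'n::finite \<Rightarrow> real" and \<gamma> :: "(real^'n) measure"
  assumes V: "continuous_on UNIV V" and nn: "\<And>x. 0 \<le> V x"
    and U: "open U" "{x. V x = 0} \<subseteq> U" and C2: "Ck_on 2 U V"
    and \<gamma>: "prob_space \<gamma>" "sets \<gamma> = sets borel" and pos: "emeasure \<gamma> {x. V x > 0} = 0"
  shows "\<exists>\<psi> :: real \<Rightarrow> real^'n \<Rightarrow> 'k::{real_normed_field,euclidean_space}.
           (\<forall>\<epsilon>>0. \<psi> \<epsilon> \<in> H1 \<and> (LINT x|lborel. (norm (\<psi> \<epsilon> x))\<^sup>2) = 1) \<and>
           weakly_converges (\<lambda>\<epsilon>. mass_measure (\<psi> \<epsilon>)) \<gamma> (at_right 0) \<and>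
           Limsup (at_right 0) (\<lambda>\<epsilon>. energy V \<epsilon> (\<psi> \<epsilon>)) \<le> limit_energy V \<gamma>"
proof -
  interpret prob_space \<gamma> by (rule \<gamma>(1))
  have Z: "AE x in \<gamma>. V x = 0"
  proof (rule AE_iff_measurable[THEN iffD2, OF _ _ pos])
    have "open {x. V x > 0}" using V by (intro open_Collect_less continuous_intros)
    then show "{x. V x > 0} \<in> sets \<gamma>" by (simp add: \<gamma>(2))
    show "{x \<in> space \<gamma>. V x \<noteq> 0} = {x. V x > 0}"
      using nn sets_eq_imp_space_eq[OF \<gamma>(2)] by (auto simp: less_le)
  qed
  let ?E = "\<lambda>\<epsilon> f g. LINT x|lborel. \<epsilon> powr (1/2) * ((norm (g x))\<^sup>2 / 2) + \<epsilon> powr (-1/2) * V x * (f x)\<^sup>2"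
  define Q where "Q = (\<lambda>n (f :: real^'n \<Rightarrow> real). \<forall>\<phi> B \<omega>. continuous_on UNIV \<phi> \<longrightarrow> (\<forall>x. \<bar>\<phi> x\<bar> \<le> B) \<longrightarrow> (\<forall>x x'. dist x x' < 1 / real n \<longrightarrow> \<bar>\<phi> x - \<phi> x'\<bar> \<le> \<omega>) \<longrightarrow>
       \<bar>(LINT x|lborel. \<phi> x * (f x)\<^sup>2) - (LINT x|\<gamma>. \<phi> x)\<bar> \<le> 2 * \<omega> + 2 * B * measure \<gamma> (- cball 0 (real n)))"
  \<comment> \<open>For n = 0 only regularity and unit mass are demanded, so that a function is
    available at every \<epsilon>. For positive n the condition \<epsilon> > 0 is stored for
    \<open>C1_compact_energy\<close>.\<close>
  define S where "S = (\<lambda>n \<epsilon> f g. C1_compact f g \<and> (LINT x|lborel. (f x)\<^sup>2) = 1 \<and>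
     (n > 0 \<longrightarrow> \<epsilon> > 0 \<and> ennreal (?E \<epsilon> f g) \<le> limit_energy V \<gamma> + ennreal (1 / real n) \<and> Q n f))"
  define P where "P = (\<lambda>n \<epsilon>. \<exists>f g. S n \<epsilon> f g)"
  have P0: "P 0 \<epsilon>" for \<epsilon>
  proof -
    have "pos_semidef (0 :: real^'n^'n)" by (simp add: pos_semidef_def transpose_def vec_eq_iff)
    from optimal_profile[OF this zero_less_one] obtain u :: "real^'n \<Rightarrow> real" and g
      where "C1_compact u g" "(LINT x|lborel. (u x)\<^sup>2) = 1" by blast
    then have "S 0 \<epsilon> u g" by (simp add: S_def)
    then show ?thesis by (auto simp: P_def)
  qed
  have ev: "\<forall>\<^sub>F \<epsilon> in at_right 0. P n \<epsilon>" for n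
  proof (cases "n > 0")
    case True
    then have "1 / real n > 0" by simp
    from approximate_recovery[OF V nn U C2 \<gamma> Z this, of "real n"] eventually_at_right_less[of 0]
    show ?thesis
    proof eventually_elim
      case (elim \<epsilon>)
      then show ?case unfolding P_def S_def Q_def by blast
    qed
  qed (use P0 in simp)
  from diagonal_index[of P, OF ev P0] obtain N where N: "\<And>\<epsilon>. P (N \<epsilon>) \<epsilon>" "\<And>m. \<forall>\<^sub>F \<epsilon> in at_right 0. m \<le> N \<epsilon>"
    by blast
  have "\<forall>\<epsilon>. \<exists>f g. S (N \<epsilon>) \<epsilon> f g" using N(1) by (simp add: P_def)
  then obtain f g where "\<And>\<epsilon>. S (N \<epsilon>) \<epsilon> (f \<epsilon>) (g \<epsilon>)" by metis
  then have f: "\<And>\<epsilon>. C1_compact (f \<epsilon>) (g \<epsilon>)" "\<And>\<epsilon>. (LINT x|lborel. (f \<epsilon> x)\<^sup>2) = 1"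
    and fN: "\<And>\<epsilon>. N \<epsilon> > 0 \<Longrightarrow> \<epsilon> > 0" "\<And>\<epsilon>. N \<epsilon> > 0 \<Longrightarrow> ennreal (?E \<epsilon> (f \<epsilon>) (g \<epsilon>)) \<le> limit_energy V \<gamma> + ennreal (1 / real (N \<epsilon>))"
      "\<And>\<epsilon>. N \<epsilon> > 0 \<Longrightarrow> Q (N \<epsilon>) (f \<epsilon>)"
    unfolding S_def by blast+
  define \<psi> where "\<psi> = (\<lambda>\<epsilon> x. of_real (f \<epsilon> x) :: 'k)"
  have H: "\<psi> \<epsilon> \<in> H1" for \<epsilon> unfolding \<psi>_def by (rule C1_compact_H1[OF f(1)])
  have n2: "(norm (\<psi> \<epsilon> x))\<^sup>2 = (f \<epsilon> x)\<^sup>2" for \<epsilon> x by (simp add: \<psi>_def)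
  have W: "weakly_converges (\<lambda>\<epsilon>. mass_measure (\<psi> \<epsilon>)) \<gamma> (at_right 0)"
    unfolding weakly_converges_def
  proof (intro allI impI)
    fix \<phi> :: "real^'n \<Rightarrow> real" assume "continuous_on UNIV \<phi> \<and> compactly_supported \<phi>"
    then have \<phi>: "continuous_on UNIV \<phi>" "compactly_supported \<phi>" by auto
    have \<phi>m: "\<phi> \<in> borel_measurable borel" using \<phi>(1) by (rule borel_measurable_continuous_onI)
    obtain B where B: "0 \<le> B" "\<And>x. \<bar>\<phi> x\<bar> \<le> B" using compactly_supported_bounded[OF \<phi>] by blast
    have "(\<lambda>n. measure \<gamma> (- cball 0 (real n))) \<longlonglongrightarrow> measure \<gamma> (\<Inter>n::nat. - cball (0::real^'n) (real n))"
      by (rule finite_Lim_measure_decseq) (auto simp: \<gamma>(2) decseq_def)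
    moreover have "(\<Inter>n::nat. - cball (0::real^'n) (real n)) = {}"
    proof -
      have "\<exists>n::nat. norm x \<le> real n" for x :: "real^'n" by (rule real_arch_simple)
      then show ?thesis by (simp add: set_eq_iff)
    qed
    ultimately have "(\<lambda>n. measure \<gamma> (- cball (0::real^'n) (real n))) \<longlonglongrightarrow> 0" by simp
    then have tail: "(\<lambda>n. 2 * B * measure \<gamma> (- cball (0::real^'n) (real n))) \<longlonglongrightarrow> 2 * B * 0" by (intro tendsto_intros)
    show "((\<lambda>\<epsilon>. LINT x|mass_measure (\<psi> \<epsilon>). \<phi> x) \<longlongrightarrow> (LINT x|\<gamma>. \<phi> x)) (at_right 0)"
    proof (rule tendstoI)
      fix e :: real assume e: "e > 0"
      then have "e / 4 > 0" by simp
      from compactly_supported_uniformly_continuous[OF \<phi> this]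
      obtain \<delta> where \<delta>: "\<delta> > 0" "\<And>x x'. dist x x' < \<delta> \<Longrightarrow> \<bar>\<phi> x - \<phi> x'\<bar> \<le> e / 4" by blast
      have "\<forall>\<^sub>F n in sequentially. 2 * B * measure \<gamma> (- cball (0::real^'n) (real n)) < e / 2"
        by (rule order_tendstoD(2)[OF tail]) (use e in simp)
      then obtain m1 where m1: "\<And>n. n \<ge> m1 \<Longrightarrow> 2 * B * measure \<gamma> (- cball (0::real^'n) (real n)) < e / 2"
        by (auto simp: eventually_sequentially)
      \<comment> \<open>Beyond this index the mesh 1 / N is finer than the modulus of continuity
        \<delta>.\<close>
      obtain m2 :: nat where m2: "1 / \<delta> < real m2" using reals_Archimedean2 by blast
      from N(2)[of "max 1 (max m1 m2)"]
      show "\<forall>\<^sub>F \<epsilon> in at_right 0. dist (LINT x|mass_measure (\<psi> \<epsilon>). \<phi> x) (LINT x|\<gamma>. \<phi> x) < e"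
      proof eventually_elim
        case (elim \<epsilon>)
        then have n: "N \<epsilon> > 0" "N \<epsilon> \<ge> m1" "real m2 \<le> real (N \<epsilon>)" by auto
        have "1 / \<delta> < real (N \<epsilon>)" using m2 n(3) by linarith
        then have "1 / real (N \<epsilon>) < \<delta>" using \<delta>(1) n(1) by (simp add: field_simps)
        then have "\<forall>x x'. dist x x' < 1 / real (N \<epsilon>) \<longrightarrow> \<bar>\<phi> x - \<phi> x'\<bar> \<le> e / 4" using \<delta>(2) by force
        then have "\<bar>(LINT x|lborel. \<phi> x * (f \<epsilon> x)\<^sup>2) - (LINT x|\<gamma>. \<phi> x)\<bar> \<le> 2 * (e / 4) + 2 * B * measure \<gamma> (- cball 0 (real (N \<epsilon>)))"
          using fN(3)[OF n(1)] \<phi>(1) B(2) unfolding Q_def by blast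
        also have "\<dots> < e" using m1[OF n(2)] by linarith
        finally show ?case by (simp add: integral_mass_measure[OF H \<phi>m] n2 dist_real_def)
      qed
    qed
  qed
  have "Limsup (at_right 0) (\<lambda>\<epsilon>. energy V \<epsilon> (\<psi> \<epsilon>)) \<le> limit_energy V \<gamma>"
  proof (rule ennreal_le_epsilon)
    fix e :: real assume e: "e > 0"
    obtain m :: nat where m: "1 / e < real m" using reals_Archimedean2 by blast
    show "Limsup (at_right 0) (\<lambda>\<epsilon>. energy V \<epsilon> (\<psi> \<epsilon>)) \<le> limit_energy V \<gamma> + ennreal e"
    proof (rule Limsup_bounded)
      show "\<forall>\<^sub>F \<epsilon> in at_right 0. energy V \<epsilon> (\<psi> \<epsilon>) \<le> limit_energy V \<gamma> + ennreal e"
        using N(2)[of "max 1 m"]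
      proof eventually_elim
        case (elim \<epsilon>)
        then have n: "N \<epsilon> > 0" "real m \<le> real (N \<epsilon>)" by auto
        have "1 / e < real (N \<epsilon>)" using m n(2) by linarith
        then have "1 / real (N \<epsilon>) \<le> e" using e n(1) by (simp add: field_simps)
        have "energy V \<epsilon> (\<psi> \<epsilon>) = ennreal (?E \<epsilon> (f \<epsilon>) (g \<epsilon>))"
          unfolding \<psi>_def by (rule C1_compact_energy[OF f(1) V nn fN(1)[OF n(1)]])
        also have "\<dots> \<le> limit_energy V \<gamma> + ennreal (1 / real (N \<epsilon>))" by (rule fN(2)[OF n(1)])
        also have "\<dots> \<le> limit_energy V \<gamma> + ennreal e"
          using \<open>1 / real (N \<epsilon>) \<le> e\<close> by (intro add_left_mono ennreal_leI)
        finally show ?case .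
      qed
    qed
  qed
  moreover have "\<forall>\<epsilon>>0. \<psi> \<epsilon> \<in> H1 \<and> (LINT x|lborel. (norm (\<psi> \<epsilon> x))\<^sup>2) = 1"
    using H f(2) by (simp add: n2)
  ultimately show ?thesis using W by blast
qed

theorem theorem1p2:
  fixes V :: "real^'n::finite \<Rightarrow> real"
  assumes "continuous_on UNIV V"
    and "\<And>x. 0 \<le> V x"
    and "\<exists>U. open U \<and> {x. V x = 0} \<subseteq> U \<and> Ck_on 2 U V"
  shows
    "(\<forall>(\<epsilon> :: nat \<Rightarrow> real) (\<psi> :: nat \<Rightarrow> real^'n \<Rightarrow> 'k::{real_normed_field,euclidean_space}).
        (\<forall>n. 0 < \<epsilon> n) \<and> \<epsilon> \<longlonglongrightarrow> 0 \<and>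
        (\<forall>n. \<psi> n \<in> H1 \<and> (LINT x|lborel. (norm (\<psi> n x))\<^sup>2) = 1) \<and>
        liminf (\<lambda>n. energy V (\<epsilon> n) (\<psi> n)) < \<infinity> \<longrightarrow>
        (\<exists>\<gamma> :: (real^'n) measure.
           sets \<gamma> = sets borel \<and> emeasure \<gamma> {x. V x > 0} = 0 \<and> emeasure \<gamma> UNIV \<le> 1 \<and>
           (\<exists>r :: nat \<Rightarrow> nat. strict_mono r \<and>
              weakly_converges (\<lambda>k. mass_measure (\<psi> (r k))) \<gamma> sequentially) \<and>
           liminf (\<lambda>n. energy V (\<epsilon> n) (\<psi> n)) \<ge> limit_energy V \<gamma>))
     \<and>
     (\<forall>\<gamma> :: (real^'n) measure.
        prob_space \<gamma> \<and> sets \<gamma> = sets borel \<and> emeasure \<gamma> {x. V x > 0} = 0 \<longrightarrow>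
        (\<exists>\<psi> :: real \<Rightarrow> real^'n \<Rightarrow> 'k.
           (\<forall>\<epsilon>>0. \<psi> \<epsilon> \<in> H1 \<and> (LINT x|lborel. (norm (\<psi> \<epsilon> x))\<^sup>2) = 1) \<and>
           weakly_converges (\<lambda>\<epsilon>. mass_measure (\<psi> \<epsilon>)) \<gamma> (at_right 0) \<and>
           Limsup (at_right 0) (\<lambda>\<epsilon>. energy V \<epsilon> (\<psi> \<epsilon>)) \<le> limit_energy V \<gamma>))"
proof -
  obtain U where U: "open U" "{x. V x = 0} \<subseteq> U" and C2: "Ck_on 2 U V" using assms(3) by blast
  show ?thesis
  proof (intro conjI allI impI)
    fix \<epsilon> :: "nat \<Rightarrow> real" and \<psi> :: "nat \<Rightarrow> real^'n \<Rightarrow> 'k"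
    assume h: "(\<forall>n. 0 < \<epsilon> n) \<and> \<epsilon> \<longlonglongrightarrow> 0 \<and>
        (\<forall>n. \<psi> n \<in> H1 \<and> (LINT x|lborel. (norm (\<psi> n x))\<^sup>2) = 1) \<and>
        liminf (\<lambda>n. energy V (\<epsilon> n) (\<psi> n)) < \<infinity>"
    show "\<exists>\<gamma> :: (real^'n) measure.
           sets \<gamma> = sets borel \<and> emeasure \<gamma> {x. V x > 0} = 0 \<and> emeasure \<gamma> UNIV \<le> 1 \<and>
           (\<exists>r :: nat \<Rightarrow> nat. strict_mono r \<and>
              weakly_converges (\<lambda>k. mass_measure (\<psi> (r k))) \<gamma> sequentially) \<and>
           liminf (\<lambda>n. energy V (\<epsilon> n) (\<psi> n)) \<ge> limit_energy V \<gamma>"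
      by (rule compactness_and_liminf[OF assms(1,2) U C2]) (use h in auto)
  next
    fix \<gamma> :: "(real^'n) measure"
    assume "prob_space \<gamma> \<and> sets \<gamma> = sets borel \<and> emeasure \<gamma> {x. V x > 0} = 0"
    then show "\<exists>\<psi> :: real \<Rightarrow> real^'n \<Rightarrow> 'k.
           (\<forall>\<epsilon>>0. \<psi> \<epsilon> \<in> H1 \<and> (LINT x|lborel. (norm (\<psi> \<epsilon> x))\<^sup>2) = 1) \<and>
           weakly_converges (\<lambda>\<epsilon>. mass_measure (\<psi> \<epsilon>)) \<gamma> (at_right 0) \<and>
           Limsup (at_right 0) (\<lambda>\<epsilon>. energy V \<epsilon> (\<psi> \<epsilon>)) \<le> limit_energy V \<gamma>"
      by (intro recovery_sequence[OF assms(1,2) U C2]) auto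
  qed
qed

end
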